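(* Let $(M,h)$ be a Riemannian manifold of even dimension $n\ge2$. Then the polynomial (in $\lambda$) $$\mathcal V_n(\lambda) = \left[\left(\lambda-\tfrac n2+1\right)\cdots(\lambda-1)\lambda\right]\sum_{j=0}^{n/2}(n+2j)\,\mathcal T_{2j}^*(\lambda)(v_{n-2j})$$ vanishes identically: $\mathcal V_n(\lambda)=0$. Here $v_{2j}$ are the holographic coefficients of $h$ and $\mathcal T_{2j}^*(\lambda)$ is the formal adjoint of the operator $\mathcal T_{2j}(\lambda)=\mathcal T_{2j}(h;\lambda)$.
   Context: The bracketed prefactor is the product $\prod_{k=0}^{n/2-1}(\lambda-k)$. Poincaré-Einstein metric ($n$ even). On $M\times(0,\varepsilon)$ consider $g_+=r^{-2}(dr^2+h_r)$, where $h_r=h+r^2h_{(2)}+\dots+r^{n-2}h_{(n-2)}+r^n(h_{(n)}+\log r\,\bar h_{(n)})+\cdots$ is a one-parameter family of metrics on $M$ such that $\mathrm{Ric}(g_+)+n g_+=O(r^{n-2})$ and the restriction to $TM$ of $r^{2-n}(\mathrm{Ric}(g_+)+n g_+)$ at $r=0$ has vanishing trace with respect to $h$. These conditions determine $h_{(2)},\dots,h_{(n-2)}$ and $\mathrm{tr}_h(h_{(n)})$ uniquely in terms of $h$, and $\mathrm{tr}_h(\bar h_{(n)})=0$; the quantities below depend only on these data. Holographic coefficients. Write $v(r)=\mathrm{dvol}(h_r)/\mathrm{dvol}(h)=1+v_2r^2+v_4r^4+\cdots$ and $v_0=1$. The functions $v_{2j}\in C^\infty(M)$, $0\le 2j\le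 n$, are determined by $h$. Operators $\mathcal T_{2j}(\lambda)$. All Laplacians $\Delta$ are non-positive. For $f\in C^\infty(M)$ and generic $\lambda\in\mathbb C$, there are unique coefficients $\mathcal T_{2j}(\lambda)f$, $0\le j\le n/2$, with $\mathcal T_0(\lambda)=\mathrm{Id}$ such that $u=\sum_{j=0}^{n/2} r^{\lambda+2j}\,\mathcal T_{2j}(\lambda)f$ satisfies $\Delta_{g_+}u+\lambda(n-\lambda)u=O(r^{\lambda+n+1})$. The $\mathcal T_{2j}(\lambda)=\mathcal T_{2j}(h;\lambda)$ are differential operators on $M$, rational in $\lambda$, with at most simple poles contained in $\{\frac n2-1,\dots,\frac n2-j\}$. The formal adjoint $\mathcal T_{2j}^*(\lambda)$ is taken with respect to $\mathrm{dvol}(h)$ and the bilinear pairing: $\int_M \mathcal T_{2j}(\lambda)(f)\,g\,\mathrm{dvol}(h)=\int_M f\,\mathcal T_{2j}^*(\lambda)(g)\,\mathrm{dvol}(h)$ for compactly supported $f$. *)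

theory Defs
  imports "HOL-Analysis.Analysis" "HOL-Computational_Algebra.Polynomial"
begin

section \<open>Smooth maps between Euclidean spaces\<close>

text \<open>Only used for open \<open>S\<close> and finite-dimensional domains, where it is the usual \<open>C\<^sup>k\<close> condition.\<close>

primrec Ck_on ::
  "nat \<Rightarrow> 'a::real_normed_vector set \<Rightarrow> ('a \<Rightarrow> 'b::real_normed_vector) \<Rightarrow> bool" where
  "Ck_on 0 S f \<longleftrightarrow> continuous_on S f"
| "Ck_on (Suc k) S f \<longleftrightarrow>
     (\<forall>x\<in>S. f differentiable (at x)) \<and> (\<forall>w. Ck_on k S (\<lambda>x. frechet_derivative f (at x) w))"

definition smooth_on :: "'a::real_normed_vector set \<Rightarrow> ('a \<Rightarrow> 'b::real_normed_vector) \<Rightarrow> bool" where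
  "smooth_on S f \<longleftrightarrow> (\<forall>k. Ck_on k S f)"

definition pderivative :: "'k::finite \<Rightarrow> (real^'k \<Rightarrow> 'b::real_normed_vector) \<Rightarrow> real^'k \<Rightarrow> 'b" where
  "pderivative i f p = frechet_derivative f (at p) (axis i 1)"


section \<open>Riemannian geometry in coordinates\<close>

text \<open>A metric on an open subset of \<open>\<real>\<^sup>k\<close> is given by its component matrix \<open>g p $ i $ j\<close>.\<close>

definition christoffel ::
  "(real^'k \<Rightarrow> real^'k^'k) \<Rightarrow> 'k::finite \<Rightarrow> 'k \<Rightarrow> 'k \<Rightarrow> real^'k \<Rightarrow> real" where
  "christoffel g k i j p =
     (\<Sum>l\<in>UNIV. (matrix_inv (g p) $ k $ l) *
        (pderivative i (\<lambda>q. g q $ j $ l) p + pderivative j (\<lambda>q. g q $ i $ l) p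
          - pderivative l (\<lambda>q. g q $ i $ j) p)) / 2"

definition ricci :: "(real^'k \<Rightarrow> real^'k^'k) \<Rightarrow> real^'k \<Rightarrow> real^'k^'k::finite" where
  "ricci g p = (\<chi> i j.
     (\<Sum>k\<in>UNIV. pderivative k (christoffel g k i j) p - pderivative j (christoffel g k i k) p)
     + (\<Sum>k\<in>UNIV. \<Sum>l\<in>UNIV. christoffel g k k l p * christoffel g l i j p
                          - christoffel g k j l p * christoffel g l i k p))"

text \<open>Non-positive sign convention.\<close>

definition laplacian ::
  "(real^'k \<Rightarrow> real^'k^'k) \<Rightarrow> (real^'k::finite \<Rightarrow> complex) \<Rightarrow> real^'k \<Rightarrow> complex" where
  "laplacian g u p =
     (\<Sum>i\<in>UNIV. \<Sum>j\<in>UNIV. (matrix_inv (g p) $ i $ j) *\<^sub>R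
        (pderivative i (pderivative j u) p
          - (\<Sum>k\<in>UNIV. christoffel g k i j p *\<^sub>R pderivative k u p)))"


section \<open>Smooth manifolds and tensor fields\<close>

text \<open>A chart \<open>(U, \<phi>)\<close> consists of its domain and its coordinate map.  The points of the
  manifold are the elements of the carrier of an abstract topology.\<close>

type_synonym ('m, 'n) chart = "'m set \<times> ('m \<Rightarrow> real^'n)"

definition cdom :: "('m, 'n::finite) chart \<Rightarrow> 'm set" where
  "cdom c = fst c"

definition cimg :: "('m, 'n::finite) chart \<Rightarrow> (real^'n) set" where
  "cimg c = snd c ` fst c"

definition cinv :: "('m, 'n::finite) chart \<Rightarrow> real^'n \<Rightarrow> 'm" where
  "cinv c = inv_into (fst c) (snd c)"

definition transition :: "('m, 'n::finite) chart \<Rightarrow> ('m, 'n) chart \<Rightarrow> real^'n \<Rightarrow> real^'n" where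
  "transition c d = snd d \<circ> cinv c"

definition smooth_manifold :: "'m topology \<Rightarrow> ('m, 'n::finite) chart set \<Rightarrow> bool" where
  "smooth_manifold X A \<longleftrightarrow>
     Hausdorff_space X \<and> second_countable X \<and>
     (\<forall>c\<in>A. openin X (cdom c) \<and> open (cimg c) \<and>
        homeomorphic_map (subtopology X (cdom c)) (top_of_set (cimg c)) (snd c)) \<and>
     (\<Union>c\<in>A. cdom c) = topspace X \<and>
     (\<forall>c\<in>A. \<forall>d\<in>A. smooth_on (snd c ` (cdom c \<inter> cdom d)) (transition c d))"

definition smooth_fun ::
  "('m, 'n::finite) chart set \<Rightarrow> ('m \<Rightarrow> 'b::real_normed_vector) \<Rightarrow> bool" where
  "smooth_fun A f \<longleftrightarrow> (\<forall>c\<in>A. smooth_on (cimg c) (f \<circ> cinv c))"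

definition compact_support :: "'m topology \<Rightarrow> ('m \<Rightarrow> complex) \<Rightarrow> bool" where
  "compact_support X f \<longleftrightarrow> (\<exists>K. compactin X K \<and> (\<forall>x\<in>topspace X - K. f x = 0))"

text \<open>A symmetric two-tensor is given by its component matrices: \<open>h c p\<close> contains the components
  at the point with coordinates \<open>p\<close> in the chart \<open>c\<close>.\<close>

type_synonym ('m, 'n) tensor2 = "('m, 'n) chart \<Rightarrow> real^'n \<Rightarrow> real^'n^'n"

definition sym_tensor_field :: "('m, 'n::finite) chart set \<Rightarrow> ('m, 'n) tensor2 \<Rightarrow> bool" where
  "sym_tensor_field A h \<longleftrightarrow>
     (\<forall>c\<in>A. smooth_on (cimg c) (h c) \<and> (\<forall>p\<in>cimg c. transpose (h c p) = h c p)) \<and>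
     (\<forall>c\<in>A. \<forall>d\<in>A. \<forall>p\<in>snd c ` (cdom c \<inter> cdom d).
        let J = matrix (frechet_derivative (transition c d) (at p))
        in h c p = transpose J ** h d (transition c d p) ** J)"

definition riemannian_metric :: "('m, 'n::finite) chart set \<Rightarrow> ('m, 'n) tensor2 \<Rightarrow> bool" where
  "riemannian_metric A h \<longleftrightarrow>
     sym_tensor_field A h \<and>
     (\<forall>c\<in>A. \<forall>p\<in>cimg c. \<forall>w. w \<noteq> 0 \<longrightarrow> w \<bullet> (h c p *v w) > 0)"

definition riemannian_manifold ::
  "'m topology \<Rightarrow> ('m, 'n::finite) chart set \<Rightarrow> ('m, 'n) tensor2 \<Rightarrow> bool" where
  "riemannian_manifold X A h \<longleftrightarrow> smooth_manifold X A \<and> riemannian_metric A h"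

text \<open>The measure \<open>dvol(h)\<close>.  The condition determines \<open>\<mu>\<close>, since countably many charts cover
  the manifold.\<close>

definition volume_measure ::
  "'m topology \<Rightarrow> ('m, 'n::finite) chart set \<Rightarrow> ('m, 'n) tensor2 \<Rightarrow> 'm measure \<Rightarrow> bool" where
  "volume_measure X A h \<mu> \<longleftrightarrow>
     space \<mu> = topspace X \<and>
     sets \<mu> = sigma_sets (topspace X) {U. openin X U} \<and>
     (\<forall>c\<in>A. \<forall>B\<in>sets \<mu>. B \<subseteq> cdom c \<longrightarrow>
        emeasure \<mu> B = (\<integral>\<^sup>+p. ennreal (sqrt (det (h c p))) * indicator (snd c ` B) p \<partial>lborel))"


section \<open>Poincare--Einstein metrics\<close>

text \<open>Coordinates on \<open>M \<times> (0, \<epsilon>)\<close> are indexed by \<open>'n option\<close>: \<open>None\<close> is the index of \<open>r\<close> and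
  \<open>Some i\<close> that of the \<open>i\<close>-th coordinate on \<open>M\<close>.\<close>

definition mk_pt :: "real^'n \<Rightarrow> real \<Rightarrow> real^('n::finite option)" where
  "mk_pt x r = (\<chi> k. case k of None \<Rightarrow> r | Some i \<Rightarrow> x $ i)"

definition base_pt :: "real^('n::finite option) \<Rightarrow> real^'n" where
  "base_pt p = (\<chi> i. p $ Some i)"

definition cylinder :: "(real^'n) set \<Rightarrow> real \<Rightarrow> (real^('n::finite option)) set" where
  "cylinder S \<epsilon> = {p. base_pt p \<in> S \<and> 0 < p $ None \<and> p $ None < \<epsilon>}"

text \<open>\<open>F = O(r\<^sup>s)\<close> as \<open>r \<rightarrow> 0\<close>, locally uniformly on \<open>S\<close>.\<close>

definition O_bdry ::
  "(real^'n) set \<Rightarrow> (real^('n::finite option) \<Rightarrow> 'b::real_normed_vector) \<Rightarrow> real \<Rightarrow> bool" where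
  "O_bdry S F s \<longleftrightarrow>
     (\<forall>K. compact K \<and> K \<subseteq> S \<longrightarrow>
        (\<exists>C \<delta>. 0 < \<delta> \<and> (\<forall>x\<in>K. \<forall>r. 0 < r \<and> r < \<delta> \<longrightarrow> norm (F (mk_pt x r)) \<le> C * r powr s)))"

text \<open>Iterated derivatives along the vector fields \<open>r \<partial>\<^sub>r\<close> and \<open>\<partial>\<^sub>i\<close>.  In an asymptotic
  expansion the remainder has the same order after any number of these.\<close>

primrec bderiv ::
  "'n::finite option list \<Rightarrow> (real^('n option) \<Rightarrow> 'b::real_normed_vector) \<Rightarrow> real^('n option) \<Rightarrow> 'b"
where
  "bderiv [] F = F"
| "bderiv (k # ks) F =
     (\<lambda>p. (case k of None \<Rightarrow> p $ None | Some i \<Rightarrow> 1) *\<^sub>R pderivative k (bderiv ks F) p)"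

text \<open>The components of \<open>g\<^sub>+ = r\<^sup>-\<^sup>2 (dr\<^sup>2 + h\<^sub>r)\<close> over the chart \<open>c\<close>; here \<open>hr r\<close> is \<open>h\<^sub>r\<close>.\<close>

definition gplus ::
  "(real \<Rightarrow> ('m, 'n::finite) tensor2) \<Rightarrow> ('m, 'n) chart \<Rightarrow>
   real^('n option) \<Rightarrow> real^('n option)^('n option)" where
  "gplus hr c p = (\<chi> k l. (case (k, l) of
        (None, None) \<Rightarrow> 1
      | (Some i, Some j) \<Rightarrow> hr (p $ None) c (base_pt p) $ i $ j
      | _ \<Rightarrow> 0) / (p $ None)\<^sup>2)"

text \<open>\<open>h\<^sub>r = h + r\<^sup>2 h\<^sub>(\<^sub>2\<^sub>) + \<dots> + r\<^sup>n (h\<^sub>(\<^sub>n\<^sub>) + log r \<cdot> hbar) + O(r\<^sup>n\<^sup>+\<^sup>1)\<close> with \<open>n\<close> the dimension;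
  \<open>hk j\<close> is \<open>h\<^sub>(\<^sub>2\<^sub>j\<^sub>)\<close>.\<close>

definition metric_expansion ::
  "('m, 'n::finite) chart set \<Rightarrow> ('m, 'n) tensor2 \<Rightarrow> (real \<Rightarrow> ('m, 'n) tensor2) \<Rightarrow> bool" where
  "metric_expansion A h hr \<longleftrightarrow>
     (\<exists>hk hbar.
        (\<forall>j. sym_tensor_field A (hk j)) \<and> sym_tensor_field A hbar \<and>
        (\<forall>c\<in>A. \<forall>p\<in>cimg c. hk 0 c p = h c p) \<and>
        (\<forall>c\<in>A. \<forall>ks. O_bdry (cimg c)
           (bderiv ks (\<lambda>p. hr (p $ None) c (base_pt p)
              - (\<Sum>j\<le>CARD('n) div 2. (p $ None) ^ (2*j) *\<^sub>R hk j c (base_pt p))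
              - ((p $ None) ^ CARD('n) * ln (p $ None)) *\<^sub>R hbar c (base_pt p)))
           (real CARD('n) + 1)))"

definition einstein_defect ::
  "(real \<Rightarrow> ('m, 'n::finite) tensor2) \<Rightarrow> ('m, 'n) chart \<Rightarrow>
   real^('n option) \<Rightarrow> real^('n option)^('n option)" where
  "einstein_defect hr c p = ricci (gplus hr c) p + real CARD('n) *\<^sub>R gplus hr c p"

definition poincare_einstein ::
  "('m, 'n::finite) chart set \<Rightarrow> ('m, 'n) tensor2 \<Rightarrow> real \<Rightarrow> (real \<Rightarrow> ('m, 'n) tensor2) \<Rightarrow> bool" where
  "poincare_einstein A h \<epsilon> hr \<longleftrightarrow>
     0 < \<epsilon> \<and>
     (\<forall>r. 0 < r \<and> r < \<epsilon> \<longrightarrow> riemannian_metric A (hr r)) \<and>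
     (\<forall>c\<in>A. smooth_on (cylinder (cimg c) \<epsilon>) (\<lambda>p. hr (p $ None) c (base_pt p))) \<and>
     metric_expansion A h hr \<and>
     (\<forall>c\<in>A. O_bdry (cimg c) (einstein_defect hr c) (real CARD('n) - 2)) \<and>
     (\<forall>c\<in>A. \<forall>x\<in>cimg c. \<exists>E :: real^'n^'n.
        (\<forall>i j. ((\<lambda>r. r powr (2 - real CARD('n)) * einstein_defect hr c (mk_pt x r) $ Some i $ Some j)
                  \<longlongrightarrow> E $ i $ j) (at_right 0)) \<and>
        trace (matrix_inv (h c x) ** E) = 0)"


section \<open>Holographic coefficients and the operators \<open>\<T>\<^sub>2\<^sub>j(lam)\<close>\<close>

text \<open>\<open>v k\<close> is \<open>v\<^sub>k\<close>; only even \<open>k \<le> n\<close> are constrained, and there \<open>v\<close> is determined on the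
  manifold by the expansion of \<open>dvol(h\<^sub>r) / dvol(h)\<close>.\<close>

definition holographic_coeffs ::
  "('m, 'n::finite) chart set \<Rightarrow> ('m, 'n) tensor2 \<Rightarrow> (real \<Rightarrow> ('m, 'n) tensor2) \<Rightarrow>
   (nat \<Rightarrow> 'm \<Rightarrow> real) \<Rightarrow> bool" where
  "holographic_coeffs A h hr v \<longleftrightarrow>
     (\<forall>c\<in>A. \<forall>x\<in>cdom c. v 0 x = 1) \<and>
     (\<forall>j\<le>CARD('n) div 2. smooth_fun A (v (2*j))) \<and>
     (\<forall>c\<in>A. O_bdry (cimg c)
        (\<lambda>p. sqrt (det (hr (p $ None) c (base_pt p))) / sqrt (det (h c (base_pt p)))
             - (\<Sum>j\<le>CARD('n) div 2. v (2*j) (cinv c (base_pt p)) * (p $ None) ^ (2*j)))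
        (real CARD('n) + 1))"

text \<open>\<open>t j\<close> plays the role of \<open>\<T>\<^sub>2\<^sub>j(lam) f\<close>.  The order \<open>O(r powr (lam + n + 1))\<close> of the defect is
  measured by the real part of the exponent.\<close>

definition eigen_ansatz ::
  "('m, 'n::finite) chart \<Rightarrow> complex \<Rightarrow> (nat \<Rightarrow> 'm \<Rightarrow> complex) \<Rightarrow> real^('n option) \<Rightarrow> complex" where
  "eigen_ansatz c lam t p =
     (\<Sum>j\<le>CARD('n) div 2. of_real (p $ None) powr (lam + 2 * of_nat j) * t j (cinv c (base_pt p)))"

definition solution_coeffs ::
  "('m, 'n::finite) chart set \<Rightarrow> (real \<Rightarrow> ('m, 'n) tensor2) \<Rightarrow> complex \<Rightarrow>
   ('m \<Rightarrow> complex) \<Rightarrow> (nat \<Rightarrow> 'm \<Rightarrow> complex) \<Rightarrow> bool" where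
  "solution_coeffs A hr lam f t \<longleftrightarrow>
     (\<forall>j\<le>CARD('n) div 2. smooth_fun A (t j)) \<and>
     (\<forall>c\<in>A. \<forall>x\<in>cdom c. t 0 x = f x) \<and>
     (\<forall>c\<in>A. O_bdry (cimg c)
        (\<lambda>p. laplacian (gplus hr c) (eigen_ansatz c lam t) p
             + lam * (of_nat CARD('n) - lam) * eigen_ansatz c lam t p)
        (Re lam + real CARD('n) + 1))"

text \<open>\<open>lam\<close> is generic if it lies outside \<open>{n/2 - 1, \<dots>, n/2 - n/2}\<close>, the possible poles of the
  operators with \<open>0 \<le> j \<le> n/2\<close>; for such \<open>lam\<close> the coefficients exist and are unique.\<close>

definition generic :: "nat \<Rightarrow> complex \<Rightarrow> bool" where
  "generic n lam \<longleftrightarrow> (\<forall>k\<in>{1..n div 2}. lam \<noteq> of_nat (n div 2) - of_nat k)"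

text \<open>\<open>T j lam\<close> is \<open>\<T>\<^sub>2\<^sub>j(lam)\<close>.\<close>

definition solution_operators ::
  "('m, 'n::finite) chart set \<Rightarrow> (real \<Rightarrow> ('m, 'n) tensor2) \<Rightarrow>
   (nat \<Rightarrow> complex \<Rightarrow> ('m \<Rightarrow> complex) \<Rightarrow> 'm \<Rightarrow> complex) \<Rightarrow> bool" where
  "solution_operators A hr T \<longleftrightarrow>
     (\<forall>lam. generic CARD('n) lam \<longrightarrow>
        (\<forall>f. smooth_fun A f \<longrightarrow> solution_coeffs A hr lam f (\<lambda>j. T j lam f)))"

definition formal_adjoint ::
  "'m topology \<Rightarrow> ('m, 'n::finite) chart set \<Rightarrow> 'm measure \<Rightarrow>
   (('m \<Rightarrow> complex) \<Rightarrow> 'm \<Rightarrow> complex) \<Rightarrow> (('m \<Rightarrow> complex) \<Rightarrow> 'm \<Rightarrow> complex) \<Rightarrow> bool" where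
  "formal_adjoint X A \<mu> P Q \<longleftrightarrow>
     (\<forall>g. smooth_fun A g \<longrightarrow> smooth_fun A (Q g)) \<and>
     (\<forall>f g. smooth_fun A f \<and> compact_support X f \<and> smooth_fun A g \<longrightarrow>
        (LINT x|\<mu>. P f x * g x) = (LINT x|\<mu>. f x * Q g x))"

text \<open>The defining formula of \<open>\<V>\<^sub>n(lam)\<close>, meaningful for generic \<open>lam\<close>; \<open>Ts j lam\<close> is the formal
  adjoint of \<open>\<T>\<^sub>2\<^sub>j(lam)\<close>.\<close>

definition calV ::
  "nat \<Rightarrow> (nat \<Rightarrow> complex \<Rightarrow> ('m \<Rightarrow> complex) \<Rightarrow> 'm \<Rightarrow> complex) \<Rightarrow> (nat \<Rightarrow> 'm \<Rightarrow> real) \<Rightarrow>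
   complex \<Rightarrow> 'm \<Rightarrow> complex" where
  "calV n Ts v lam x =
     (\<Prod>k<n div 2. lam - of_nat k) *
     (\<Sum>j\<le>n div 2. of_nat (n + 2*j) * Ts j lam (\<lambda>y. of_real (v (n - 2*j) y)) x)"

end

theory Submission
  imports Defs "HOL-Library.Landau_Symbols"
begin

text \<open>
  The identity is the coefficient of \<open>r\<close> to the power \<open>lam + n\<close> in the eigenvalue equation, after
  integration over \<open>M\<close> against \<open>dvol(h\<^sub>r)\<close>.  Write \<open>D\<^sub>r = sqrt (det h\<^sub>r)\<close> in a chart.  The Laplacian of
  \<open>g\<^sub>+\<close> has the divergence form (\<open>laplacian_gplus\<close>)

  \<open>D\<^sub>r \<Delta>u = r^(n+1) (\<partial>\<^sub>r (r^(1-n) D\<^sub>r \<partial>\<^sub>r u) + \<Sum>\<^sub>i \<partial>\<^sub>i (r^(1-n) D\<^sub>r \<Sum>\<^sub>k h\<^sub>r^(ik) \<partial>\<^sub>k u))\<close>.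

  If \<open>u = \<Sum>\<^sub>j r^(lam+2j) u\<^sub>j\<close> is compactly supported along \<open>M\<close>, then integration over \<open>M\<close> removes the
  second term.  Since \<open>D\<^sub>r = D\<^sub>0 \<Sum>\<^sub>k v\<^sub>2\<^sub>k r^(2k)\<close> up to higher order, the coefficient in question is

  \<open>\<Sum>\<^sub>j ((lam + 2j) lam + lam (n - lam)) \<integral> u\<^sub>j v\<^sub>n\<^sub>-\<^sub>2\<^sub>j dvol(h) = lam \<Sum>\<^sub>j (n + 2j) \<integral> u\<^sub>j v\<^sub>n\<^sub>-\<^sub>2\<^sub>j dvol(h)\<close>,

  and it must vanish (\<open>integral_identity\<close>).  With \<open>u\<^sub>j = \<T>\<^sub>2\<^sub>j(lam) f\<close> this says that the function
  \<open>\<Sum>\<^sub>j (n + 2j) \<T>\<^sub>2\<^sub>j\<^sup>*(lam) v\<^sub>n\<^sub>-\<^sub>2\<^sub>j\<close> is orthogonal to every bump function \<open>f\<close>, because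
  the factor \<open>lam\<close> is not zero: \<open>0\<close> is one of the excluded values \<open>n/2 - k\<close>.  So this function is
  zero for generic \<open>lam\<close>, and the zero polynomial is the witness.

  Two points carry the rest of the work.

  The expansion that defines the \<open>v\<^sub>2\<^sub>k\<close> is one of \<open>D\<^sub>r\<close> only; it does not control \<open>\<partial>\<^sub>r D\<^sub>r\<close>, so it cannot
  be differentiated term by term.  Instead the integrated equation is regarded as an ordinary differential
  relation between \<open>P(r) = r^(1-n) \<integral> \<phi> D\<^sub>r \<partial>\<^sub>r u\<close> and \<open>P'(r)\<close>, both of which have known expansions
  (\<open>weak_eigen_equation\<close>); \<open>derivative_of_expansion\<close> shows that these expansions must be formally
  compatible.

  The functions \<open>\<T>\<^sub>2\<^sub>j(lam) f\<close> are only given as the coefficients of a solution; that they are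
  supported in the support of \<open>f\<close> has to be proved (\<open>solution_coeffs_local\<close>).  Where \<open>f\<close> vanishes,
  let \<open>u\<^sub>m\<close> be the first coefficient that is not known to vanish.  The same weak equation, tested
  against a bump function \<open>\<phi>\<close>, gives \<open>4m (lam - n/2 + m) \<integral> \<phi> u\<^sub>m dvol(h) = 0\<close>, and the factor is not
  zero for generic \<open>lam\<close>.
\<close>

section \<open>Calculus of \<open>C\<^sup>k\<close> maps\<close>

lemma pderivative_eq:
  assumes "(f has_derivative f') (at p)"
  shows "pderivative i f p = f' (axis i 1)"
  unfolding pderivative_def using frechet_derivative_at[OF assms] by simp

lemma frechet_derivative_cong_open:
  assumes "open S" "x \<in> S" "\<And>y. y \<in> S \<Longrightarrow> f y = g y"
  shows "frechet_derivative f (at x) = frechet_derivative g (at x)"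
proof -
  have "(f has_derivative D) (at x) \<longleftrightarrow> (g has_derivative D) (at x)" for D
    using has_derivative_transform_within_open[of f D x UNIV S g]
          has_derivative_transform_within_open[of g D x UNIV S f] assms by auto
  then show ?thesis unfolding frechet_derivative_def by simp
qed

lemma pderivative_cong_open:
  assumes "open S" "x \<in> S" "\<And>y. y \<in> S \<Longrightarrow> f y = g y"
  shows "pderivative i f x = pderivative i g x"
  unfolding pderivative_def using frechet_derivative_cong_open[OF assms] by simp

lemma differentiable_cong_open:
  assumes "open S" "x \<in> S" "\<And>y. y \<in> S \<Longrightarrow> f y = g y" "f differentiable (at x)"
  shows "g differentiable (at x)"
  using assms has_derivative_transform_within_open[of f _ x UNIV S g] unfolding differentiable_def
  by auto

lemma Ck_on_subset: "Ck_on k S f \<Longrightarrow> T \<subseteq> S \<Longrightarrow> Ck_on k T f"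
  by (induction k arbitrary: f) (auto intro: continuous_on_subset)

lemma Ck_on_cong:
  assumes "open S" "\<And>x. x \<in> S \<Longrightarrow> f x = g x"
  shows "Ck_on k S f \<Longrightarrow> Ck_on k S g"
  using assms(2)
proof (induction k arbitrary: f g)
  case 0
  then show ?case using continuous_on_cong[of S S f g] by auto
next
  case (Suc k)
  have "g differentiable (at x)" if "x \<in> S" for x
    using differentiable_cong_open[OF assms(1) that, of f g] Suc.prems that by auto
  moreover have "Ck_on k S (\<lambda>x. frechet_derivative g (at x) w)" for w
  proof (rule Suc.IH)
    show "Ck_on k S (\<lambda>x. frechet_derivative f (at x) w)" using Suc.prems by auto
    show "frechet_derivative f (at x) w = frechet_derivative g (at x) w" if "x \<in> S" for x
      using frechet_derivative_cong_open[OF assms(1) that, of f g] Suc.prems by auto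
  qed
  ultimately show ?case by auto
qed

lemma Ck_on_SucI:
  assumes "open S" "\<And>x. x \<in> S \<Longrightarrow> (f has_derivative f' x) (at x)"
    and "\<And>w. Ck_on k S (\<lambda>x. f' x w)"
  shows "Ck_on (Suc k) S f"
proof -
  have "Ck_on k S (\<lambda>x. frechet_derivative f (at x) w)" for w
    by (rule Ck_on_cong[OF assms(1) _ assms(3)[of w]])
       (simp add: frechet_derivative_at[OF assms(2)])
  then show ?thesis using assms(2) by (auto simp: differentiable_def)
qed

lemma Ck_on_SucD:
  assumes "Ck_on (Suc k) S f" "x \<in> S"
  shows "(f has_derivative frechet_derivative f (at x)) (at x)"
  using assms frechet_derivative_works by auto

lemma Ck_on_Suc_imp: "Ck_on (Suc k) S f \<Longrightarrow> Ck_on k S f"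
proof (induction k arbitrary: f)
  case 0
  then show ?case
    by (auto intro!: continuous_at_imp_continuous_on differentiable_imp_continuous_within)
next
  case (Suc k)
  then show ?case by (metis Ck_on.simps(2))
qed

lemma Ck_on_continuous: "Ck_on k S f \<Longrightarrow> continuous_on S f"
  by (induction k) (auto dest: Ck_on_Suc_imp simp del: Ck_on.simps(2))

text \<open>Used to glue smoothness on the overlap of two charts with smoothness away from the support of
  a function.\<close>
lemma Ck_on_local:
  assumes "\<And>x. x \<in> S \<Longrightarrow> \<exists>U. open U \<and> x \<in> U \<and> Ck_on k U f"
  shows "Ck_on k S f"
  using assms
proof (induction k arbitrary: f)
  case 0
  then have "continuous (at x) f" if "x \<in> S" for x
    using continuous_on_eq_continuous_at that by (metis Ck_on.simps(1))
  then show ?case by (simp add: continuous_at_imp_continuous_on)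
next
  case (Suc k)
  have "Ck_on k S (\<lambda>x. frechet_derivative f (at x) w)" for w
    by (rule Suc.IH) (use Suc.prems in \<open>metis Ck_on.simps(2)\<close>)
  moreover have "f differentiable (at x)" if "x \<in> S" for x
    using Suc.prems[OF that] by auto
  ultimately show ?case by auto
qed

lemma Ck_on_const: "Ck_on k S (\<lambda>_. c)"
  by (induction k arbitrary: c) auto

lemma Ck_on_bounded_linear:
  assumes "bounded_linear L" "open S"
  shows "Ck_on k S f \<Longrightarrow> Ck_on k S (\<lambda>x. L (f x))"
proof (induction k arbitrary: f)
  case 0
  then show ?case
    using bounded_linear.continuous_on[OF assms(1)] by auto
next
  case (Suc k)
  show ?case
  proof (rule Ck_on_SucI[OF assms(2)])
    show "((\<lambda>x. L (f x)) has_derivative (\<lambda>w. L (frechet_derivative f (at x) w))) (at x)"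
      if "x \<in> S" for x
      by (rule bounded_linear.has_derivative[OF assms(1) Ck_on_SucD[OF Suc.prems that]])
    show "Ck_on k S (\<lambda>x. L (frechet_derivative f (at x) w))" for w
      using Suc by auto
  qed
qed

lemma Ck_on_add:
  assumes "open S"
  shows "Ck_on k S f \<Longrightarrow> Ck_on k S g \<Longrightarrow> Ck_on k S (\<lambda>x. f x + g x)"
proof (induction k arbitrary: f g)
  case 0
  then show ?case by (auto intro: continuous_intros)
next
  case (Suc k)
  show ?case
  proof (rule Ck_on_SucI[OF assms])
    show "((\<lambda>x. f x + g x) has_derivative
        (\<lambda>w. frechet_derivative f (at x) w + frechet_derivative g (at x) w)) (at x)" if "x \<in> S" for x
      by (intro has_derivative_add Ck_on_SucD[OF Suc.prems(1) that] Ck_on_SucD[OF Suc.prems(2) that])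
    show "Ck_on k S (\<lambda>x. frechet_derivative f (at x) w + frechet_derivative g (at x) w)" for w
      using Suc by auto
  qed
qed

lemma Ck_on_sum:
  assumes "open S" "\<And>b. b \<in> B \<Longrightarrow> Ck_on k S (f b)"
  shows "Ck_on k S (\<lambda>x. \<Sum>b\<in>B. f b x)"
  using assms(2)
  by (induction B rule: infinite_finite_induct) (auto intro: Ck_on_const Ck_on_add[OF assms(1)])

lemma Ck_on_bilinear:
  assumes "bounded_bilinear B" "open S"
  shows "Ck_on k S f \<Longrightarrow> Ck_on k S g \<Longrightarrow> Ck_on k S (\<lambda>x. B (f x) (g x))"
proof (induction k arbitrary: f g)
  case 0
  then show ?case using bounded_bilinear.continuous_on[OF assms(1)] by auto
next
  case (Suc k)
  show ?case
  proof (rule Ck_on_SucI[OF assms(2)])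
    show "((\<lambda>x. B (f x) (g x)) has_derivative
        (\<lambda>w. B (f x) (frechet_derivative g (at x) w) + B (frechet_derivative f (at x) w) (g x))) (at x)"
      if "x \<in> S" for x
      by (intro bounded_bilinear.FDERIV[OF assms(1)] Ck_on_SucD[OF Suc.prems(1) that]
           Ck_on_SucD[OF Suc.prems(2) that])
    show "Ck_on k S (\<lambda>x. B (f x) (frechet_derivative g (at x) w) + B (frechet_derivative f (at x) w) (g x))" for w
      using Suc.prems
      by (intro Ck_on_add[OF assms(2)] Suc.IH Ck_on_Suc_imp[OF Suc.prems(1)]
          Ck_on_Suc_imp[OF Suc.prems(2)]) auto
  qed
qed

text \<open>The derivative of \<open>f\<close> in the direction \<open>g' w\<close>, which depends on the point, is expanded in the
  standard basis.  This turns it into a sum of products of \<open>C\<^sup>k\<close> functions, since directional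
  derivatives in fixed directions are \<open>C\<^sup>k\<close> by definition.\<close>
lemma Ck_on_compose:
  fixes g :: "'a::real_normed_vector \<Rightarrow> 'b::euclidean_space"
    and f :: "'b \<Rightarrow> 'c::real_normed_vector"
  assumes "open S" "g ` S \<subseteq> T"
  shows "Ck_on k T f \<Longrightarrow> Ck_on k S g \<Longrightarrow> Ck_on k S (\<lambda>x. f (g x))"
proof (induction k arbitrary: f)
  case 0
  then show ?case using assms(2) by (auto intro: continuous_on_compose2)
next
  case (Suc k)
  let ?f' = "\<lambda>x. frechet_derivative f (at (g x))"
  let ?g' = "\<lambda>x. frechet_derivative g (at x)"
  show ?case
  proof (rule Ck_on_SucI[OF assms(1)])
    fix x assume x: "x \<in> S"
    have f': "(f has_derivative ?f' x) (at (g x))"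
      using Ck_on_SucD[OF Suc.prems(1)] assms(2) x by auto
    have "((\<lambda>x. f (g x)) has_derivative (\<lambda>w. ?f' x (?g' x w))) (at x)"
      using diff_chain_at[OF Ck_on_SucD[OF Suc.prems(2) x] f'] by (simp add: o_def)
    moreover have "?f' x (?g' x w) = (\<Sum>b\<in>Basis. (?g' x w \<bullet> b) *\<^sub>R ?f' x b)" for w
    proof -
      interpret linear "?f' x" using f' by (rule has_derivative_linear)
      show ?thesis
        by (subst euclidean_representation[of "?g' x w", symmetric]) (simp add: sum scale)
    qed
    ultimately show "((\<lambda>x. f (g x)) has_derivative (\<lambda>w. \<Sum>b\<in>Basis. (?g' x w \<bullet> b) *\<^sub>R ?f' x b)) (at x)"
      by (simp add: fun_eq_iff)
  next
    fix w
    show "Ck_on k S (\<lambda>x. \<Sum>b\<in>Basis. (?g' x w \<bullet> b) *\<^sub>R ?f' x b)"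
    proof (intro Ck_on_sum[OF assms(1)] Ck_on_bilinear[OF bounded_bilinear_scaleR assms(1)])
      fix b :: 'b assume "b \<in> Basis"
      show "Ck_on k S (\<lambda>x. ?g' x w \<bullet> b)"
        using Suc.prems by (intro Ck_on_bounded_linear[OF bounded_linear_inner_left assms(1)]) auto
      show "Ck_on k S (\<lambda>x. ?f' x b)"
        by (rule Suc.IH[of "\<lambda>y. frechet_derivative f (at y) b"])
           (use Suc.prems Ck_on_Suc_imp[OF Suc.prems(2)] in auto)
    qed
  qed
qed

lemma Ck_on_ident: "Ck_on k S (\<lambda>x. x)"
  by (cases k) (auto intro: Ck_on_const)

lemma smooth_on_subset: "smooth_on S f \<Longrightarrow> T \<subseteq> S \<Longrightarrow> smooth_on T f"
  by (auto simp: smooth_on_def intro: Ck_on_subset)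

lemma smooth_on_frechet_derivative:
  "smooth_on S f \<Longrightarrow> smooth_on S (\<lambda>x. frechet_derivative f (at x) w)"
  unfolding smooth_on_def using Ck_on.simps(2) by blast

lemma smooth_on_pderivative: "smooth_on S f \<Longrightarrow> smooth_on S (pderivative i f)"
  using smooth_on_frechet_derivative[of S f "axis i 1"] by (simp add: pderivative_def[abs_def])

lemma smooth_on_continuous: "smooth_on S f \<Longrightarrow> continuous_on S f"
  unfolding smooth_on_def using Ck_on_continuous by blast

lemma smooth_on_differentiable: "smooth_on S f \<Longrightarrow> x \<in> S \<Longrightarrow> f differentiable (at x)"
  unfolding smooth_on_def using Ck_on.simps(2) by blast

lemma smooth_on_has_derivative:
  "smooth_on S f \<Longrightarrow> x \<in> S \<Longrightarrow> (f has_derivative frechet_derivative f (at x)) (at x)"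
  using smooth_on_differentiable frechet_derivative_works by blast

section \<open>Smooth bump functions\<close>

text \<open>The derivatives of \<open>exp (- 1/t)\<close> for \<open>t > 0\<close> are this function times polynomials in \<open>1/t\<close>; the
  polynomial as a parameter makes the family closed under differentiation.\<close>
definition flat_exp :: "real poly \<Rightarrow> real \<Rightarrow> real" where
  "flat_exp p t = (if t > 0 then poly p (1/t) * exp (- (1/t)) else 0)"

lemma poly_exp_tendsto_0: "((\<lambda>t::real. poly p t * exp (- t)) \<longlongrightarrow> 0) at_top"
proof -
  have "((\<lambda>t::real. \<Sum>i\<le>degree p. coeff p i * (t ^ i / exp t)) \<longlongrightarrow> (\<Sum>i\<le>degree p. coeff p i * 0)) at_top"
    by (intro tendsto_sum tendsto_mult tendsto_const tendsto_power_div_exp_0)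
  moreover have "poly p t * exp (- t) = (\<Sum>i\<le>degree p. coeff p i * (t ^ i / exp t))" for t :: real
    by (simp add: poly_altdef sum_distrib_right exp_minus divide_inverse mult.assoc)
  ultimately show ?thesis by simp
qed

lemma flat_exp_tendsto_0: "((\<lambda>t. poly p (1/t) * exp (- (1/t))) \<longlongrightarrow> (0::real)) (at_right 0)"
  using filterlim_compose[OF poly_exp_tendsto_0[of p] filterlim_inverse_at_top_right]
  by (simp add: inverse_eq_divide)

text \<open>With \<open>s = 1/t\<close> the derivative of \<open>p(s) e^(-s)\<close> in \<open>t\<close> is \<open>s\<^sup>2 (p(s) - p'(s)) e^(-s)\<close>.  At \<open>t = 0\<close> the
  exponential decay in \<open>s\<close> beats the polynomial growth of the difference quotient.\<close>
lemma flat_exp_has_derivative: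
  "(flat_exp p has_real_derivative flat_exp ([:0,0,1:] * (p - pderiv p)) t) (at t)"
proof (cases t "0::real" rule: linorder_cases)
  case less
  have "((\<lambda>_. 0) has_real_derivative 0) (at t)" by simp
  then have "(flat_exp p has_real_derivative 0) (at t)"
    by (rule DERIV_cong_ev[THEN iffD1, rotated -1])
       (use less eventually_nhds_in_open[of "{..<0}" t] in \<open>auto simp: flat_exp_def elim!: eventually_mono\<close>)
  then show ?thesis using less by (simp add: flat_exp_def)
next
  case greater
  have "((\<lambda>t. poly p (1/t) * exp (- (1/t))) has_real_derivative
      flat_exp ([:0,0,1:] * (p - pderiv p)) t) (at t)"
    using greater
    by (auto intro!: derivative_eq_intros DERIV_chain2[OF poly_DERIV]
        simp: flat_exp_def field_simps power2_eq_square)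
  then show ?thesis
    by (rule DERIV_cong_ev[THEN iffD1, rotated -1])
       (use greater eventually_nhds_in_open[of "{0<..}" t] in \<open>auto simp: flat_exp_def elim!: eventually_mono\<close>)
next
  case equal
  have "((\<lambda>h. flat_exp p h / h) \<longlongrightarrow> 0) (at_left 0)"
    by (rule tendsto_eventually) (auto simp: flat_exp_def eventually_at_filter)
  moreover have "((\<lambda>h. flat_exp p h / h) \<longlongrightarrow> 0) (at_right 0)"
    using flat_exp_tendsto_0[of "pCons 0 p"]
    by (rule tendsto_cong[THEN iffD1, rotated])
       (auto simp: flat_exp_def eventually_at_filter field_simps)
  ultimately have "((\<lambda>h. flat_exp p h / h) \<longlongrightarrow> 0) (at 0)"
    by (simp add: filterlim_split_at)
  then show ?thesis using equal by (simp add: DERIV_def flat_exp_def)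
qed

lemma Ck_on_flat_exp: "Ck_on k UNIV (flat_exp p)"
proof (induction k arbitrary: p)
  case 0
  then show ?case using flat_exp_has_derivative
    by (auto intro!: continuous_at_imp_continuous_on DERIV_isCont)
next
  case (Suc k)
  show ?case
    by (rule Ck_on_SucI[OF open_UNIV flat_exp_has_derivative[unfolded has_field_derivative_def]])
       (intro Ck_on_bilinear[OF bounded_bilinear_mult] open_UNIV Suc Ck_on_const)
qed

definition bump :: "'a::euclidean_space \<Rightarrow> real \<Rightarrow> 'a \<Rightarrow> real" where
  "bump y0 d y = flat_exp 1 (d\<^sup>2 - (y - y0) \<bullet> (y - y0))"

lemma bump_nonneg: "0 \<le> bump y0 d y"
  by (simp add: bump_def flat_exp_def)

lemma bump_pos: "0 < d \<Longrightarrow> 0 < bump y0 d y0"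
  by (simp add: bump_def flat_exp_def)

lemma bump_outside: "0 < d \<Longrightarrow> y \<notin> cball y0 d \<Longrightarrow> bump y0 d y = 0"
proof -
  assume d: "0 < d" "y \<notin> cball y0 d"
  then have "d < norm (y - y0)" by (simp add: dist_norm norm_minus_commute)
  then have "d\<^sup>2 < (norm (y - y0))\<^sup>2" using d(1) by (intro power_strict_mono) auto
  then show ?thesis by (simp add: bump_def flat_exp_def power2_norm_eq_inner)
qed

lemma smooth_on_bump: "smooth_on UNIV (bump y0 d)"
  unfolding smooth_on_def
proof
  fix k
  have 1: "Ck_on k UNIV (\<lambda>y. y + - y0)"
    by (intro Ck_on_add Ck_on_ident Ck_on_const) auto
  have "Ck_on k UNIV (\<lambda>y. d\<^sup>2 + - ((y + - y0) \<bullet> (y + - y0)))"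
    by (intro Ck_on_add Ck_on_const Ck_on_bounded_linear[OF bounded_linear_minus[OF bounded_linear_ident]]
        Ck_on_bilinear[OF bounded_bilinear_inner] 1) auto
  from Ck_on_compose[OF _ _ Ck_on_flat_exp this] show "Ck_on k UNIV (bump y0 d)"
    by (simp add: bump_def[abs_def])
qed

section \<open>Derivatives of determinants and inverse matrices\<close>

lemma matrix_inv_unique:
  fixes A :: "real^'k^'k"
  assumes "A ** B = mat 1" "B ** A = mat 1"
  shows "matrix_inv A = B"
proof -
  have "invertible A" using assms by (auto simp: invertible_def)
  then have "A ** matrix_inv A = mat 1 \<and> matrix_inv A ** A = mat 1"
    unfolding invertible_def matrix_inv_def by (rule someI_ex)
  then show ?thesis by (metis assms(2) matrix_mul_assoc matrix_mul_lid matrix_mul_rid)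
qed

lemma matrix_inv_works:
  fixes A :: "real^'k^'k"
  assumes "det A \<noteq> 0"
  shows "A ** matrix_inv A = mat 1" "matrix_inv A ** A = mat 1"
proof -
  have "invertible A" using assms by (simp add: invertible_det_nz)
  then have "A ** matrix_inv A = mat 1 \<and> matrix_inv A ** A = mat 1"
    unfolding invertible_def matrix_inv_def by (rule someI_ex)
  then show "A ** matrix_inv A = mat 1" "matrix_inv A ** A = mat 1" by auto
qed

lemma transpose_matrix_inv:
  fixes A :: "real^'k^'k"
  assumes "det A \<noteq> 0" "transpose A = A"
  shows "transpose (matrix_inv A) = matrix_inv A"
  using matrix_inv_unique[of A "transpose (matrix_inv A)"] matrix_inv_works[OF assms(1)] assms(2)
  by (metis matrix_transpose_mul transpose_mat)

lemma matrix_inv_cramer: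
  fixes A :: "real^'k^'k"
  assumes "det A \<noteq> 0"
  shows "matrix_inv A $ k $ j = det (\<chi> i l. if l = k then axis j 1 $ i else A $ i $ l) / det A"
proof -
  have "A *v (matrix_inv A *v axis j 1) = axis j 1"
    by (simp add: matrix_vector_mul_assoc matrix_inv_works[OF assms])
  then have "matrix_inv A *v axis j 1 =
      (\<chi> k. det (\<chi> i l. if l = k then axis j 1 $ i else A $ i $ l) / det A)"
    using cramer[OF assms] by blast
  moreover have "(matrix_inv A *v axis j 1) $ k = matrix_inv A $ k $ j"
    by (simp add: matrix_vector_mul_component inner_axis row_def matrix_vector_mult_basis column_def)
  ultimately show ?thesis by simp
qed

lemma has_derivative_vec_entry:
  "(M has_derivative M') F \<Longrightarrow> ((\<lambda>q. M q $ i) has_derivative (\<lambda>w. M' w $ i)) F"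
  by (rule bounded_linear.has_derivative[OF bounded_linear_vec_nth])

text \<open>The determinant is multilinear in the rows.\<close>
lemma has_derivative_det_rows:
  fixes M :: "'a::real_normed_vector \<Rightarrow> real^'k^'k"
  assumes "\<And>i j. ((\<lambda>q. M q $ i $ j) has_derivative (\<lambda>w. M' w $ i $ j)) (at p)"
  shows "((\<lambda>q. det (M q)) has_derivative
     (\<lambda>w. \<Sum>i\<in>UNIV. det (\<chi> k. if k = i then M' w $ k else M p $ k))) (at p)"
proof -
  have "((\<lambda>q. det (M q)) has_derivative (\<lambda>w. \<Sum>\<sigma> | \<sigma> permutes UNIV. of_int (sign \<sigma>) *
      (\<Sum>i\<in>UNIV. M' w $ i $ \<sigma> i * (\<Prod>k\<in>UNIV - {i}. M p $ k $ \<sigma> k)))) (at p)"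
    unfolding det_def
    by (intro has_derivative_sum has_derivative_mult_right has_derivative_prod assms)
  moreover have "(\<Sum>\<sigma> | \<sigma> permutes UNIV. of_int (sign \<sigma>) *
      (\<Sum>i\<in>UNIV. M' w $ i $ \<sigma> i * (\<Prod>k\<in>UNIV - {i}. M p $ k $ \<sigma> k)))
     = (\<Sum>i\<in>UNIV. det (\<chi> k. if k = i then M' w $ k else M p $ k))" for w
  proof -
    have "M' w $ i $ \<sigma> i * (\<Prod>k\<in>UNIV - {i}. M p $ k $ \<sigma> k)
       = (\<Prod>k\<in>UNIV. (\<chi> k. if k = i then M' w $ k else M p $ k) $ k $ \<sigma> k)" for i \<sigma>
      by (subst prod.remove[of UNIV i]) (auto intro!: prod.cong)
    then show ?thesis
      unfolding det_def sum_distrib_left by (subst sum.swap) (simp add: sum_distrib_left)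
  qed
  ultimately show ?thesis by simp
qed

text \<open>The new row is a linear combination of the rows of \<open>A\<close>, with coefficients in the \<open>i\<close>-th row of
  \<open>B A\<^sup>-\<^sup>1\<close>; only the multiple of the \<open>i\<close>-th row of \<open>A\<close> contributes to the determinant.\<close>
lemma det_replace_row:
  fixes A B :: "real^'k^'k"
  assumes "det A \<noteq> 0"
  shows "det (\<chi> k. if k = i then B $ k else A $ k) = (B ** matrix_inv A) $ i $ i * det A"
proof -
  let ?x = "(B ** matrix_inv A) $ i"
  have "(\<Sum>k\<in>UNIV. ?x $ k *s row k A) = ?x v* A"
    by (simp add: vec_eq_iff vector_matrix_mult_def row_def mult.commute)
  also have "\<dots> = (B ** matrix_inv A ** A) $ i"
    by (simp add: vec_eq_iff vector_matrix_mult_def matrix_matrix_mult_def mult.commute)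
  also have "\<dots> = B $ i"
    by (simp add: matrix_mul_assoc[symmetric] matrix_inv_works[OF assms])
  finally have "(\<chi> k. if k = i then B $ k else A $ k) =
      (\<chi> k. if k = i then (\<Sum>k\<in>UNIV. ?x $ k *s row k A) else row k A)"
    by (simp add: vec_eq_iff row_def)
  then show ?thesis using cramer_lemma_transpose[of i ?x A] by simp
qed

text \<open>Jacobi's formula \<open>d (det M) = det M \<cdot> tr (M\<^sup>-\<^sup>1 dM)\<close>.\<close>
lemma has_derivative_det:
  fixes M :: "'a::real_normed_vector \<Rightarrow> real^'k^'k"
  assumes "(M has_derivative M') (at p)" "det (M p) \<noteq> 0"
  shows "((\<lambda>q. det (M q)) has_derivative
     (\<lambda>w. det (M p) * (\<Sum>a\<in>UNIV. \<Sum>b\<in>UNIV. matrix_inv (M p) $ b $ a * M' w $ a $ b))) (at p)"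
proof -
  have 1: "((\<lambda>q. M q $ i $ j) has_derivative (\<lambda>w. M' w $ i $ j)) (at p)" for i j
    by (intro has_derivative_vec_entry assms)
  show ?thesis
    using has_derivative_det_rows[OF 1]
    by (simp add: det_replace_row[OF assms(2)] sum_distrib_left matrix_matrix_mult_def mult_ac)
qed

lemma matrix_mult_entry: "(A ** B) $ i $ j = (\<Sum>k\<in>UNIV. A $ i $ k * B $ k $ j)"
  by (simp add: matrix_matrix_mult_def)

text \<open>Differentiation of \<open>g\<^sup>-\<^sup>1 g = 1\<close> gives \<open>\<partial>(g\<^sup>-\<^sup>1) = - g\<^sup>-\<^sup>1 (\<partial>g) g\<^sup>-\<^sup>1\<close>.\<close>
lemma pderivative_matrix_inv:
  fixes g gi :: "real^'k \<Rightarrow> real^'k^'k"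
  assumes S: "open S" "p \<in> S" and inv: "\<And>q. q \<in> S \<Longrightarrow> gi q ** g q = mat 1"
    and g: "\<And>a b. (\<lambda>q. g q $ a $ b) differentiable (at p)"
    and gi: "\<And>a b. (\<lambda>q. gi q $ a $ b) differentiable (at p)"
  shows "pderivative l (\<lambda>q. gi q $ a $ d) p =
     - (\<Sum>b\<in>UNIV. \<Sum>c\<in>UNIV. gi p $ a $ b * pderivative l (\<lambda>q. g q $ b $ c) p * gi p $ c $ d)"
proof -
  have inv': "g p ** gi p = mat 1"
    using inv[OF S(2)] matrix_left_right_inverse by blast
  let ?dg = "\<lambda>b c. pderivative l (\<lambda>q. g q $ b $ c) p"
  let ?di = "\<lambda>a b. pderivative l (\<lambda>q. gi q $ a $ b) p"
  have prod: "(\<Sum>b\<in>UNIV. gi p $ a $ b * ?dg b c) + (\<Sum>b\<in>UNIV. ?di a b * g p $ b $ c) = 0" for c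
  proof -
    have h: "((\<lambda>q. \<Sum>b\<in>UNIV. gi q $ a $ b * g q $ b $ c) has_derivative
       (\<lambda>w. \<Sum>b\<in>UNIV. gi p $ a $ b * frechet_derivative (\<lambda>q. g q $ b $ c) (at p) w
           + frechet_derivative (\<lambda>q. gi q $ a $ b) (at p) w * g p $ b $ c)) (at p)"
      using g gi unfolding frechet_derivative_works
      by (intro has_derivative_sum has_derivative_mult) auto
    have "pderivative l (\<lambda>q. \<Sum>b\<in>UNIV. gi q $ a $ b * g q $ b $ c) p =
          pderivative l (\<lambda>q. (mat 1 :: real^'k^'k) $ a $ c) p"
      by (rule pderivative_cong_open[OF S]) (simp only: inv matrix_mult_entry[symmetric])
    also have "\<dots> = 0" by (simp add: pderivative_def)
    finally show ?thesis
      using pderivative_eq[OF h, of l] by (simp add: pderivative_def sum.distrib)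
  qed
  have "?di a d = (\<Sum>b\<in>UNIV. ?di a b * (mat 1 :: real^'k^'k) $ b $ d)"
    by (simp add: mat_def if_distrib[of "(*) _"] cong: if_cong)
  also have "\<dots> = (\<Sum>c\<in>UNIV. (\<Sum>b\<in>UNIV. ?di a b * g p $ b $ c) * gi p $ c $ d)"
    unfolding inv'[symmetric] matrix_mult_entry sum_distrib_left sum_distrib_right
    by (subst sum.swap) (simp only: mult.assoc)
  also have "\<dots> = (\<Sum>c\<in>UNIV. - (\<Sum>b\<in>UNIV. gi p $ a $ b * ?dg b c) * gi p $ c $ d)"
  proof (rule sum.cong[OF refl])
    fix c
    have "(\<Sum>b\<in>UNIV. ?di a b * g p $ b $ c) = - (\<Sum>b\<in>UNIV. gi p $ a $ b * ?dg b c)"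
      using prod[of c] by linarith
    then show "(\<Sum>b\<in>UNIV. ?di a b * g p $ b $ c) * gi p $ c $ d
       = - (\<Sum>b\<in>UNIV. gi p $ a $ b * ?dg b c) * gi p $ c $ d" by simp
  qed
  also have "\<dots> = - (\<Sum>b\<in>UNIV. \<Sum>c\<in>UNIV. gi p $ a $ b * ?dg b c * gi p $ c $ d)"
    by (simp only: sum_distrib_right sum_negf mult_minus_left) (rule arg_cong[OF sum.swap])
  finally show ?thesis .
qed

section \<open>The Laplacian in divergence form\<close>

text \<open>The contraction \<open>g\<^sup>i\<^sup>j \<Gamma>\<^sup>k\<^sub>i\<^sub>j\<close>, with \<open>G\<close> for \<open>g\<^sup>-\<^sup>1\<close> and \<open>dg l i j\<close> for \<open>\<partial>\<^sub>l g\<^sub>i\<^sub>j\<close>.  The first two terms of the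
  Christoffel symbol agree under the exchange of \<open>i\<close> and \<open>j\<close>.\<close>
lemma christoffel_trace:
  fixes G :: "'k::finite \<Rightarrow> 'k \<Rightarrow> real" and dg :: "'k \<Rightarrow> 'k \<Rightarrow> 'k \<Rightarrow> real"
  assumes sym: "\<And>a b. G a b = G b a"
  shows "(\<Sum>i\<in>UNIV. \<Sum>j\<in>UNIV. G i j * ((\<Sum>l\<in>UNIV. G k l * (dg i j l + dg j i l - dg l i j)) / 2))
     = (\<Sum>i\<in>UNIV. \<Sum>b\<in>UNIV. \<Sum>c\<in>UNIV. G i b * dg i b c * G c k)
       - (\<Sum>i\<in>UNIV. (\<Sum>a\<in>UNIV. \<Sum>b\<in>UNIV. G a b * dg i a b) * G i k) / 2"
proof -
  have 1: "(\<Sum>i\<in>UNIV. \<Sum>j\<in>UNIV. \<Sum>l\<in>UNIV. G i j * G k l * dg i j l)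
     = (\<Sum>i\<in>UNIV. \<Sum>b\<in>UNIV. \<Sum>c\<in>UNIV. G i b * dg i b c * G c k)"
    by (simp add: sym[of k] mult_ac)
  have 2: "(\<Sum>i\<in>UNIV. \<Sum>j\<in>UNIV. \<Sum>l\<in>UNIV. G i j * G k l * dg j i l)
     = (\<Sum>i\<in>UNIV. \<Sum>j\<in>UNIV. \<Sum>l\<in>UNIV. G i j * G k l * dg i j l)"
    by (subst sum.swap) (simp add: sym)
  have 3: "(\<Sum>i\<in>UNIV. \<Sum>j\<in>UNIV. \<Sum>l\<in>UNIV. G i j * G k l * dg l i j)
     = (\<Sum>i\<in>UNIV. (\<Sum>a\<in>UNIV. \<Sum>b\<in>UNIV. G a b * dg i a b) * G i k)"
  proof -
    have "(\<Sum>i\<in>UNIV. \<Sum>j\<in>UNIV. \<Sum>l\<in>UNIV. G i j * G k l * dg l i j)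
        = (\<Sum>i\<in>UNIV. \<Sum>l\<in>UNIV. \<Sum>j\<in>UNIV. G i j * G k l * dg l i j)"
      by (intro sum.cong refl sum.swap)
    also have "\<dots> = (\<Sum>l\<in>UNIV. \<Sum>i\<in>UNIV. \<Sum>j\<in>UNIV. G i j * G k l * dg l i j)"
      by (rule sum.swap)
    also have "\<dots> = (\<Sum>l\<in>UNIV. (\<Sum>i\<in>UNIV. \<Sum>j\<in>UNIV. G i j * dg l i j) * G l k)"
      unfolding sum_distrib_right sym[of k] by (intro sum.cong refl) (simp only: mult_ac)
    finally show ?thesis .
  qed
  have "(\<Sum>i\<in>UNIV. \<Sum>j\<in>UNIV. G i j * ((\<Sum>l\<in>UNIV. G k l * (dg i j l + dg j i l - dg l i j)) / 2))
     = ((\<Sum>i\<in>UNIV. \<Sum>j\<in>UNIV. \<Sum>l\<in>UNIV. G i j * G k l * dg i j l)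
       + (\<Sum>i\<in>UNIV. \<Sum>j\<in>UNIV. \<Sum>l\<in>UNIV. G i j * G k l * dg j i l)
       - (\<Sum>i\<in>UNIV. \<Sum>j\<in>UNIV. \<Sum>l\<in>UNIV. G i j * G k l * dg l i j)) / 2"
    by (simp add: sum_divide_distrib[symmetric] sum_distrib_left sum.distrib sum_subtractf
         algebra_simps)
  then show ?thesis using 1 2 3 by simp
qed

text \<open>The weight \<open>\<rho>\<close> is any function with the logarithmic derivative \<open>\<partial>\<^sub>l \<rho> / \<rho> = 1/2 \<cdot> tr (g\<^sup>-\<^sup>1 \<partial>\<^sub>l g)\<close>
  of \<open>sqrt (det g)\<close>.  Stated in this way, the lemma applies to \<open>g\<^sub>+\<close> without a formula for the
  determinant of a block matrix.\<close>
lemma laplacian_divergence_form: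
  fixes g gi :: "real^'k \<Rightarrow> real^'k^'k" and \<rho> :: "real^'k \<Rightarrow> real" and u :: "real^'k \<Rightarrow> complex"
  assumes S: "open S" "p \<in> S"
    and inv: "\<And>q. q \<in> S \<Longrightarrow> gi q ** g q = mat 1"
    and sym: "transpose (gi p) = gi p"
    and g: "\<And>a b. (\<lambda>q. g q $ a $ b) differentiable (at p)"
    and gi: "\<And>a b. (\<lambda>q. gi q $ a $ b) differentiable (at p)"
    and rho: "\<rho> differentiable (at p)"
    and drho: "\<And>l. pderivative l \<rho> p =
        \<rho> p * (\<Sum>a\<in>UNIV. \<Sum>b\<in>UNIV. gi p $ a $ b * pderivative l (\<lambda>q. g q $ a $ b) p) / 2"
    and u: "\<And>k. pderivative k u differentiable (at p)"
  shows "\<rho> p *\<^sub>R laplacian g u p =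
    (\<Sum>i\<in>UNIV. pderivative i (\<lambda>q. \<Sum>j\<in>UNIV. (\<rho> q * gi q $ i $ j) *\<^sub>R pderivative j u q) p)"
proof -
  define G where "G a b = gi p $ a $ b" for a b
  define dg where "dg l a b = pderivative l (\<lambda>q. g q $ a $ b) p" for l a b
  define du where "du k = pderivative k u p" for k
  define ddu where "ddu i j = pderivative i (pderivative j u) p" for i j
  have symG: "G a b = G b a" for a b
    unfolding G_def using arg_cong[OF sym, of "\<lambda>M. M $ a $ b"] by (simp add: transpose_def)
  have mi: "matrix_inv (g p) = gi p"
    by (rule matrix_inv_unique) (use inv[OF S(2)] matrix_left_right_inverse in blast)+
  have dgi: "pderivative l (\<lambda>q. gi q $ a $ d) p =
     - (\<Sum>b\<in>UNIV. \<Sum>c\<in>UNIV. G a b * dg l b c * G c d)" for l a d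
    unfolding G_def dg_def by (rule pderivative_matrix_inv[OF S inv g gi])
  have chr: "christoffel g k i j p = (\<Sum>l\<in>UNIV. G k l * (dg i j l + dg j i l - dg l i j)) / 2" for i j k
    by (simp add: christoffel_def mi G_def dg_def)
  have flux: "pderivative i (\<lambda>q. \<Sum>j\<in>UNIV. (\<rho> q * gi q $ i $ j) *\<^sub>R pderivative j u q) p =
     (\<Sum>j\<in>UNIV. (\<rho> p * G i j) *\<^sub>R ddu i j
       + (\<rho> p * ((\<Sum>a\<in>UNIV. \<Sum>b\<in>UNIV. G a b * dg i a b) / 2 * G i j
              - (\<Sum>b\<in>UNIV. \<Sum>c\<in>UNIV. G i b * dg i b c * G c j))) *\<^sub>R du j)" for i
  proof -
    have "((\<lambda>q. \<Sum>j\<in>UNIV. (\<rho> q * gi q $ i $ j) *\<^sub>R pderivative j u q) has_derivative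
       (\<lambda>w. \<Sum>j\<in>UNIV. (\<rho> p * gi p $ i $ j) *\<^sub>R frechet_derivative (pderivative j u) (at p) w
         + (\<rho> p * frechet_derivative (\<lambda>q. gi q $ i $ j) (at p) w
              + frechet_derivative \<rho> (at p) w * gi p $ i $ j) *\<^sub>R pderivative j u p)) (at p)"
      using gi rho u unfolding frechet_derivative_works
      by (intro has_derivative_sum has_derivative_mult has_derivative_scaleR) auto
    from pderivative_eq[OF this, of i]
    show ?thesis
      unfolding pderivative_def[of i, symmetric]
      using dgi[of i i] drho[of i]
      by (simp add: G_def du_def ddu_def dg_def algebra_simps)
  qed
  have "\<rho> p *\<^sub>R laplacian g u p = \<rho> p *\<^sub>R (\<Sum>i\<in>UNIV. \<Sum>j\<in>UNIV. G i j *\<^sub>R ddu i j)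
       - \<rho> p *\<^sub>R (\<Sum>i\<in>UNIV. \<Sum>j\<in>UNIV. \<Sum>k\<in>UNIV. (G i j * christoffel g k i j p) *\<^sub>R du k)"
    unfolding laplacian_def mi
    by (simp add: G_def du_def ddu_def scaleR_right_diff_distrib sum_subtractf scaleR_sum_right)
  also have "(\<Sum>i\<in>UNIV. \<Sum>j\<in>UNIV. \<Sum>k\<in>UNIV. (G i j * christoffel g k i j p) *\<^sub>R du k)
     = (\<Sum>k\<in>UNIV. (\<Sum>i\<in>UNIV. \<Sum>j\<in>UNIV. G i j * christoffel g k i j p) *\<^sub>R du k)"
  proof -
    have "(\<Sum>i\<in>UNIV. \<Sum>j\<in>UNIV. \<Sum>k\<in>UNIV. (G i j * christoffel g k i j p) *\<^sub>R du k)
       = (\<Sum>i\<in>UNIV. \<Sum>k\<in>UNIV. \<Sum>j\<in>UNIV. (G i j * christoffel g k i j p) *\<^sub>R du k)"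
      by (intro sum.cong refl sum.swap)
    also have "\<dots> = (\<Sum>k\<in>UNIV. \<Sum>i\<in>UNIV. \<Sum>j\<in>UNIV. (G i j * christoffel g k i j p) *\<^sub>R du k)"
      by (rule sum.swap)
    finally show ?thesis by (simp add: scaleR_sum_left)
  qed
  also have "\<dots> = (\<Sum>k\<in>UNIV. ((\<Sum>i\<in>UNIV. \<Sum>b\<in>UNIV. \<Sum>c\<in>UNIV. G i b * dg i b c * G c k)
       - (\<Sum>i\<in>UNIV. (\<Sum>a\<in>UNIV. \<Sum>b\<in>UNIV. G a b * dg i a b) * G i k) / 2) *\<^sub>R du k)"
    unfolding chr by (subst christoffel_trace[where G=G and dg=dg]) (rule symG, rule refl)
  also have "\<rho> p *\<^sub>R (\<Sum>i\<in>UNIV. \<Sum>j\<in>UNIV. G i j *\<^sub>R ddu i j) - \<rho> p *\<^sub>R \<dots> =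
     (\<Sum>i\<in>UNIV. \<Sum>j\<in>UNIV. (\<rho> p * G i j) *\<^sub>R ddu i j)
     + (\<Sum>k\<in>UNIV. \<Sum>i\<in>UNIV. (\<rho> p * ((\<Sum>a\<in>UNIV. \<Sum>b\<in>UNIV. G a b * dg i a b) / 2 * G i k
              - (\<Sum>b\<in>UNIV. \<Sum>c\<in>UNIV. G i b * dg i b c * G c k))) *\<^sub>R du k)"
  proof -
    have "\<rho> p *\<^sub>R (\<Sum>k\<in>UNIV. ((\<Sum>i\<in>UNIV. \<Sum>b\<in>UNIV. \<Sum>c\<in>UNIV. G i b * dg i b c * G c k)
       - (\<Sum>i\<in>UNIV. (\<Sum>a\<in>UNIV. \<Sum>b\<in>UNIV. G a b * dg i a b) * G i k) / 2) *\<^sub>R du k)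
      = - (\<Sum>k\<in>UNIV. (\<Sum>i\<in>UNIV. \<rho> p * ((\<Sum>a\<in>UNIV. \<Sum>b\<in>UNIV. G a b * dg i a b) / 2 * G i k
              - (\<Sum>b\<in>UNIV. \<Sum>c\<in>UNIV. G i b * dg i b c * G c k))) *\<^sub>R du k)"
      unfolding scaleR_sum_right sum_negf[symmetric]
    proof (intro sum.cong refl)
      fix k :: 'k
      have "\<rho> p * ((\<Sum>i\<in>UNIV. \<Sum>b\<in>UNIV. \<Sum>c\<in>UNIV. G i b * dg i b c * G c k)
          - (\<Sum>i\<in>UNIV. (\<Sum>a\<in>UNIV. \<Sum>b\<in>UNIV. G a b * dg i a b) * G i k) / 2)
        = - (\<Sum>i\<in>UNIV. \<rho> p * ((\<Sum>a\<in>UNIV. \<Sum>b\<in>UNIV. G a b * dg i a b) / 2 * G i k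
              - (\<Sum>b\<in>UNIV. \<Sum>c\<in>UNIV. G i b * dg i b c * G c k)))"
        unfolding sum_distrib_left[symmetric] sum_subtractf times_divide_eq_left
          sum_divide_distrib[of "\<lambda>i. (\<Sum>a\<in>UNIV. \<Sum>b\<in>UNIV. G a b * dg i a b) * G i k", symmetric]
        by (simp only: right_diff_distrib minus_diff_eq)
      then show "\<rho> p *\<^sub>R ((\<Sum>i\<in>UNIV. \<Sum>b\<in>UNIV. \<Sum>c\<in>UNIV. G i b * dg i b c * G c k)
          - (\<Sum>i\<in>UNIV. (\<Sum>a\<in>UNIV. \<Sum>b\<in>UNIV. G a b * dg i a b) * G i k) / 2) *\<^sub>R du k
        = - ((\<Sum>i\<in>UNIV. \<rho> p * ((\<Sum>a\<in>UNIV. \<Sum>b\<in>UNIV. G a b * dg i a b) / 2 * G i k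
              - (\<Sum>b\<in>UNIV. \<Sum>c\<in>UNIV. G i b * dg i b c * G c k))) *\<^sub>R du k)"
        by (simp only: scaleR_scaleR scaleR_minus_left)
    qed
    moreover have "\<rho> p *\<^sub>R (\<Sum>i\<in>UNIV. \<Sum>j\<in>UNIV. G i j *\<^sub>R ddu i j)
       = (\<Sum>i\<in>UNIV. \<Sum>j\<in>UNIV. (\<rho> p * G i j) *\<^sub>R ddu i j)"
      by (simp add: scaleR_sum_right)
    ultimately show ?thesis by (simp only: scaleR_sum_left diff_minus_eq_add)
  qed
  also have "\<dots> = (\<Sum>i\<in>UNIV. pderivative i (\<lambda>q. \<Sum>j\<in>UNIV. (\<rho> q * gi q $ i $ j) *\<^sub>R pderivative j u q) p)"
    unfolding flux sum.distrib by (intro arg_cong2[of _ _ _ _ plus] refl sum.swap)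
  finally show ?thesis .
qed

section \<open>Smooth functions built from smooth functions\<close>

lemma smooth_on_const: "smooth_on S (\<lambda>_. c)"
  by (simp add: smooth_on_def Ck_on_const)

lemma smooth_on_cong: "open S \<Longrightarrow> (\<And>x. x \<in> S \<Longrightarrow> f x = g x) \<Longrightarrow> smooth_on S f \<Longrightarrow> smooth_on S g"
  unfolding smooth_on_def using Ck_on_cong by blast

lemma smooth_on_sum:
  "open S \<Longrightarrow> (\<And>b. b \<in> B \<Longrightarrow> smooth_on S (f b)) \<Longrightarrow> smooth_on S (\<lambda>x. \<Sum>b\<in>B. f b x)"
  unfolding smooth_on_def using Ck_on_sum[of S B _ f] by blast

lemma smooth_on_bilinear:
  "bounded_bilinear B \<Longrightarrow> open S \<Longrightarrow> smooth_on S f \<Longrightarrow> smooth_on S g \<Longrightarrow> smooth_on S (\<lambda>x. B (f x) (g x))"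
  unfolding smooth_on_def using Ck_on_bilinear[of B S _ f g] by blast

lemmas smooth_on_mult = smooth_on_bilinear[OF bounded_bilinear_mult]
lemmas smooth_on_scaleR = smooth_on_bilinear[OF bounded_bilinear_scaleR]

lemma smooth_on_bounded_linear:
  "bounded_linear L \<Longrightarrow> open S \<Longrightarrow> smooth_on S f \<Longrightarrow> smooth_on S (\<lambda>x. L (f x))"
  unfolding smooth_on_def using Ck_on_bounded_linear[of L S _ f] by blast

lemma smooth_on_compose:
  fixes g :: "'a::real_normed_vector \<Rightarrow> 'b::euclidean_space"
    and f :: "'b \<Rightarrow> 'c::real_normed_vector"
  assumes "open S" "g ` S \<subseteq> T" "smooth_on T f" "smooth_on S g"
  shows "smooth_on S (\<lambda>x. f (g x))"
  using Ck_on_compose[OF assms(1,2)] assms(3,4) unfolding smooth_on_def by blast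

lemma smooth_on_local:
  assumes "\<And>x. x \<in> S \<Longrightarrow> \<exists>U. open U \<and> x \<in> U \<and> smooth_on U f"
  shows "smooth_on S f"
  unfolding smooth_on_def using Ck_on_local[of S _ f] assms unfolding smooth_on_def by metis

lemma smooth_on_linear: "bounded_linear L \<Longrightarrow> open S \<Longrightarrow> smooth_on S L"
  using smooth_on_bounded_linear[of L S "\<lambda>x. x"] by (simp add: smooth_on_def Ck_on_ident)

lemma smooth_on_prod:
  fixes f :: "'i \<Rightarrow> 'a::real_normed_vector \<Rightarrow> real"
  assumes "open S" "\<And>b. b \<in> B \<Longrightarrow> smooth_on S (f b)"
  shows "smooth_on S (\<lambda>x. \<Prod>b\<in>B. f b x)"
  using assms(2)
  by (induction B rule: infinite_finite_induct) (auto intro: smooth_on_const smooth_on_mult[OF assms(1)])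

lemma smooth_on_det:
  fixes M :: "'a::real_normed_vector \<Rightarrow> real^'k^'k"
  assumes "open S" "\<And>i j. smooth_on S (\<lambda>x. M x $ i $ j)"
  shows "smooth_on S (\<lambda>x. det (M x))"
  unfolding det_def by (intro smooth_on_sum smooth_on_mult smooth_on_const smooth_on_prod assms)

lemma smooth_on_vec_nth: "open S \<Longrightarrow> smooth_on S f \<Longrightarrow> smooth_on S (\<lambda>x. f x $ i)"
  by (rule smooth_on_bounded_linear[OF bounded_linear_vec_nth])

lemma smooth_on_powr: "smooth_on {0<..} (\<lambda>t::real. t powr a)"
  unfolding smooth_on_def
proof
  fix k show "Ck_on k {0<..} (\<lambda>t::real. t powr a)"
  proof (induction k arbitrary: a)
    case 0
    then show ?case by (auto intro!: continuous_intros)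
  next
    case (Suc k)
    show ?case
    proof (rule Ck_on_SucI)
      show "((\<lambda>t. t powr a) has_derivative (\<lambda>w. a * t powr (a - 1) * w)) (at t)" if "t \<in> {0<..}" for t
        using that by (auto intro!: derivative_eq_intros simp: powr_diff)
    qed (auto intro!: Ck_on_bilinear[OF bounded_bilinear_mult] Ck_on_const Suc)
  qed
qed

lemma has_vector_derivative_of_real_powr:
  assumes "0 < t"
  shows "((\<lambda>s. complex_of_real s powr z) has_vector_derivative z * complex_of_real t powr (z - 1)) (at t)"
proof -
  have "((\<lambda>x. x powr z) has_field_derivative z * complex_of_real t powr (z - 1)) (at (complex_of_real t))"
    by (rule has_field_derivative_powr) (use assms in \<open>simp add: complex_nonpos_Reals_iff\<close>)
  then have "((\<lambda>s. (\<lambda>x. x powr z) (complex_of_real s)) has_vector_derivative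
       1 * (z * complex_of_real t powr (z - 1))) (at t)"
    using field_vector_diff_chain_at[of complex_of_real 1 t "\<lambda>x. x powr z", OF has_vector_derivative_of_real[OF DERIV_ident, unfolded of_real_1]]
    by (auto simp: o_def)
  then show ?thesis by simp
qed

lemma smooth_on_of_real_powr: "smooth_on {0<..} (\<lambda>t. complex_of_real t powr z)"
  unfolding smooth_on_def
proof
  fix k show "Ck_on k {0<..} (\<lambda>t. complex_of_real t powr z)"
  proof (induction k arbitrary: z)
    case 0
    then show ?case
      by (auto intro!: continuous_at_imp_continuous_on
          dest!: has_vector_derivative_of_real_powr[THEN has_vector_derivative_continuous])
  next
    case (Suc k)
    show ?case
      by (rule Ck_on_SucI[OF _ has_vector_derivative_of_real_powr[unfolded has_vector_derivative_def]])
         (auto intro!: Ck_on_bilinear[OF bounded_bilinear_scaleR]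
           Ck_on_bilinear[OF bounded_bilinear_mult] Ck_on_const Suc)
  qed
qed

lemma smooth_on_sqrt:
  assumes "open S" "smooth_on S f" "\<And>x. x \<in> S \<Longrightarrow> 0 < f x"
  shows "smooth_on S (\<lambda>x. sqrt (f x))"
  by (rule smooth_on_cong[OF assms(1) _ smooth_on_compose[OF assms(1) _ smooth_on_powr[of "1/2"] assms(2)]])
     (use assms(3) in \<open>auto simp: powr_half_sqrt less_imp_le\<close>)

lemma smooth_on_divide:
  fixes f :: "'a::real_normed_vector \<Rightarrow> real"
  assumes "open S" "smooth_on S f" "smooth_on S g" "\<And>x. x \<in> S \<Longrightarrow> 0 < g x"
  shows "smooth_on S (\<lambda>x. f x / g x)"
proof (rule smooth_on_cong[OF assms(1)])
  show "smooth_on S (\<lambda>x. f x * (g x) powr (-1))"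
    by (intro smooth_on_mult assms smooth_on_compose[OF assms(1) _ smooth_on_powr assms(3)])
       (use assms(4) in auto)
  show "f x * (g x) powr (-1) = f x / g x" if "x \<in> S" for x
    using assms(4)[OF that] by (simp add: powr_minus divide_inverse)
qed

text \<open>By Cramer's rule the entries are quotients of determinants.\<close>
lemma smooth_on_matrix_inv:
  fixes M :: "'a::real_normed_vector \<Rightarrow> real^'k^'k"
  assumes S: "open S" and M: "\<And>i j. smooth_on S (\<lambda>x. M x $ i $ j)"
    and det: "\<And>x. x \<in> S \<Longrightarrow> 0 < det (M x)"
  shows "smooth_on S (\<lambda>x. matrix_inv (M x) $ a $ b)"
proof (rule smooth_on_cong[OF S])
  let ?c = "\<lambda>q. det (\<chi> i l. if l = a then axis b 1 $ i else M q $ i $ l)"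
  have "smooth_on S (\<lambda>q. (\<chi> i l. if l = a then axis b 1 $ i else M q $ i $ l) $ i $ j)" for i j
    using M by (cases "j = a") (auto intro: smooth_on_const)
  then show "smooth_on S (\<lambda>q. ?c q / det (M q))"
    by (intro smooth_on_divide smooth_on_det S M det)
  show "?c x / det (M x) = matrix_inv (M x) $ a $ b" if "x \<in> S" for x
    using det[OF that] by (simp add: matrix_inv_cramer)
qed

section \<open>The Laplacian of \<open>g\<^sub>+\<close>\<close>

lemma sum_option: "(\<Sum>k\<in>UNIV. f k) = f None + (\<Sum>i\<in>UNIV. f (Some (i::'n::finite)))"
  by (simp add: UNIV_option_conv sum.reindex)

lemma mk_pt_None [simp]: "mk_pt x r $ None = r"
  and mk_pt_Some [simp]: "mk_pt x r $ Some i = x $ i"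
  and base_pt_mk_pt [simp]: "base_pt (mk_pt x r) = x"
  by (simp_all add: mk_pt_def base_pt_def vec_eq_iff)

lemma bounded_linear_base_pt: "bounded_linear base_pt"
  by (rule linear_conv_bounded_linear[THEN iffD1]) (auto intro!: linearI simp: base_pt_def vec_eq_iff)

lemma mk_pt_add: "mk_pt (x + y) (r + s) = mk_pt x r + mk_pt y s"
  by (auto simp: mk_pt_def vec_eq_iff split: option.split)

lemma mk_pt_scale: "mk_pt (a *\<^sub>R x) (a * r) = a *\<^sub>R mk_pt x r"
  by (auto simp: mk_pt_def vec_eq_iff split: option.split)

lemma bounded_linear_mk_pt: "bounded_linear (\<lambda>z. mk_pt (fst z) (snd z))"
  by (rule linear_conv_bounded_linear[THEN iffD1]) (auto intro!: linearI simp: mk_pt_add mk_pt_scale)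

lemma mk_pt_axis: "mk_pt 0 1 = axis None 1" "mk_pt (axis i 1) 0 = axis (Some i) 1"
  by (auto simp: mk_pt_def vec_eq_iff axis_def split: option.split)

lemma continuous_on_mk_pt [continuous_intros]:
  "continuous_on S f \<Longrightarrow> continuous_on S g \<Longrightarrow> continuous_on S (\<lambda>x. mk_pt (f x) (g x))"
  using bounded_linear.continuous_on[OF bounded_linear_mk_pt, of S "\<lambda>x. (f x, g x)"]
  by (simp add: continuous_on_Pair)

lemma open_cylinder:
  fixes S :: "(real^'n::finite) set"
  assumes "open S" shows "open (cylinder S \<epsilon>)"
proof -
  note assms
  then have "open (base_pt -` S \<inter> (\<lambda>p::real^('n option). p $ None) -` {0<..<\<epsilon>})"
    by (intro open_Int continuous_open_vimage open_greaterThanLessThan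
         linear_continuous_at bounded_linear_base_pt bounded_linear_vec_nth continuous_intros) auto
  moreover have "cylinder S \<epsilon> = base_pt -` S \<inter> (\<lambda>p::real^('n option). p $ None) -` {0<..<\<epsilon>}"
    by (auto simp: cylinder_def)
  ultimately show ?thesis by simp
qed

lemma mk_pt_in_cylinder: "mk_pt x r \<in> cylinder S \<epsilon> \<longleftrightarrow> x \<in> S \<and> 0 < r \<and> r < \<epsilon>"
  by (simp add: cylinder_def)

lemma has_vector_derivative_mk_pt:
  fixes F :: "real^('n::finite option) \<Rightarrow> 'b::real_normed_vector"
  assumes "F differentiable (at (mk_pt x r))"
  shows "((\<lambda>s. F (mk_pt x s)) has_vector_derivative pderivative None F (mk_pt x r)) (at r)"
proof -
  have 1: "((\<lambda>s. mk_pt x s) has_derivative (\<lambda>s. mk_pt 0 s)) (at r)"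
    using bounded_linear.has_derivative[OF bounded_linear_mk_pt, of "\<lambda>s. (x, s)" "\<lambda>s. (0, s)" "at r"]
      has_derivative_Pair[OF has_derivative_const[of x "at r"] has_derivative_ident]
    by simp
  have 2: "(F has_derivative frechet_derivative F (at (mk_pt x r))) (at (mk_pt x r))"
    using assms frechet_derivative_works by blast
  interpret linear "frechet_derivative F (at (mk_pt x r))" using 2 by (rule has_derivative_linear)
  have "(mk_pt 0 s :: real^('n option)) = s *\<^sub>R axis None 1" for s
    using mk_pt_scale[of s 0 1] by (simp add: mk_pt_axis)
  then show ?thesis
    using diff_chain_at[OF 1 2]
    by (simp add: has_vector_derivative_def o_def scale pderivative_def)
qed

lemma pderivative_mk_pt:
  assumes "F differentiable (at (mk_pt x r))"
  shows "(\<lambda>y. F (mk_pt y r)) differentiable (at x)"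
    and "pderivative i (\<lambda>y. F (mk_pt y r)) x = pderivative (Some i) F (mk_pt x r)"
proof -
  have 1: "((\<lambda>y. mk_pt y r) has_derivative (\<lambda>y. mk_pt y 0)) (at x)"
    using bounded_linear.has_derivative[OF bounded_linear_mk_pt, of "\<lambda>y. (y, r)" "\<lambda>y. (y, 0)" "at x"]
      has_derivative_Pair[OF has_derivative_ident has_derivative_const[of r "at x"]]
    by simp
  have 2: "(F has_derivative frechet_derivative F (at (mk_pt x r))) (at (mk_pt x r))"
    using assms frechet_derivative_works by blast
  have 3: "((\<lambda>y. F (mk_pt y r)) has_derivative (\<lambda>y. frechet_derivative F (at (mk_pt x r)) (mk_pt y 0))) (at x)"
    using diff_chain_at[OF 1 2] by (simp add: o_def)
  show "(\<lambda>y. F (mk_pt y r)) differentiable (at x)" using 3 by (auto simp: differentiable_def)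
  show "pderivative i (\<lambda>y. F (mk_pt y r)) x = pderivative (Some i) F (mk_pt x r)"
    using pderivative_eq[OF 3, of i] by (simp add: mk_pt_axis pderivative_def)
qed

text \<open>The inverse of \<open>g\<^sub>+\<close> is \<open>r\<^sup>2\<close> times the block matrix of \<open>1\<close> and \<open>h\<^sub>r\<^sup>-\<^sup>1\<close>, and the weight
  \<open>\<rho> = r^(-n-1) sqrt (det h\<^sub>r)\<close> has the logarithmic derivative that the divergence form requires:
  by Jacobi's formula the factor \<open>sqrt (det h\<^sub>r)\<close> accounts for \<open>tr (h\<^sub>r\<^sup>-\<^sup>1 \<partial>h\<^sub>r)\<close>, and the power of \<open>r\<close>
  for the derivatives of the \<open>n + 1\<close> factors \<open>r\<^sup>-\<^sup>2\<close>.\<close>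
lemma laplacian_gplus:
  fixes hr :: "real \<Rightarrow> ('m, 'n::finite) tensor2" and u :: "real^('n option) \<Rightarrow> complex"
    and c :: "('m, 'n) chart"
  defines "n \<equiv> CARD('n)"
  defines "H \<equiv> \<lambda>q. hr (q $ None) c (base_pt q)"
  assumes S: "open S" "p \<in> S" and pos: "\<And>q. q \<in> S \<Longrightarrow> 0 < q $ None"
    and H: "smooth_on S H" and sym: "\<And>q. q \<in> S \<Longrightarrow> transpose (H q) = H q"
    and det: "\<And>q. q \<in> S \<Longrightarrow> 0 < det (H q)"
    and u: "smooth_on S u"
  shows "sqrt (det (H p)) *\<^sub>R laplacian (gplus hr c) u p = (p $ None) ^ (n + 1) *\<^sub>R
     (pderivative None (\<lambda>q. (sqrt (det (H q)) / (q $ None) ^ (n - 1)) *\<^sub>R pderivative None u q) p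
      + (\<Sum>i\<in>UNIV. pderivative (Some i) (\<lambda>q. \<Sum>j\<in>UNIV.
          (sqrt (det (H q)) * matrix_inv (H q) $ i $ j / (q $ None) ^ (n - 1)) *\<^sub>R
             pderivative (Some j) u q) p))"
proof -
  define gi :: "real^('n option) \<Rightarrow> real^('n option)^('n option)" where
    "gi q = (\<chi> k l. (case (k, l) of (None, None) \<Rightarrow> 1
       | (Some i, Some j) \<Rightarrow> matrix_inv (H q) $ i $ j | _ \<Rightarrow> 0) * (q $ None)\<^sup>2)" for q
  define \<rho> where "\<rho> q = sqrt (det (H q)) / (q $ None) ^ (n + 1)" for q
  let ?r = "p $ None" let ?g = "gplus hr c"
  have r: "0 < ?r" using pos S(2) .
  have detnz: "det (H q) \<noteq> 0" if "q \<in> S" for q using det[OF that] by simp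
  have gi_simps: "gi q $ None $ None = (q $ None)\<^sup>2" "gi q $ Some i $ Some j = matrix_inv (H q) $ i $ j * (q $ None)\<^sup>2"
    "gi q $ None $ Some j = 0" "gi q $ Some i $ None = 0" for q i j
    by (simp_all add: gi_def)
  have g_simps: "?g q $ None $ None = 1 / (q $ None)\<^sup>2" "?g q $ Some i $ Some j = H q $ i $ j / (q $ None)\<^sup>2"
    "?g q $ None $ Some j = 0" "?g q $ Some i $ None = 0" for q i j
    by (simp_all add: gplus_def H_def)
  have inv: "gi q ** ?g q = mat 1" if q: "q \<in> S" for q
  proof -
    have r0: "q $ None \<noteq> 0" using pos[OF q] by simp
    have e: "(\<Sum>k\<in>UNIV. matrix_inv (H q) $ i $ k * H q $ k $ j) = (if i = j then 1 else 0)" for i j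
      using matrix_inv_works(2)[OF detnz[OF q]]
      by (simp add: matrix_mult_entry[symmetric]) (simp add: mat_def)
    have "(gi q ** ?g q) $ k $ l = mat 1 $ k $ l" for k l
      using r0 e
      by (cases k; cases l) (simp_all add: matrix_mult_entry sum_option gi_simps g_simps mat_def)
    then show ?thesis by (simp add: vec_eq_iff)
  qed
  have symi: "matrix_inv (H p) $ i $ j = matrix_inv (H p) $ j $ i" for i j
    using arg_cong[OF transpose_matrix_inv[OF detnz sym], OF S(2) S(2), of "\<lambda>M. M $ i $ j"]
    by (simp add: transpose_def)
  have symg: "transpose (gi p) = gi p"
  proof -
    have "transpose (gi p) $ k $ l = gi p $ k $ l" for k l
      by (cases k; cases l) (simp_all add: transpose_def gi_simps symi)
    then show ?thesis by (simp add: vec_eq_iff)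
  qed
  have smN: "smooth_on S (\<lambda>q. q $ None)"
    by (rule smooth_on_linear[OF bounded_linear_vec_nth S(1)])
  have smpow: "smooth_on S (\<lambda>q. (q $ None) ^ m)" for m
    using smooth_on_prod[OF S(1), of "{..<m}" "\<lambda>_ q. q $ None"] smN by simp
  have smH: "smooth_on S (\<lambda>q. H q $ i $ j)" for i j
    by (intro smooth_on_vec_nth S H)
  have sminv: "smooth_on S (\<lambda>q. matrix_inv (H q) $ i $ j)" for i j
    by (intro smooth_on_matrix_inv S smH det)
  have smg: "smooth_on S (\<lambda>q. ?g q $ k $ l)" for k l
    using pos[THEN less_imp_neq, symmetric] pos
    by (cases k; cases l) (auto simp: g_simps simp del: zero_less_power2 intro!: smooth_on_divide S smH smooth_on_const smpow zero_less_power)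
  have smgi: "smooth_on S (\<lambda>q. gi q $ k $ l)" for k l
    by (cases k; cases l) (auto simp: gi_simps intro!: smooth_on_mult S sminv smooth_on_const smpow)
  have smdet: "smooth_on S (\<lambda>q. sqrt (det (H q)))"
    by (intro smooth_on_sqrt S smooth_on_det smH det)
  have smrho: "smooth_on S \<rho>"
    unfolding \<rho>_def[abs_def] using pos by (intro smooth_on_divide S smdet smpow) auto
  have drho: "pderivative l \<rho> p =
        \<rho> p * (\<Sum>a\<in>UNIV. \<Sum>b\<in>UNIV. gi p $ a $ b * pderivative l (\<lambda>q. ?g q $ a $ b) p) / 2" for l
  proof -
    define dl where "dl = (axis l (1::real) :: real^('n option)) $ None"
    define dH where "dH i j = pderivative l (\<lambda>q. H q $ i $ j) p" for i j
    have hN: "((\<lambda>q. q $ None) has_derivative (\<lambda>w. w $ None)) (at p)"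
      by (rule bounded_linear_imp_has_derivative[OF bounded_linear_vec_nth])
    have hH: "(H has_derivative frechet_derivative H (at p)) (at p)"
      by (rule smooth_on_has_derivative[OF H S(2)])
    have dHe: "frechet_derivative H (at p) (axis l 1) $ i $ j = dH i j" for i j
      unfolding dH_def
      using pderivative_eq[OF has_derivative_vec_entry[OF has_derivative_vec_entry[OF hH]]] by simp
    have dgN: "pderivative l (\<lambda>q. ?g q $ None $ None) p = - 2 * dl / ?r ^ 3"
    proof -
      have "((\<lambda>q. 1 / (q $ None)\<^sup>2) has_derivative (\<lambda>w. - 2 * w $ None / ?r ^ 3)) (at p)"
        using r by (auto intro!: derivative_eq_intros hN simp: field_simps power2_eq_square power3_eq_cube)
      from pderivative_eq[OF this] show ?thesis by (simp add: g_simps dl_def)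
    qed
    have dgS: "pderivative l (\<lambda>q. ?g q $ Some i $ Some j) p = dH i j / ?r\<^sup>2 - 2 * dl * H p $ i $ j / ?r ^ 3" for i j
    proof -
      have "((\<lambda>q. H q $ i $ j / (q $ None)\<^sup>2) has_derivative
         (\<lambda>w. frechet_derivative H (at p) w $ i $ j / ?r\<^sup>2 - 2 * w $ None * H p $ i $ j / ?r ^ 3)) (at p)"
        using r by (auto intro!: derivative_eq_intros hN has_derivative_vec_entry hH
            simp: field_simps power2_eq_square power3_eq_cube)
      from pderivative_eq[OF this] show ?thesis by (simp add: g_simps dl_def dHe)
    qed
    have tr: "(\<Sum>i\<in>UNIV. \<Sum>j\<in>UNIV. matrix_inv (H p) $ i $ j * H p $ i $ j) = real n"
    proof -
      have "(\<Sum>j\<in>UNIV. matrix_inv (H p) $ i $ j * H p $ i $ j) = 1" for i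
      proof -
        have "H p $ i $ j = H p $ j $ i" for j
          using arg_cong[OF sym[OF S(2)], of "\<lambda>M. M $ i $ j"] by (simp add: transpose_def)
        then have "(\<Sum>j\<in>UNIV. matrix_inv (H p) $ i $ j * H p $ i $ j) = (matrix_inv (H p) ** H p) $ i $ i"
          by (simp add: matrix_mult_entry)
        then show ?thesis by (simp add: matrix_inv_works(2)[OF detnz[OF S(2)]] mat_def)
      qed
      then show ?thesis by (simp add: n_def)
    qed
    define tH where "tH = (\<Sum>i\<in>UNIV. \<Sum>j\<in>UNIV. matrix_inv (H p) $ i $ j * dH i j)"
    have "(\<Sum>a\<in>UNIV. \<Sum>b\<in>UNIV. gi p $ a $ b * pderivative l (\<lambda>q. ?g q $ a $ b) p)
       = ?r\<^sup>2 * (- 2 * dl / ?r ^ 3) + (\<Sum>i\<in>UNIV. \<Sum>j\<in>UNIV. matrix_inv (H p) $ i $ j * ?r\<^sup>2 *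
            (dH i j / ?r\<^sup>2 - 2 * dl * H p $ i $ j / ?r ^ 3))"
      by (simp add: sum_option gi_simps dgN dgS)
    also have "(\<Sum>i\<in>UNIV. \<Sum>j\<in>UNIV. matrix_inv (H p) $ i $ j * ?r\<^sup>2 *
            (dH i j / ?r\<^sup>2 - 2 * dl * H p $ i $ j / ?r ^ 3))
       = (\<Sum>i\<in>UNIV. \<Sum>j\<in>UNIV. matrix_inv (H p) $ i $ j * dH i j
            - (2 * dl / ?r) * (matrix_inv (H p) $ i $ j * H p $ i $ j))"
      using r by (intro sum.cong refl) (simp add: field_simps power2_eq_square power3_eq_cube)
    also have "\<dots> = tH - (2 * dl / ?r) * real n"
      by (simp only: sum_subtractf sum_distrib_left[symmetric] tr tH_def)
    also have "?r\<^sup>2 * (- 2 * dl / ?r ^ 3) + (tH - (2 * dl / ?r) * real n) = tH - 2 * dl * (real n + 1) / ?r"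
      using r by (simp add: field_simps power2_eq_square power3_eq_cube)
    finally have sum: "(\<Sum>a\<in>UNIV. \<Sum>b\<in>UNIV. gi p $ a $ b * pderivative l (\<lambda>q. ?g q $ a $ b) p)
       = tH - 2 * dl * (real n + 1) / ?r" .
    have hd: "((\<lambda>q. det (H q)) has_derivative
        (\<lambda>w. det (H p) * (\<Sum>a\<in>UNIV. \<Sum>b\<in>UNIV. matrix_inv (H p) $ b $ a * frechet_derivative H (at p) w $ a $ b))) (at p)"
      by (rule has_derivative_det[OF hH detnz[OF S(2)]])
    let ?D = "det (H p)"
    have D: "0 < ?D" using det[OF S(2)] .
    define tr where "tr w = (\<Sum>a\<in>UNIV. \<Sum>b\<in>UNIV. matrix_inv (H p) $ b $ a *
           frechet_derivative H (at p) w $ a $ b)" for w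
    have trl: "tr (axis l 1) = tH"
      unfolding tr_def tH_def dHe by (intro sum.cong refl arg_cong2[of _ _ _ _ "(*)"] symi)
    have hs: "((\<lambda>q. sqrt (det (H q))) has_derivative (\<lambda>w. ?D * tr w * (inverse (sqrt ?D) / 2))) (at p)"
      unfolding tr_def by (rule has_derivative_real_sqrt[OF D hd])
    have hp: "((\<lambda>q. (q $ None) ^ (n + 1)) has_derivative (\<lambda>w. real (n + 1) * w $ None * ?r ^ (n + 1 - 1))) (at p)"
      by (rule has_derivative_power[OF hN])
    define R where "R = ?r ^ (n + 1)"
    have R: "0 < R" "R \<noteq> 0" "?r ^ (n + 1 - 1) = R / ?r" using r by (simp_all add: R_def)
    have "(\<rho> has_derivative (\<lambda>w. - sqrt ?D * (inverse R * (real (n + 1) * w $ None * (R / ?r)) * inverse R)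
        + ?D * tr w * (inverse (sqrt ?D) / 2) / R)) (at p)"
      using has_derivative_divide[OF hs hp, folded R_def, OF R(2)]
      unfolding \<rho>_def[abs_def] R(3) .
    from pderivative_eq[OF this, of l]
    have "pderivative l \<rho> p = - sqrt ?D * (inverse R * (real (n + 1) * dl * (R / ?r)) * inverse R)
        + ?D * tH * (inverse (sqrt ?D) / 2) / R"
      by (simp only: trl dl_def)
    also have "?D * tH * (inverse (sqrt ?D) / 2) = sqrt ?D * tH / 2"
    proof -
      have "?D * inverse (sqrt ?D) = sqrt ?D"
        using D by (simp add: real_div_sqrt flip: divide_inverse)
      moreover have "?D * tH * (inverse (sqrt ?D) / 2) = (?D * inverse (sqrt ?D)) * tH / 2"
        by (simp only: times_divide_eq_right mult_ac)
      ultimately show ?thesis by (simp only:)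
    qed
    also have "- sqrt ?D * (inverse R * (real (n + 1) * dl * (R / ?r)) * inverse R) + sqrt ?D * tH / 2 / R
        = sqrt ?D / R * (tH - 2 * dl * (real n + 1) / ?r) / 2"
      using R(1) r by (simp add: field_simps)
    also have "sqrt ?D / R = \<rho> p" by (simp add: \<rho>_def R_def)
    finally show ?thesis unfolding sum .
  qed
  have div: "\<rho> p *\<^sub>R laplacian ?g u p =
    (\<Sum>i\<in>UNIV. pderivative i (\<lambda>q. \<Sum>j\<in>UNIV. (\<rho> q * gi q $ i $ j) *\<^sub>R pderivative j u q) p)"
    by (rule laplacian_divergence_form[where g="?g" and gi=gi and \<rho>=\<rho>, OF S inv symg _ _ _ drho])
       (auto intro: smooth_on_differentiable[OF _ S(2)] smg smgi smrho smooth_on_pderivative[OF u])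
  have rn: "(q $ None)\<^sup>2 / (q $ None) ^ (n + 1) = 1 / (q $ None) ^ (n - 1)" if "q \<in> S" for q
  proof -
    have "0 < n" by (simp add: n_def)
    then have "n + 1 = (n - 1) + 2" by simp
    then have "(q $ None) ^ (n + 1) = (q $ None) ^ (n - 1) * (q $ None)\<^sup>2"
      by (metis power_add)
    then show ?thesis using pos[OF that] by simp
  qed
  have rho_r2: "\<rho> q * (q $ None)\<^sup>2 = sqrt (det (H q)) / (q $ None) ^ (n - 1)" if "q \<in> S" for q
    using arg_cong[OF rn[OF that], of "\<lambda>x. sqrt (det (H q)) * x"] by (simp only: \<rho>_def times_divide_eq_right times_divide_eq_left mult_1_right)
  have "pderivative None (\<lambda>q. \<Sum>j\<in>UNIV. (\<rho> q * gi q $ None $ j) *\<^sub>R pderivative j u q) p =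
     pderivative None (\<lambda>q. (sqrt (det (H q)) / (q $ None) ^ (n - 1)) *\<^sub>R pderivative None u q) p"
    by (rule pderivative_cong_open[OF S]) (simp add: sum_option gi_simps rho_r2)
  moreover have "pderivative (Some i) (\<lambda>q. \<Sum>j\<in>UNIV. (\<rho> q * gi q $ Some i $ j) *\<^sub>R pderivative j u q) p =
     pderivative (Some i) (\<lambda>q. \<Sum>j\<in>UNIV. (sqrt (det (H q)) * matrix_inv (H q) $ i $ j / (q $ None) ^ (n - 1)) *\<^sub>R
             pderivative (Some j) u q) p" for i
  proof (rule pderivative_cong_open[OF S])
    fix q assume q: "q \<in> S"
    have "\<rho> q * (matrix_inv (H q) $ i $ j * (q $ None)\<^sup>2) =
       sqrt (det (H q)) * matrix_inv (H q) $ i $ j / (q $ None) ^ (n - 1)" for j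
      using arg_cong[OF rho_r2[OF q], of "\<lambda>x. matrix_inv (H q) $ i $ j * x"]
      by (simp only: times_divide_eq_right mult_ac)
    then show "(\<Sum>j\<in>UNIV. (\<rho> q * gi q $ Some i $ j) *\<^sub>R pderivative j u q) =
       (\<Sum>j\<in>UNIV. (sqrt (det (H q)) * matrix_inv (H q) $ i $ j / (q $ None) ^ (n - 1)) *\<^sub>R
             pderivative (Some j) u q)"
      by (simp add: sum_option gi_simps )
  qed
  ultimately have "\<rho> p *\<^sub>R laplacian ?g u p =
     (pderivative None (\<lambda>q. (sqrt (det (H q)) / (q $ None) ^ (n - 1)) *\<^sub>R pderivative None u q) p
      + (\<Sum>i\<in>UNIV. pderivative (Some i) (\<lambda>q. \<Sum>j\<in>UNIV.
          (sqrt (det (H q)) * matrix_inv (H q) $ i $ j / (q $ None) ^ (n - 1)) *\<^sub>R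
             pderivative (Some j) u q) p))"
    using div by (simp add: sum_option)
  moreover have "sqrt (det (H p)) = ?r ^ (n + 1) * \<rho> p"
    using r by (simp add: \<rho>_def)
  ultimately show ?thesis by (simp only: scaleR_scaleR[symmetric])
qed

section \<open>Comparison of asymptotic expansions\<close>

abbreviation O0 :: "nat \<Rightarrow> (real \<Rightarrow> complex) set" where
  "O0 k \<equiv> O[at_right 0](\<lambda>r. complex_of_real r ^ k)"

lemma O0_I:
  assumes "0 < \<delta>" "\<And>r. 0 < r \<Longrightarrow> r < \<delta> \<Longrightarrow> norm (F r) \<le> C * r ^ k"
  shows "F \<in> O0 k"
proof (rule bigoI)
  show "\<forall>\<^sub>F r in at_right 0. norm (F r) \<le> C * norm (complex_of_real r ^ k)"
    unfolding eventually_at_right_field using assms by (auto simp: norm_power)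
qed

lemma O0_E:
  assumes "F \<in> O0 k"
  obtains C \<delta> where "0 < C" "0 < \<delta>" "\<And>r. 0 < r \<Longrightarrow> r < \<delta> \<Longrightarrow> norm (F r) \<le> C * r ^ k"
proof -
  obtain C where C: "0 < C" "\<forall>\<^sub>F r in at_right 0. norm (F r) \<le> C * norm (complex_of_real r ^ k)"
    using assms by (elim landau_o.bigE)
  obtain \<delta> where "0 < \<delta>" "\<And>r. 0 < r \<Longrightarrow> r < \<delta> \<Longrightarrow> norm (F r) \<le> C * norm (complex_of_real r ^ k)"
    using C(2) unfolding eventually_at_right_field by auto
  then show thesis using C(1) by (intro that[of C \<delta>]) (auto simp: norm_power)
qed

lemma O0_mult_power:
  assumes "F \<in> O0 k"
  shows "(\<lambda>r. complex_of_real r ^ l * F r) \<in> O0 (l + k)"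
  unfolding power_add by (rule landau_o.big.mult[OF landau_o.big_refl assms])

lemma O0_mono:
  assumes "F \<in> O0 l" "k \<le> l"
  shows "F \<in> O0 k"
proof -
  have "(\<lambda>r. complex_of_real r ^ l) \<in> O0 k"
    by (rule O0_I[of 1 _ 1]) (use assms(2) in \<open>auto simp: norm_power intro: power_decreasing\<close>)
  then show ?thesis using assms(1) by (rule landau_o.big_trans[rotated])
qed

lemma O0_cmult: "F \<in> O0 k \<Longrightarrow> (\<lambda>r. c * F r) \<in> O0 k"
  by (cases "c = 0") auto

text \<open>Division by the lowest power with a nonzero coefficient would give a function with two
  different limits at \<open>0\<close>.\<close>
lemma vanishing_expansion:
  assumes F: "(\<lambda>r. \<Sum>i\<le>N. e i * complex_of_real r ^ i) \<in> O0 (Suc N)" and "i \<le> N"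
  shows "e i = 0"
  using assms(2)
proof (induction i rule: less_induct)
  case (less i)
  obtain C \<delta> where C: "0 < C" "0 < \<delta>"
    "\<And>r. 0 < r \<Longrightarrow> r < \<delta> \<Longrightarrow> norm (\<Sum>i\<le>N. e i * complex_of_real r ^ i) \<le> C * r ^ Suc N"
    using O0_E[OF F] by metis
  define G where "G r = (\<Sum>k\<in>{i..N}. e k * complex_of_real r ^ (k - i))" for r
  have G: "(\<Sum>i\<le>N. e i * complex_of_real r ^ i) = complex_of_real r ^ i * G r" for r
  proof -
    have "(\<Sum>i\<le>N. e i * complex_of_real r ^ i) = (\<Sum>k\<in>{i..N}. e k * complex_of_real r ^ k)"
      using less by (intro sum.mono_neutral_right) auto
    also have "\<dots> = complex_of_real r ^ i * G r"
      unfolding G_def sum_distrib_left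
      by (intro sum.cong refl) (auto simp: mult.left_commute simp flip: power_add)
    finally show ?thesis .
  qed
  have "(G \<longlongrightarrow> (\<Sum>k\<in>{i..N}. e k * complex_of_real 0 ^ (k - i))) (at_right 0)"
    unfolding G_def by (intro tendsto_intros)
  moreover have "(\<Sum>k\<in>{i..N}. e k * complex_of_real 0 ^ (k - i)) = e i"
  proof -
    have "(\<Sum>k\<in>{i..N}. e k * complex_of_real 0 ^ (k - i)) = (\<Sum>k\<in>{i..N}. if k = i then e k else 0)"
      by (intro sum.cong refl) (auto simp: power_0_left)
    then show ?thesis using less.prems by simp
  qed
  moreover have "(G \<longlongrightarrow> 0) (at_right 0)"
  proof (rule Lim_null_comparison)
    show "((\<lambda>r. C * r) \<longlongrightarrow> 0) (at_right (0::real))"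
      by (auto intro!: tendsto_eq_intros)
    have "norm (G r) \<le> C * r" if r: "0 < r" "r < min \<delta> 1" for r
    proof -
      have "r ^ i * norm (G r) \<le> C * r ^ Suc N"
        using C(3)[of r] r unfolding G by (simp add: norm_mult norm_power)
      also have "\<dots> \<le> C * r ^ Suc i"
        using C(1) r less.prems by (intro mult_left_mono power_decreasing) auto
      finally show ?thesis using r by (simp add: mult.left_commute)
    qed
    moreover have "0 < min \<delta> 1" using C by simp
    ultimately show "\<forall>\<^sub>F r in at_right 0. norm (G r) \<le> C * r"
      unfolding eventually_at_right_field by blast
  qed
  ultimately show ?case using tendsto_unique[of "at_right (0::real)" G] by simp
qed

text \<open>If \<open>r Z' = \<Sum>\<^sub>i d\<^sub>i r\<^sup>i + O(r^(N+1))\<close>, then \<open>Z\<close> differs from \<open>d\<^sub>0 log r + \<Sum>\<^sub>i\<^sub>\<ge>\<^sub>1 d\<^sub>i r\<^sup>i / i\<close> by a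
  function whose derivative is \<open>O(r\<^sup>N)\<close>.  The increment between \<open>r/2\<close> and \<open>r\<close> of this difference is \<open>O(r^(N+1))\<close> by the
  mean value inequality, and that of \<open>Z\<close> is so by hypothesis.  Hence the increment of the
  explicit part, which is \<open>\<Sum>\<^sub>i d\<^sub>i w\<^sub>i r\<^sup>i\<close> with nonzero weights \<open>w\<^sub>i\<close>, vanishes to the same order.\<close>
lemma vanishing_euler_expansion:
  fixes Z :: "real \<Rightarrow> complex"
  assumes \<delta>: "0 < \<delta>" and Z: "\<And>r. 0 < r \<Longrightarrow> r < \<delta> \<Longrightarrow> (Z has_vector_derivative Z' r) (at r)"
    and small: "Z \<in> O0 (Suc N)"
    and expansion: "(\<lambda>r. complex_of_real r * Z' r - (\<Sum>i\<le>N. d i * complex_of_real r ^ i)) \<in> O0 (Suc N)"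
    and "i \<le> N"
  shows "d i = 0"
proof -
  define w where "w k = (if k = 0 then complex_of_real (ln 2) else of_real ((1 - (1/2) ^ k) / real k))" for k
  define prim where "prim k r = (if k = 0 then complex_of_real (ln r) else of_real (r ^ k / real k))" for k r
  define L where "L r = Z r - (\<Sum>k\<le>N. d k * prim k r)" for r
  have prim_diff: "prim k r - prim k (r / 2) = w k * complex_of_real r ^ k" if "0 < r" for k r
  proof (cases "k = 0")
    case True
    then show ?thesis using that by (simp add: prim_def w_def ln_div)
  next
    case False
    have "r ^ k / real k - (r / 2) ^ k / real k = (1 - (1/2) ^ k) / real k * r ^ k"
      by (simp add: power_divide diff_divide_distrib left_diff_distrib)
    from arg_cong[OF this, of complex_of_real] show ?thesis
      using False by (simp only: prim_def w_def of_real_diff of_real_mult of_real_power if_False)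
  qed
  have prim': "(prim k has_vector_derivative complex_of_real r ^ k / of_real r) (at r)" if r: "0 < r" for k r
  proof (cases "k = 0")
    case True
    have "((\<lambda>r. complex_of_real (ln r)) has_vector_derivative of_real (1 / r)) (at r)"
      using r by (intro has_vector_derivative_of_real) (auto intro!: derivative_eq_intros)
    then show ?thesis using True by (simp add: prim_def[abs_def])
  next
    case False
    then obtain m where m: "k = Suc m" by (cases k) auto
    have "((\<lambda>r. r ^ Suc m / real (Suc m)) has_real_derivative real (Suc m) * r ^ m / real (Suc m)) (at r)"
      by (intro DERIV_cdivide) (auto intro!: derivative_eq_intros simp del: of_nat_Suc power_Suc)
    then have "((\<lambda>r. r ^ Suc m / real (Suc m)) has_real_derivative r ^ m) (at r)"
      by (simp del: of_nat_Suc power_Suc)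
    from has_vector_derivative_of_real[OF this]
    have "(prim k has_vector_derivative of_real (r ^ m)) (at r)"
      unfolding prim_def[abs_def] m by (simp only: nat.distinct if_False)
    moreover have "complex_of_real (r ^ m) = complex_of_real r ^ k / of_real r"
      using r unfolding m by simp
    ultimately show ?thesis by (simp only:)
  qed
  obtain C1 \<delta>1 where C1: "0 < C1" "0 < \<delta>1" "\<And>r. 0 < r \<Longrightarrow> r < \<delta>1 \<Longrightarrow>
      norm (complex_of_real r * Z' r - (\<Sum>i\<le>N. d i * complex_of_real r ^ i)) \<le> C1 * r ^ Suc N"
    using O0_E[OF expansion] by metis
  obtain C2 \<delta>2 where C2: "0 < C2" "0 < \<delta>2" "\<And>r. 0 < r \<Longrightarrow> r < \<delta>2 \<Longrightarrow> norm (Z r) \<le> C2 * r ^ Suc N"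
    using O0_E[OF small] by metis
  define L' where "L' r = Z' r - (\<Sum>k\<le>N. d k * (complex_of_real r ^ k / of_real r))" for r
  have L: "(L has_vector_derivative L' r) (at r)" if "0 < r" "r < \<delta>" for r
    unfolding L_def[abs_def] L'_def using that
    by (intro has_vector_derivative_diff Z has_vector_derivative_sum has_vector_derivative_mult_right prim') auto
  have L'_bound: "norm (L' r) \<le> C1 * r ^ N" if "0 < r" "r < \<delta>1" for r
  proof -
    have "complex_of_real r * L' r = complex_of_real r * Z' r - (\<Sum>i\<le>N. d i * complex_of_real r ^ i)"
      using that by (simp add: L'_def right_diff_distrib sum_distrib_left)
    then have "r * norm (L' r) \<le> C1 * r ^ Suc N"
      using C1(3)[OF that] that norm_mult[of "complex_of_real r" "L' r"] by simp
    then show ?thesis using that by (simp add: mult.left_commute)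
  qed
  have diff: "norm (L r - L (r/2)) \<le> C1 * r ^ Suc N" if r: "0 < r" "r < min \<delta> \<delta>1" for r
  proof -
    have "norm (L r - L (r/2)) \<le> (C1 * r ^ N) * norm (r - r/2)"
    proof (rule differentiable_bound[of "{r/2..r}" L "\<lambda>s h. h *\<^sub>R L' s"])
      fix s assume s: "s \<in> {r/2..r}"
      show "(L has_derivative (\<lambda>h. h *\<^sub>R L' s)) (at s within {r/2..r})"
        using L[of s] s r unfolding has_vector_derivative_def by (auto intro: has_derivative_at_withinI)
      have "norm (L' s) \<le> C1 * s ^ N" using L'_bound[of s] s r by auto
      also have "\<dots> \<le> C1 * r ^ N" using C1(1) s r by (intro mult_left_mono power_mono) auto
      finally have "norm (L' s) \<le> C1 * r ^ N" .
      then show "onorm (\<lambda>h. h *\<^sub>R L' s) \<le> C1 * r ^ N"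
      proof (intro onorm_bound)
        show "0 \<le> C1 * r ^ N" using C1(1) r by simp
        show "norm (h *\<^sub>R L' s) \<le> C1 * r ^ N * norm h" for h
          using mult_left_mono[OF \<open>norm (L' s) \<le> C1 * r ^ N\<close>, of "\<bar>h\<bar>"] by (simp add: mult.commute)
      qed
    qed (use r in auto)
    also have "\<dots> \<le> (C1 * r ^ N) * r" using C1(1) r by (intro mult_left_mono) auto
    finally show ?thesis by (simp add: mult_ac)
  qed
  have "(\<lambda>r. \<Sum>k\<le>N. (d k * w k) * complex_of_real r ^ k) \<in> O0 (Suc N)"
  proof (rule O0_I[of "min \<delta> (min \<delta>1 \<delta>2)" _ "2 * C2 + C1"])
    show "0 < min \<delta> (min \<delta>1 \<delta>2)" using \<delta> C1 C2 by simp
    fix r assume r: "0 < r" "r < min \<delta> (min \<delta>1 \<delta>2)"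
    have "(\<Sum>k\<le>N. (d k * w k) * complex_of_real r ^ k) = (\<Sum>k\<le>N. d k * prim k r) - (\<Sum>k\<le>N. d k * prim k (r/2))"
      unfolding sum_subtractf[symmetric] right_diff_distrib[symmetric] prim_diff[OF r(1)] by (simp add: mult.assoc)
    also have "\<dots> = Z r - Z (r/2) - (L r - L (r/2))" by (simp add: L_def)
    finally have "norm (\<Sum>k\<le>N. (d k * w k) * complex_of_real r ^ k) \<le> norm (Z r) + norm (Z (r/2)) + norm (L r - L (r/2))"
      using norm_triangle_ineq4[of "Z r - Z (r/2)" "L r - L (r/2)"] norm_triangle_ineq4[of "Z r" "Z (r/2)"]
      by simp
    moreover have "norm (Z r) \<le> C2 * r ^ Suc N" using C2(3)[of r] r by auto
    moreover have "norm (Z (r/2)) \<le> C2 * (r/2) ^ Suc N" using C2(3)[of "r/2"] r by auto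
    moreover have "C2 * (r/2) ^ Suc N \<le> C2 * r ^ Suc N"
      using C2(1) r by (intro mult_left_mono power_mono) auto
    moreover have "norm (L r - L (r/2)) \<le> C1 * r ^ Suc N" using diff[of r] r by auto
    ultimately show "norm (\<Sum>k\<le>N. (d k * w k) * complex_of_real r ^ k) \<le> (2 * C2 + C1) * r ^ Suc N"
      by (simp add: distrib_right)
  qed
  from vanishing_expansion[OF this \<open>i \<le> N\<close>] have "d i * w i = 0" .
  moreover have "w i \<noteq> 0"
  proof (cases "i = 0")
    case False
    then have "(1/2::real) ^ i < 1" using power_strict_decreasing[of 0 i "1/2::real"] by simp
    then have "(1 - (1/2::real) ^ i) / real i \<noteq> 0" using False by simp
    then show ?thesis using False unfolding w_def by (simp only: of_real_eq_0_iff if_False not_False_eq_True)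
  qed (simp add: w_def)
  ultimately show ?thesis by simp
qed

text \<open>Expansions of a function and of its derivative are compatible, although neither was obtained
  from the other: apply the previous lemma to the remainder \<open>Z = r^(-\<mu>) P - \<Sum>\<^sub>i \<alpha>\<^sub>i r\<^sup>i\<close>, for which
  \<open>r Z' = \<Sum>\<^sub>i (\<beta>\<^sub>i - (\<mu> + i) \<alpha>\<^sub>i) r\<^sup>i\<close> up to \<open>O(r^(N+1))\<close>.\<close>
lemma derivative_of_expansion:
  fixes P :: "real \<Rightarrow> complex"
  assumes \<delta>: "0 < \<delta>" and P: "\<And>r. 0 < r \<Longrightarrow> r < \<delta> \<Longrightarrow> (P has_vector_derivative P' r) (at r)"
    and a: "(\<lambda>r. complex_of_real r powr (- \<mu>) * P r - (\<Sum>i\<le>N. \<alpha> i * complex_of_real r ^ i)) \<in> O0 (Suc N)"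
    and b: "(\<lambda>r. complex_of_real r powr (1 - \<mu>) * P' r - (\<Sum>i\<le>N. \<beta> i * complex_of_real r ^ i)) \<in> O0 (Suc N)"
    and "i \<le> N"
  shows "\<beta> i = (\<mu> + of_nat i) * \<alpha> i"
proof -
  define Z where "Z r = complex_of_real r powr (- \<mu>) * P r - (\<Sum>i\<le>N. \<alpha> i * complex_of_real r ^ i)" for r
  define Z' where "Z' r = complex_of_real r powr (- \<mu>) * P' r
     + (- \<mu> * complex_of_real r powr (- \<mu> - 1)) * P r
     - (\<Sum>i\<le>N. \<alpha> i * (of_nat i * complex_of_real r ^ (i - 1)))" for r
  have pow: "((\<lambda>r. complex_of_real r ^ k) has_vector_derivative of_nat k * complex_of_real r ^ (k - 1)) (at r)" for k r
  proof -
    have "((\<lambda>r. r ^ k) has_real_derivative real k * r ^ (k - 1)) (at r)"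
      by (auto intro!: derivative_eq_intros)
    from has_vector_derivative_of_real[OF this] show ?thesis by simp
  qed
  have Zd: "(Z has_vector_derivative Z' r) (at r)" if "0 < r" "r < \<delta>" for r
    unfolding Z_def[abs_def] Z'_def using that
    by (intro has_vector_derivative_diff has_vector_derivative_mult P has_vector_derivative_of_real_powr
        has_vector_derivative_sum has_vector_derivative_mult_right pow) auto
  have "(\<lambda>r. (complex_of_real r powr (1 - \<mu>) * P' r - (\<Sum>i\<le>N. \<beta> i * complex_of_real r ^ i)) - \<mu> * Z r) \<in> O0 (Suc N)"
    by (rule sum_in_bigo(2)[OF b O0_cmult]) (use a in \<open>simp add: Z_def[abs_def]\<close>)
  moreover have "(complex_of_real r powr (1 - \<mu>) * P' r - (\<Sum>i\<le>N. \<beta> i * complex_of_real r ^ i)) - \<mu> * Z r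
     = complex_of_real r * Z' r - (\<Sum>i\<le>N. (\<beta> i - (\<mu> + of_nat i) * \<alpha> i) * complex_of_real r ^ i)" if r: "0 < r" for r
  proof -
    have e1: "complex_of_real r powr (1 - \<mu>) = complex_of_real r * complex_of_real r powr (- \<mu>)"
      using r powr_add[of "complex_of_real r" 1 "- \<mu>"] by simp
    have e2: "complex_of_real r * complex_of_real r powr (- \<mu> - 1) = complex_of_real r powr (- \<mu>)"
      using r powr_add[of "complex_of_real r" 1 "- \<mu> - 1"] by simp
    have e3: "complex_of_real r * (\<Sum>i\<le>N. \<alpha> i * (of_nat i * complex_of_real r ^ (i - 1)))
        = (\<Sum>i\<le>N. of_nat i * \<alpha> i * complex_of_real r ^ i)"
      unfolding sum_distrib_left
    proof (intro sum.cong refl)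
      fix k show "complex_of_real r * (\<alpha> k * (of_nat k * complex_of_real r ^ (k - 1))) = of_nat k * \<alpha> k * complex_of_real r ^ k"
        by (cases k) auto
    qed
    have "complex_of_real r * Z' r = complex_of_real r powr (1 - \<mu>) * P' r
        - \<mu> * (complex_of_real r powr (- \<mu>) * P r)
        - (\<Sum>i\<le>N. of_nat i * \<alpha> i * complex_of_real r ^ i)"
    proof -
      have "complex_of_real r * Z' r = (complex_of_real r * complex_of_real r powr (- \<mu>)) * P' r
         - \<mu> * ((complex_of_real r * complex_of_real r powr (- \<mu> - 1)) * P r)
         - complex_of_real r * (\<Sum>i\<le>N. \<alpha> i * (of_nat i * complex_of_real r ^ (i - 1)))"
        unfolding Z'_def by (simp add: algebra_simps)
      then show ?thesis unfolding e2 e3 e1[symmetric] .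
    qed
    moreover have "(\<Sum>i\<le>N. (\<beta> i - (\<mu> + of_nat i) * \<alpha> i) * complex_of_real r ^ i) =
       (\<Sum>i\<le>N. \<beta> i * complex_of_real r ^ i) - \<mu> * (\<Sum>i\<le>N. \<alpha> i * complex_of_real r ^ i)
        - (\<Sum>i\<le>N. of_nat i * \<alpha> i * complex_of_real r ^ i)"
      unfolding sum_distrib_left sum_subtractf[symmetric] by (intro sum.cong refl) (simp add: algebra_simps)
    ultimately show ?thesis by (simp add: Z_def right_diff_distrib)
  qed
  then have "\<forall>\<^sub>F r in at_right 0. (complex_of_real r powr (1 - \<mu>) * P' r - (\<Sum>i\<le>N. \<beta> i * complex_of_real r ^ i)) - \<mu> * Z r
     = complex_of_real r * Z' r - (\<Sum>i\<le>N. (\<beta> i - (\<mu> + of_nat i) * \<alpha> i) * complex_of_real r ^ i)"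
    unfolding eventually_at_right_field using zero_less_one by blast
  ultimately have "(\<lambda>r. complex_of_real r * Z' r - (\<Sum>i\<le>N. (\<beta> i - (\<mu> + of_nat i) * \<alpha> i) * complex_of_real r ^ i)) \<in> O0 (Suc N)"
    by (rule landau_o.big.in_cong[THEN iffD1, rotated])
  moreover have "Z \<in> O0 (Suc N)" using a by (simp add: Z_def[abs_def])
  ultimately have "\<beta> i - (\<mu> + of_nat i) * \<alpha> i = 0"
    using vanishing_euler_expansion[OF \<delta> Zd, where N=N and i=i and d="\<lambda>i. \<beta> i - (\<mu> + of_nat i) * \<alpha> i"] \<open>i \<le> N\<close>
    by blast
  then show ?thesis by simp
qed

section \<open>Integration over boxes\<close>

lemma box_neighbourhood:
  fixes y :: "'a::euclidean_space"
  assumes "open S" "y \<in> S"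
  obtains d a b where "0 < d" "cball y d \<subseteq> cbox a b" "cbox a b \<subseteq> S"
proof -
  obtain a b where ab: "cbox a b \<subseteq> S" "y \<in> box a b"
    using assms open_contains_cbox by metis
  obtain d where "0 < d" "cball y d \<subseteq> box a b"
    using ab(2) open_contains_cball open_box by blast
  then show thesis using ab(1) box_subset_cbox[of a b] that[of d a b] by (meson order_trans)
qed

text \<open>Extended by zero, \<open>Y\<close> has an integral that is invariant under translations in the direction
  \<open>i\<close>; differentiation of this constant under the integral sign gives the claim.  The larger box
  contains all translates of the support by vectors of length at most one.\<close>
lemma integral_pderivative_eq_0:
  fixes Y :: "real^'n::finite \<Rightarrow> complex"
  assumes S: "open S" "cbox a b \<subseteq> S"
    and Y: "\<And>x. x \<in> S \<Longrightarrow> Y differentiable (at x)" and cont: "continuous_on S (pderivative i Y)"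
    and supp: "\<And>x. x \<in> S - cbox a b \<Longrightarrow> Y x = 0"
  shows "integral (cbox a b) (pderivative i Y) = 0"
proof -
  define Y0 where "Y0 x = (if x \<in> cbox a b then Y x else 0)" for x
  define e where "e = (axis i 1 :: real^'n)"
  define D where "D = pderivative i Y0"
  have oS: "open (- cbox a b)" by (rule open_Compl[OF closed_cbox])
  have eqS: "Y x = Y0 x" if "x \<in> S" for x using supp[of x] that by (auto simp: Y0_def)
  have eqC: "0 = Y0 x" if "x \<in> - cbox a b" for x using that by (auto simp: Y0_def)
  have dS: "Y0 differentiable (at x)" if "x \<in> S" for x
    by (rule differentiable_cong_open[where f=Y, OF S(1) that eqS Y[OF that]])
  have dC: "Y0 differentiable (at x)" if "x \<in> - cbox a b" for x
    by (rule differentiable_cong_open[where f="\<lambda>_. 0", OF oS that eqC]) auto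
  have diff: "(Y0 has_derivative frechet_derivative Y0 (at x)) (at x)" for x
  proof -
    have "x \<in> S \<or> x \<in> - cbox a b" using S(2) by blast
    then have "Y0 differentiable (at x)" using dS[of x] dC[of x] by (elim disjE)
    then show ?thesis by (simp only: frechet_derivative_works)
  qed
  have DS: "D x = pderivative i Y x" if "x \<in> S" for x
    unfolding D_def by (rule pderivative_cong_open[where f=Y and g=Y0, OF S(1) that eqS, symmetric])
  have DC: "D x = 0" if "x \<in> - cbox a b" for x
  proof -
    have "D x = pderivative i (\<lambda>_. 0) x"
      unfolding D_def by (rule pderivative_cong_open[where f="\<lambda>_. 0" and g=Y0, OF oS that eqC, symmetric])
    then show ?thesis by (simp add: pderivative_def)
  qed
  have "continuous_on S D" using cont by (rule continuous_on_eq) (simp add: DS)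
  moreover have "continuous_on (- cbox a b) D"
    by (rule continuous_on_eq[of _ "\<lambda>_. 0"]) (simp_all add: DC)
  ultimately have "continuous_on (S \<union> - cbox a b) D"
    by (intro continuous_on_open_Un S(1) oS)
  moreover have "S \<union> - cbox a b = UNIV" using S(2) by blast
  ultimately have contD: "continuous_on UNIV D" by simp
  define a' where "a' = a - 1" define b' where "b' = b + 1"
  define F where "F t = integral (cbox a' b') (\<lambda>x. Y0 (x + t *\<^sub>R e))" for t :: real
  have intY: "Y0 integrable_on cbox c d" for c d
    by (rule integrable_continuous)
       (auto intro!: continuous_at_imp_continuous_on has_derivative_continuous[OF diff])
  have F: "F t = integral (cbox a b) Y0" if t: "t \<in> {-1..1}" for t
  proof -
    have sub: "cbox (a - t *\<^sub>R e) (b - t *\<^sub>R e) \<subseteq> cbox a' b'"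
    proof
      fix x assume x: "x \<in> cbox (a - t *\<^sub>R e) (b - t *\<^sub>R e)"
      have "a $ k - 1 \<le> x $ k \<and> x $ k \<le> b $ k + 1" for k
        using x t by (cases "k = i") (auto simp: mem_box_cart e_def axis_def dest!: spec[of _ k])
      then show "x \<in> cbox a' b'" by (simp add: mem_box_cart a'_def b'_def)
    qed
    have "((\<lambda>x. Y0 (x + t *\<^sub>R e)) has_integral integral (cbox a b) Y0) (cbox (a - t *\<^sub>R e) (b - t *\<^sub>R e))"
      by (rule has_integral_shift_cbox) (rule integrable_integral[OF intY])
    then have "((\<lambda>x. Y0 (x + t *\<^sub>R e)) has_integral integral (cbox a b) Y0) (cbox a' b')"
    proof (rule has_integral_on_superset[OF _ _ sub])
      fix x assume "x \<notin> cbox (a - t *\<^sub>R e) (b - t *\<^sub>R e)"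
      then have "x + t *\<^sub>R e \<notin> cbox a b"
        by (auto simp: mem_box_cart algebra_simps)
      then show "Y0 (x + t *\<^sub>R e) = 0" by (simp add: Y0_def)
    qed
    then show ?thesis unfolding F_def by (rule integral_unique)
  qed
  have "(F has_vector_derivative integral (cbox a' b') (\<lambda>x. D (x + 0 *\<^sub>R e))) (at 0 within {-1..1})"
    unfolding F_def[abs_def]
  proof (rule leibniz_rule_vector_derivative[where U="{-1..1}" and fx="\<lambda>t x. D (x + t *\<^sub>R e)"])
    fix t x
    have 1: "((\<lambda>t. x + t *\<^sub>R e) has_derivative (\<lambda>h. h *\<^sub>R e)) (at t within {-1..1})"
      by (auto intro!: derivative_eq_intros)
    have 2: "(Y0 has_derivative frechet_derivative Y0 (at (x + t *\<^sub>R e))) (at (x + t *\<^sub>R e))"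
      by (rule diff)
    interpret linear "frechet_derivative Y0 (at (x + t *\<^sub>R e))" using 2 by (rule has_derivative_linear)
    show "((\<lambda>t. Y0 (x + t *\<^sub>R e)) has_vector_derivative D (x + t *\<^sub>R e)) (at t within {-1..1})"
      using has_derivative_compose[OF 1 2]
      by (simp add: has_vector_derivative_def scale[unfolded e_def] D_def pderivative_def e_def)
  next
    fix t show "(\<lambda>x. Y0 (x + t *\<^sub>R e)) integrable_on cbox a' b'"
      using has_integral_shift_cbox[where a="a' + t *\<^sub>R e" and b="b' + t *\<^sub>R e" and c="t *\<^sub>R e",
          OF integrable_integral[OF intY]]
      by (auto simp: integrable_on_def)
  next
    show "continuous_on ({-1..1} \<times> cbox a' b') (\<lambda>(t, x). D (x + t *\<^sub>R e))"
      unfolding case_prod_beta by (intro continuous_intros continuous_on_compose2[OF contD]) auto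
  qed auto
  moreover have "(F has_vector_derivative 0) (at 0 within {-1..1})"
    by (rule has_vector_derivative_transform[of _ _ _ "\<lambda>_. integral (cbox a b) Y0"]) (auto simp: F)
  ultimately have "integral (cbox a' b') D = 0"
    using vector_derivative_unique_within_closed_interval[of "-1" 1 0 F] by auto
  moreover have "integral (cbox a' b') D = integral (cbox a b) D"
  proof (rule integral_unique, rule has_integral_on_superset)
    show "(D has_integral integral (cbox a b) D) (cbox a b)"
      using contD by (intro integrable_integral integrable_continuous continuous_on_subset[OF contD]) auto
    show "cbox a b \<subseteq> cbox a' b'"
    proof
      fix x assume x: "x \<in> cbox a b"
      have "a $ k - 1 \<le> x $ k \<and> x $ k \<le> b $ k + 1" for k
        using x by (auto simp: mem_box_cart dest!: spec[of _ k])
      then show "x \<in> cbox a' b'" by (simp add: mem_box_cart a'_def b'_def)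
    qed
  qed (use DC in auto)
  moreover have "integral (cbox a b) D = integral (cbox a b) (pderivative i Y)"
    using S(2) DS by (intro integral_cong) auto
  ultimately show ?thesis by simp
qed

text \<open>If \<open>G y\<close> were not zero, the real part of \<open>G\<close> times the conjugate of \<open>G y\<close> would be positive
  near \<open>y\<close>, and its integral against a bump function supported there could not vanish.\<close>
lemma vanishes_if_bump_integrals_vanish:
  fixes G :: "'a::euclidean_space \<Rightarrow> complex"
  assumes W: "open W" and cont: "continuous_on W G"
    and int: "\<And>y0 d a b. \<lbrakk>0 < d; cball y0 d \<subseteq> cbox a b; cbox a b \<subseteq> W\<rbrakk> \<Longrightarrow>
        integral (cbox a b) (\<lambda>y. bump y0 d y *\<^sub>R G y) = 0"
    and y: "y \<in> W"
  shows "G y = 0"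
proof (rule ccontr)
  assume nz: "G y \<noteq> 0"
  define g where "g x = Re (cnj (G y) * G x)" for x
  have gc: "continuous_on W g" unfolding g_def by (intro continuous_intros cont)
  have "0 < g y" using nz by (simp add: g_def complex_norm_square[symmetric] mult.commute flip: power2_eq_square)
  have "open (W \<inter> g -` {0<..})" using gc W by (auto intro!: continuous_open_preimage)
  then obtain d a b where d: "0 < d" "cball y d \<subseteq> cbox a b" "cbox a b \<subseteq> W \<inter> g -` {0<..}"
    by (rule box_neighbourhood[of "W \<inter> g -` {0<..}" y]) (use y \<open>0 < g y\<close> in auto)
  let ?f = "\<lambda>x. bump y d x * g x"
  have bc: "continuous_on T (bump y d)" for T
    by (rule continuous_on_subset[OF smooth_on_continuous[OF smooth_on_bump] subset_UNIV])
  have Gc: "continuous_on (cbox a b) G" using cont d(3) by (auto intro: continuous_on_subset)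
  have "?f y = 0"
  proof (rule has_integral_0_cbox_imp_0[where f="?f" and a=a and b=b])
    show "continuous_on (cbox a b) ?f"
      using d(3) by (intro continuous_intros bc continuous_on_subset[OF gc]) auto
    show "0 \<le> ?f x" if "x \<in> box a b" for x
    proof -
      have "x \<in> W \<inter> g -` {0<..}" using d(3) that box_subset_cbox[of a b] by blast
      then show ?thesis by (simp add: bump_nonneg)
    qed
    have "((\<lambda>x. bump y d x *\<^sub>R G x) has_integral 0) (cbox a b)"
    proof -
      have "(\<lambda>x. bump y d x *\<^sub>R G x) integrable_on cbox a b"
        by (intro integrable_continuous continuous_on_scaleR bc Gc)
      from integrable_integral[OF this] show ?thesis using int[OF d(1,2)] d(3) by simp
    qed
    from has_integral_linear[OF this bounded_linear_compose[OF bounded_linear_Re bounded_linear_mult_right[of "cnj (G y)"]]]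
    show "(?f has_integral 0) (cbox a b)"
      by (simp add: o_def g_def algebra_simps)
    have "y \<in> interior (cbox a b)"
      using interior_maximal[OF order_trans[OF ball_subset_cball d(2)] open_ball] d(1) by auto
    then show "box a b \<noteq> {}" by (auto simp: interior_cbox)
    show "y \<in> cbox a b" using d by auto
  qed
  then show False using bump_pos[OF d(1), of y] \<open>0 < g y\<close> by simp
qed

section \<open>Charts and integration over the manifold\<close>

text \<open>The determinant does not vanish on the segment from the identity matrix to \<open>M\<close>, which
  consists of positive definite matrices.\<close>
lemma pos_def_det_pos:
  fixes M :: "real^'k^'k"
  assumes "\<And>w. w \<noteq> 0 \<Longrightarrow> w \<bullet> (M *v w) > 0"
  shows "0 < det M"
proof (rule ccontr)
  define f where "f t = det ((1 - t) *\<^sub>R mat 1 + t *\<^sub>R M)" for t :: real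
  have nz: "f t \<noteq> 0" if t: "t \<in> {0..1}" for t
  proof -
    let ?M = "(1 - t) *\<^sub>R mat 1 + t *\<^sub>R M"
    have "w = 0" if "?M *v w = 0" for w
    proof (rule ccontr)
      assume w: "w \<noteq> 0"
      have "w \<bullet> (?M *v w) = (1 - t) * (w \<bullet> w) + t * (w \<bullet> (M *v w))"
        by (simp add: matrix_vector_mult_add_rdistrib scaleR_matrix_vector_assoc[symmetric] inner_add_right)
      moreover have "0 < (1 - t) * (w \<bullet> w) + t * (w \<bullet> (M *v w))"
      proof (cases "t = 0")
        case False
        then show ?thesis using t w assms[OF w] by (intro add_nonneg_pos mult_nonneg_nonneg mult_pos_pos) auto
      qed (use w in simp)
      ultimately show False using that by simp
    qed
    then have "invertible ?M"
      unfolding invertible_left_inverse matrix_left_invertible_ker by blast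
    then show ?thesis by (simp add: f_def invertible_det_nz)
  qed
  assume "\<not> 0 < det M"
  then have "f 1 \<le> 0" "0 \<le> f 0" by (simp_all add: f_def)
  moreover have "continuous_on {0..1} f"
    unfolding f_def det_def by (intro continuous_intros)
  ultimately obtain t where "0 \<le> t" "t \<le> 1" "f t = 0"
    using IVT2'[of f 1 0 0] by auto
  then show False using nz by auto
qed

lemma riemannian_metric_facts:
  assumes "riemannian_metric A h" "c \<in> A"
  shows "smooth_on (cimg c) (h c)"
    and "\<And>p. p \<in> cimg c \<Longrightarrow> transpose (h c p) = h c p"
    and "\<And>p. p \<in> cimg c \<Longrightarrow> 0 < det (h c p)"
proof -
  have sym: "\<forall>c\<in>A. smooth_on (cimg c) (h c) \<and> (\<forall>p\<in>cimg c. transpose (h c p) = h c p)"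
    and pos: "\<forall>c\<in>A. \<forall>p\<in>cimg c. \<forall>w. w \<noteq> 0 \<longrightarrow> w \<bullet> (h c p *v w) > 0"
    using assms(1) unfolding riemannian_metric_def sym_tensor_field_def by blast+
  show "smooth_on (cimg c) (h c)" using sym assms(2) by blast
  show "transpose (h c p) = h c p" if "p \<in> cimg c" for p using sym assms(2) that by blast
  show "0 < det (h c p)" if "p \<in> cimg c" for p
    using pos assms(2) that by (intro pos_def_det_pos) blast
qed

lemma chart_facts:
  assumes "smooth_manifold X A" "c \<in> A"
  shows chart_open_img: "open (cimg c)"
    and "openin X (cdom c)"
    and chart_cinv_in: "\<And>y. y \<in> cimg c \<Longrightarrow> cinv c y \<in> cdom c"
    and chart_right_inv: "\<And>y. y \<in> cimg c \<Longrightarrow> snd c (cinv c y) = y"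
    and chart_left_inv: "\<And>z. z \<in> cdom c \<Longrightarrow> cinv c (snd c z) = z"
    and chart_in: "\<And>z. z \<in> cdom c \<Longrightarrow> snd c z \<in> cimg c"
    and chart_dom_sub: "cdom c \<subseteq> topspace X"
    and chart_continuous_cinv: "continuous_map (top_of_set (cimg c)) X (cinv c)"
    and "continuous_map (subtopology X (cdom c)) euclidean (snd c)"
    and chart_open_image: "\<And>U. openin X U \<Longrightarrow> open (snd c ` (cdom c \<inter> U))"
proof -
  have o: "openin X (cdom c)" and oi: "open (cimg c)"
    and hom: "homeomorphic_map (subtopology X (cdom c)) (top_of_set (cimg c)) (snd c)"
    using assms unfolding smooth_manifold_def by blast+
  show "openin X (cdom c)" "open (cimg c)" by fact+
  show sub: "cdom c \<subseteq> topspace X" using o by (rule openin_subset)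
  have ts: "topspace (subtopology X (cdom c)) = cdom c" using sub by auto
  have inj: "inj_on (snd c) (cdom c)"
    using homeomorphic_imp_injective_map[OF hom] ts by simp
  show ri: "snd c (cinv c y) = y" if "y \<in> cimg c" for y
    using that by (auto simp: cimg_def cinv_def f_inv_into_f)
  show ci: "cinv c y \<in> cdom c" if "y \<in> cimg c" for y
    using that by (auto simp: cimg_def cinv_def cdom_def inv_into_into)
  show li: "cinv c (snd c z) = z" if "z \<in> cdom c" for z
    using that inj by (auto simp: cinv_def cdom_def)
  show "snd c z \<in> cimg c" if "z \<in> cdom c" for z
    using that by (auto simp: cimg_def cdom_def)
  obtain g where g: "homeomorphic_maps (subtopology X (cdom c)) (top_of_set (cimg c)) (snd c) g"
    using hom unfolding homeomorphic_map_maps by blast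
  then have gc: "continuous_map (top_of_set (cimg c)) (subtopology X (cdom c)) g"
    and sc: "continuous_map (subtopology X (cdom c)) (top_of_set (cimg c)) (snd c)"
    and gi: "\<And>y. y \<in> cimg c \<Longrightarrow> snd c (g y) = y"
    unfolding homeomorphic_maps_def by (simp_all add: homeomorphic_maps_def)
  have "g y = cinv c y" if "y \<in> cimg c" for y
  proof -
    have "g y \<in> cdom c" using gc that ts by (auto simp: continuous_map_def)
    then show ?thesis using li[of "g y"] gi[OF that] by simp
  qed
  then show "continuous_map (top_of_set (cimg c)) X (cinv c)"
    by (intro continuous_map_eq[OF continuous_map_into_fulltopology[OF gc]]) simp
  show "continuous_map (subtopology X (cdom c)) euclidean (snd c)"
    by (rule continuous_map_into_fulltopology[OF sc])
  show "open (snd c ` (cdom c \<inter> U))" if "openin X U" for U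
  proof -
    have "openin (subtopology X (cdom c)) (cdom c \<inter> U)"
      unfolding openin_subtopology using that by blast
    then have "openin (top_of_set (cimg c)) (snd c ` (cdom c \<inter> U))"
      using homeomorphic_imp_open_map[OF hom] by (simp add: open_map_def)
    then show ?thesis unfolding openin_open_eq[OF oi] by blast
  qed
qed

text \<open>Over a chart domain, the volume measure is the image under the inverse chart of Lebesgue
  measure with density \<open>sqrt (det h)\<close>: both agree on all Borel subsets of the domain.\<close>
lemma volume_measure_chart:
  assumes M: "smooth_manifold X A" "c \<in> A" and vol: "volume_measure X A h \<mu>"
    and h: "riemannian_metric A h"
  shows "restrict_space \<mu> (cdom c) =
    distr (density (restrict_space lborel (cimg c)) (\<lambda>y. ennreal (sqrt (det (h c y)))))
      (restrict_space \<mu> (cdom c)) (cinv c)" (is "?M = distr ?N ?M _")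
    and "cinv c \<in> measurable (restrict_space lborel (cimg c)) (restrict_space \<mu> (cdom c))"
    and "snd c \<in> measurable (restrict_space \<mu> (cdom c)) (restrict_space borel (cimg c))"
    and "(\<lambda>y. sqrt (det (h c y))) \<in> borel_measurable (restrict_space lborel (cimg c))"
    and "cdom c \<in> sets \<mu>"
proof -
  note ch = chart_facts[OF M]
  have sp: "space \<mu> = topspace X" and se: "sets \<mu> = sigma_sets (topspace X) {U. openin X U}"
    and em: "\<And>B. B \<in> sets \<mu> \<Longrightarrow> B \<subseteq> cdom c \<Longrightarrow> emeasure \<mu> B =
      (\<integral>\<^sup>+p. ennreal (sqrt (det (h c p))) * indicator (snd c ` B) p \<partial>lborel)"
    using vol M(2) by (auto simp: volume_measure_def)
  have osets: "U \<in> sets \<mu>" if "openin X U" for U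
    unfolding se using that by (intro sigma_sets.Basic) simp
  show ds: "cdom c \<in> sets \<mu>" using osets ch(2) .
  have di: "cdom c \<inter> space \<mu> \<in> sets \<mu>" using ds ch(7) sp by (simp add: Int_absorb2)
  have Sb: "cimg c \<in> sets borel" using ch(1) by simp
  have spN: "space (restrict_space lborel (cimg c)) = cimg c" by (simp add: space_restrict_space)
  have spM: "space ?M = cdom c" using ch(7) by (auto simp: space_restrict_space sp)
  have cm: "cinv c \<in> measurable (restrict_space lborel (cimg c)) \<mu>"
  proof (rule measurable_sigma_sets[OF se])
    show "{U. openin X U} \<subseteq> Pow (topspace X)" using openin_subset by blast
    show "cinv c \<in> space (restrict_space lborel (cimg c)) \<rightarrow> topspace X"
      unfolding spN using ch(3,7) by auto
    fix U assume "U \<in> {U. openin X U}"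
    then have "openin (top_of_set (cimg c)) {y \<in> cimg c. cinv c y \<in> U}"
      using openin_continuous_map_preimage[OF ch(8), of U] by simp
    then have "open (cinv c -` U \<inter> cimg c)"
      unfolding openin_open_eq[OF ch(1)] by (simp add: vimage_def Int_def conj_commute)
    then show "cinv c -` U \<inter> space (restrict_space lborel (cimg c)) \<in> sets (restrict_space lborel (cimg c))"
      unfolding spN by (subst sets_restrict_space_iff) (use Sb in auto)
  qed
  show cm': "cinv c \<in> measurable (restrict_space lborel (cimg c)) ?M"
    by (rule measurable_restrict_space2[OF _ cm]) (use ch(3) spN in auto)
  have sm: "snd c \<in> measurable ?M borel"
  proof (rule borel_measurableI)
    fix U :: "(real^'b) set" assume "open U"
    then have "openin (subtopology X (cdom c)) {z \<in> cdom c. snd c z \<in> U}"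
      using openin_continuous_map_preimage[OF ch(9), of U] ch(7) by (simp add: Int_absorb1)
    then have "openin X (snd c -` U \<inter> cdom c)"
      using openin_trans_full[OF _ ch(2)] by (simp add: vimage_def Int_def conj_commute)
    then show "snd c -` U \<inter> space ?M \<in> sets ?M"
      unfolding spM sets_restrict_space_iff[OF di] using osets by simp
  qed
  show "snd c \<in> measurable ?M (restrict_space borel (cimg c))"
    by (rule measurable_restrict_space2[OF _ sm]) (use ch(6) spM in auto)
  have "smooth_on (cimg c) (\<lambda>y. sqrt (det (h c y)))"
    by (intro smooth_on_sqrt smooth_on_det smooth_on_vec_nth ch(1) riemannian_metric_facts[OF h M(2)])
  then have "continuous_on (cimg c) (\<lambda>y. sqrt (det (h c y)))" by (rule smooth_on_continuous)
  then show dm: "(\<lambda>y. sqrt (det (h c y))) \<in> borel_measurable (restrict_space lborel (cimg c))"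
    using borel_measurable_continuous_on_restrict
    by (simp add: measurable_cong_sets[OF sets_restrict_space_cong[OF sets_lborel] refl])
  show "?M = distr ?N ?M (cinv c)"
  proof (rule measure_eqI)
    fix B assume B: "B \<in> sets ?M"
    then have B': "B \<in> sets \<mu>" "B \<subseteq> cdom c"
      unfolding sets_restrict_space_iff[OF di] by auto
    have img: "snd c ` B = cinv c -` B \<inter> cimg c"
    proof (intro equalityI subsetI)
      fix y assume "y \<in> snd c ` B" then show "y \<in> cinv c -` B \<inter> cimg c" using B' ch(5,6) by auto
    next
      fix y assume "y \<in> cinv c -` B \<inter> cimg c" then have "cinv c y \<in> B" "snd c (cinv c y) = y" using ch(4) by auto
      then show "y \<in> snd c ` B" by force
    qed
    have pre: "cinv c -` B \<inter> cimg c \<in> sets (restrict_space lborel (cimg c))"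
      using measurable_sets[OF cm' B] spN by simp
    have "emeasure (distr ?N ?M (cinv c)) B = emeasure ?N (cinv c -` B \<inter> cimg c)"
      using cm' B by (subst emeasure_distr) (auto simp: spN measurable_density_eq2)
    also have "\<dots> = (\<integral>\<^sup>+y. ennreal (sqrt (det (h c y))) * indicator (cinv c -` B \<inter> cimg c) y \<partial>restrict_space lborel (cimg c))"
      using dm pre by (intro emeasure_density) auto
    also have "\<dots> = (\<integral>\<^sup>+y. ennreal (sqrt (det (h c y))) * indicator (cinv c -` B \<inter> cimg c) y * indicator (cimg c) y \<partial>lborel)"
      using Sb by (intro nn_integral_restrict_space) simp
    also have "\<dots> = (\<integral>\<^sup>+y. ennreal (sqrt (det (h c y))) * indicator (snd c ` B) y \<partial>lborel)"
      unfolding img by (intro nn_integral_cong) (auto simp: indicator_def)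
    also have "\<dots> = emeasure \<mu> B" using em[OF B'] by simp
    also have "\<dots> = emeasure ?M B"
      by (rule emeasure_restrict_space[OF di B'(2), symmetric])
    finally show "emeasure ?M B = emeasure (distr ?N ?M (cinv c)) B" ..
  qed simp
qed

text \<open>All integrals over the manifold below have integrands supported in a coordinate box, so that
  they can be computed in one chart and no partition of unity is needed.\<close>
lemma integral_in_chart:
  fixes F :: "'m \<Rightarrow> complex" and c :: "('m, 'n::finite) chart"
  assumes M: "smooth_manifold X A" "c \<in> A" and vol: "volume_measure X A h \<mu>"
    and h: "riemannian_metric A h"
    and F: "continuous_on (cimg c) (F \<circ> cinv c)" and K: "cbox a b \<subseteq> cimg c"
    and supp: "\<And>z. z \<in> topspace X \<Longrightarrow> z \<notin> cinv c ` cbox a b \<Longrightarrow> F z = 0"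
  shows "(LINT z|\<mu>. F z) = integral (cbox a b) (\<lambda>y. sqrt (det (h c y)) *\<^sub>R F (cinv c y))"
proof -
  note ch = chart_facts[OF M] and vc = volume_measure_chart[OF M vol h]
  let ?S = "cimg c" and ?M = "restrict_space \<mu> (cdom c)"
  let ?R = "restrict_space lborel ?S" and ?w = "\<lambda>y. sqrt (det (h c y))"
  have sp: "space \<mu> = topspace X" using vol by (simp add: volume_measure_def)
  have Sb: "?S \<in> sets borel" using ch(1) by simp
  have Fm': "(F \<circ> cinv c) \<in> borel_measurable (restrict_space borel ?S)"
    by (rule borel_measurable_continuous_on_restrict[OF F])
  then have "(\<lambda>z. (F \<circ> cinv c) (snd c z)) \<in> borel_measurable ?M"
    by (rule measurable_compose[OF vc(3)])
  then have Fm: "F \<in> borel_measurable ?M"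
    by (rule measurable_cong[THEN iffD1, rotated]) (use ch(5) sp in \<open>auto simp: space_restrict_space\<close>)
  have cm: "cinv c \<in> measurable (density ?R (\<lambda>y. ennreal (?w y))) ?M"
    using vc(2) by (simp add: measurable_density_eq2)
  have Fc: "(\<lambda>y. F (cinv c y)) \<in> borel_measurable ?R"
    using measurable_compose[OF vc(2) Fm] .
  have "(LINT z|\<mu>. F z) = (LINT z|\<mu>. indicator (cdom c) z *\<^sub>R F z)"
  proof (rule Bochner_Integration.integral_cong[OF refl])
    fix z assume z: "z \<in> space \<mu>"
    have "cinv c ` cbox a b \<subseteq> cdom c" using K ch(3) by auto
    then show "F z = indicator (cdom c) z *\<^sub>R F z"
      using supp[of z] z sp by (auto simp: indicator_def)
  qed
  also have "\<dots> = (LINT z|?M. F z)"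
    using vc(5) by (subst integral_restrict_space) auto
  also have "\<dots> = (LINT z|distr (density ?R (\<lambda>y. ennreal (?w y))) ?M (cinv c). F z)"
    using vc(1) by simp
  also have "\<dots> = (LINT y|density ?R (\<lambda>y. ennreal (?w y)). F (cinv c y))"
    using cm Fm by (rule integral_distr)
  also have "\<dots> = (LINT y|?R. ?w y *\<^sub>R F (cinv c y))"
    using Fc vc(4) riemannian_metric_facts(3)[OF h M(2)]
    by (intro integral_density) (auto intro!: AE_I2 simp: space_restrict_space less_imp_le)
  also have "\<dots> = (LINT y|lborel. indicator ?S y *\<^sub>R (?w y *\<^sub>R F (cinv c y)))"
    using Sb by (intro integral_restrict_space) simp
  also have "\<dots> = (LINT y:cbox a b|lborel. ?w y *\<^sub>R F (cinv c y))"
    unfolding set_lebesgue_integral_def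
  proof (rule Bochner_Integration.integral_cong[OF refl])
    fix y
    have "F (cinv c y) = 0" if "y \<in> ?S" "y \<notin> cbox a b"
    proof (rule supp)
      show "cinv c y \<in> topspace X" using ch(3,7) that by auto
      show "cinv c y \<notin> cinv c ` cbox a b"
      proof
        assume "cinv c y \<in> cinv c ` cbox a b"
        then obtain y' where y': "y' \<in> cbox a b" "cinv c y = cinv c y'" by blast
        then have "snd c (cinv c y) = snd c (cinv c y')" by simp
        then have "y = y'" using ch(4)[OF that(1)] ch(4)[of y'] y'(1) K by auto
        then show False using that(2) y'(1) by simp
      qed
    qed
    then show "indicator ?S y *\<^sub>R (?w y *\<^sub>R F (cinv c y)) = indicator (cbox a b) y *\<^sub>R (?w y *\<^sub>R F (cinv c y))"
      using K by (auto simp: indicator_def)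
  qed
  also have "\<dots> = integral (cbox a b) (\<lambda>y. ?w y *\<^sub>R F (cinv c y))"
  proof (rule set_borel_integral_eq_integral(2))
    have "smooth_on ?S ?w"
      by (intro smooth_on_sqrt smooth_on_det smooth_on_vec_nth ch(1) riemannian_metric_facts[OF h M(2)])
    then have "continuous_on ?S (\<lambda>y. ?w y *\<^sub>R (F \<circ> cinv c) y)"
      by (intro continuous_on_scaleR smooth_on_continuous F)
    then have "continuous_on (cbox a b) (\<lambda>y. ?w y *\<^sub>R F (cinv c y))"
      using K by (auto intro: continuous_on_subset)
    then show "set_integrable lborel (cbox a b) (\<lambda>y. ?w y *\<^sub>R F (cinv c y))"
      unfolding set_integrable_def by (intro borel_integrable_compact) auto
  qed
  finally show ?thesis .
qed

section \<open>Bump functions on the manifold\<close>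

definition chart_bump :: "('m, 'n::finite) chart \<Rightarrow> real^'n \<Rightarrow> real \<Rightarrow> 'm \<Rightarrow> complex" where
  "chart_bump c y0 d z = (if z \<in> cdom c then of_real (bump y0 d (snd c z)) else 0)"

lemma chart_box_compactin:
  assumes M: "smooth_manifold X A" "c \<in> A" and K: "cbox a b \<subseteq> cimg c"
  shows "compactin X (cinv c ` cbox a b)" "closedin X (cinv c ` cbox a b)"
proof -
  show "compactin X (cinv c ` cbox a b)"
    by (rule image_compactin[OF _ chart_continuous_cinv[OF M]])
       (use K in \<open>auto simp: compactin_subtopology\<close>)
  moreover have "Hausdorff_space X" using M by (simp add: smooth_manifold_def)
  ultimately show "closedin X (cinv c ` cbox a b)" by (rule compactin_imp_closedin[rotated])
qed

lemma chart_bump_outside: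
  assumes M: "smooth_manifold X A" "c \<in> A" and d: "0 < d" "cball y0 d \<subseteq> cbox a b"
    and z: "z \<notin> cinv c ` cbox a b"
  shows "chart_bump c y0 d z = 0"
proof (cases "z \<in> cdom c")
  case True
  have "snd c z \<notin> cbox a b"
  proof
    assume "snd c z \<in> cbox a b"
    then have "cinv c (snd c z) \<in> cinv c ` cbox a b" by (rule imageI)
    then show False using z chart_left_inv[OF M True] by simp
  qed
  then have "snd c z \<notin> cball y0 d" using d(2) by blast
  then show ?thesis by (simp add: chart_bump_def bump_outside[OF d(1)] del: mem_cball)
qed (simp add: chart_bump_def)

lemma smooth_fun_chart_bump:
  assumes M: "smooth_manifold X A" "c \<in> A" and d: "0 < d" "cball y0 d \<subseteq> cbox a b"
    and K: "cbox a b \<subseteq> cimg c"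
  shows "smooth_fun A (chart_bump c y0 d)"
  unfolding smooth_fun_def
proof
  fix e assume e: "e \<in> A"
  note ce = chart_facts[OF M(1) e] and cc = chart_facts[OF M]
  show "smooth_on (cimg e) (chart_bump c y0 d \<circ> cinv e)"
  proof (rule smooth_on_local)
    fix p assume p: "p \<in> cimg e"
    show "\<exists>U. open U \<and> p \<in> U \<and> smooth_on U (chart_bump c y0 d \<circ> cinv e)"
    proof (cases "cinv e p \<in> cdom c")
      case True
      let ?U = "snd e ` (cdom e \<inter> cdom c)"
      have U: "open ?U" by (rule ce(10)[OF cc(2)])
      have "p \<in> ?U" using True ce(3,4)[OF p] by (intro image_eqI[of _ _ "cinv e p"]) auto
      moreover have "smooth_on ?U (chart_bump c y0 d \<circ> cinv e)"
      proof (rule smooth_on_cong[OF U])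
        have tr: "smooth_on ?U (transition e c)" using M e by (auto simp: smooth_manifold_def)
        show "smooth_on ?U (\<lambda>y. complex_of_real (bump y0 d (transition e c y)))"
          by (intro smooth_on_bounded_linear[OF bounded_linear_of_real U]
              smooth_on_compose[OF U _ smooth_on_bump tr]) auto
        show "complex_of_real (bump y0 d (transition e c y)) = (chart_bump c y0 d \<circ> cinv e) y" if "y \<in> ?U" for y
          using that ce(5) by (auto simp: chart_bump_def transition_def)
      qed
      ultimately show ?thesis using U by blast
    next
      case False
      let ?V = "topspace X - cinv c ` cbox a b"
      let ?U = "snd e ` (cdom e \<inter> ?V)"
      have "openin X ?V" using chart_box_compactin(2)[OF M K] by blast
      then have U: "open ?U" by (rule ce(10))
      have "cinv e p \<in> ?V" using False ce(3,7) p K cc(3) by auto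
      then have "p \<in> ?U" using ce(3,4)[OF p] by (intro image_eqI[of _ _ "cinv e p"]) auto
      moreover have "smooth_on ?U (chart_bump c y0 d \<circ> cinv e)"
      proof (rule smooth_on_cong[OF U _ smooth_on_const[of _ 0]])
        show "0 = (chart_bump c y0 d \<circ> cinv e) y" if "y \<in> ?U" for y
          using that ce(5) chart_bump_outside[OF M d] by auto
      qed
      ultimately show ?thesis using U by blast
    qed
  qed
qed

lemma compact_support_chart_bump:
  assumes M: "smooth_manifold X A" "c \<in> A" and d: "0 < d" "cball y0 d \<subseteq> cbox a b"
    and K: "cbox a b \<subseteq> cimg c"
  shows "compact_support X (chart_bump c y0 d)"
  unfolding compact_support_def
  using chart_box_compactin(1)[OF M K] chart_bump_outside[OF M d] by blast

section \<open>Complex powers of \<open>r\<close> and the ansatz\<close>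

abbreviation cpow :: "real \<Rightarrow> complex \<Rightarrow> complex" where
  "cpow r z \<equiv> complex_of_real r powr z"

lemma of_real_powr_mult_eq_power:
  assumes "0 < r" "x + y = of_nat k"
  shows "cpow r x * cpow r y = complex_of_real r ^ k"
  using assms powr_add[of "complex_of_real r" x y] by (simp add: powr_nat')

lemma norm_of_real_powr:
  assumes "0 < r"
  shows "norm (cpow r z) = r powr Re z"
  using assms by (simp add: norm_powr_real_powr)

lemma integral_lincomb:
  fixes g :: "'j \<Rightarrow> 'a::euclidean_space \<Rightarrow> complex"
  assumes "\<And>j. j \<in> J \<Longrightarrow> continuous_on (cbox a b) (g j)" "finite J"
  shows "integral (cbox a b) (\<lambda>x. \<Sum>j\<in>J. \<kappa> j * g j x) = (\<Sum>j\<in>J. \<kappa> j * integral (cbox a b) (g j))"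
proof -
  have "integral (cbox a b) (\<lambda>x. \<Sum>j\<in>J. \<kappa> j * g j x) = (\<Sum>j\<in>J. integral (cbox a b) (\<lambda>x. \<kappa> j * g j x))"
    by (rule Henstock_Kurzweil_Integration.integral_sum[OF assms(2)])
       (intro integrable_continuous continuous_on_mult continuous_on_const assms(1))
  then show ?thesis by simp
qed

lemma smooth_on_fix_r:
  assumes "smooth_on (cylinder S \<epsilon>) G" "0 < r" "r < \<epsilon>"
  shows "continuous_on S (\<lambda>x. G (mk_pt x r))"
  by (rule continuous_on_compose2[OF smooth_on_continuous[OF assms(1)]])
     (use assms(2,3) in \<open>auto intro!: continuous_intros simp: mk_pt_in_cylinder\<close>)

lemma smooth_on_eigen_ansatz:
  fixes t :: "nat \<Rightarrow> 'm \<Rightarrow> complex" and c :: "('m, 'n::finite) chart"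
  assumes S: "open S" and t: "\<And>j. j \<le> CARD('n) div 2 \<Longrightarrow> smooth_on S (t j \<circ> cinv c)"
  shows "smooth_on (cylinder S \<epsilon>) (eigen_ansatz c lam t)"
proof -
  have O: "open (cylinder S \<epsilon>)" by (rule open_cylinder[OF S])
  have 1: "smooth_on (cylinder S \<epsilon>) (\<lambda>p. complex_of_real (p $ None) powr z)" for z
    by (rule smooth_on_compose[OF O _ smooth_on_of_real_powr smooth_on_linear[OF bounded_linear_vec_nth O]])
       (auto simp: cylinder_def)
  have 2: "smooth_on (cylinder S \<epsilon>) (\<lambda>p. (t j \<circ> cinv c) (base_pt p))" if "j \<le> CARD('n) div 2" for j
    by (rule smooth_on_compose[OF O _ t[OF that] smooth_on_linear[OF bounded_linear_base_pt O]])
       (auto simp: cylinder_def)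
  have "smooth_on (cylinder S \<epsilon>) (\<lambda>p. \<Sum>j\<le>CARD('n) div 2.
      complex_of_real (p $ None) powr (lam + 2 * of_nat j) * (t j \<circ> cinv c) (base_pt p))"
    by (intro smooth_on_sum[OF O] smooth_on_mult[OF O] 1 2) auto
  then show ?thesis by (simp add: eigen_ansatz_def[abs_def])
qed

lemma pderivative_eigen_ansatz:
  fixes t :: "nat \<Rightarrow> 'm \<Rightarrow> complex" and c :: "('m, 'n::finite) chart"
  assumes S: "open S" and t: "\<And>j. j \<le> CARD('n) div 2 \<Longrightarrow> smooth_on S (t j \<circ> cinv c)"
    and x: "x \<in> S" and r: "0 < r"
  shows "pderivative None (eigen_ansatz c lam t) (mk_pt x r) = (\<Sum>j\<le>CARD('n) div 2.
      (lam + 2 * of_nat j) * cpow r (lam + 2 * of_nat j - 1) * (t j \<circ> cinv c) x)" (is ?N)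
    and "pderivative (Some i) (eigen_ansatz c lam t) (mk_pt x r) = (\<Sum>j\<le>CARD('n) div 2.
      cpow r (lam + 2 * of_nat j) * pderivative i (t j \<circ> cinv c) x)" (is ?S)
proof -
  let ?u = "eigen_ansatz c lam t"
  have "mk_pt x r \<in> cylinder S (r + 1)" using x r by (simp add: mk_pt_in_cylinder)
  moreover have "smooth_on (cylinder S (r + 1)) ?u"
    by (rule smooth_on_eigen_ansatz[OF S]) (rule t)
  ultimately have d: "?u differentiable (at (mk_pt x r))"
    by (intro smooth_on_differentiable)
  have u: "?u (mk_pt y s) = (\<Sum>j\<le>CARD('n) div 2.
      complex_of_real s powr (lam + 2 * of_nat j) * (t j \<circ> cinv c) y)" for y s
    by (simp add: eigen_ansatz_def)
  have "((\<lambda>s. ?u (mk_pt x s)) has_vector_derivative (\<Sum>j\<le>CARD('n) div 2.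
      (lam + 2 * of_nat j) * cpow r (lam + 2 * of_nat j - 1) * (t j \<circ> cinv c) x)) (at r)"
    unfolding u
    by (intro has_vector_derivative_sum has_vector_derivative_mult_left has_vector_derivative_of_real_powr r)
  from vector_derivative_unique_at[OF has_vector_derivative_mk_pt[OF d] this] show ?N .
  have "((\<lambda>y. ?u (mk_pt y r)) has_derivative (\<lambda>v. \<Sum>j\<le>CARD('n) div 2.
      cpow r (lam + 2 * of_nat j) * frechet_derivative (t j \<circ> cinv c) (at x) v)) (at x)"
    unfolding u
    by (intro has_derivative_sum has_derivative_mult_right smooth_on_has_derivative[OF t x]) auto
  from pderivative_eq[OF this, of i] show ?S
    unfolding pderivative_mk_pt(2)[OF d] by (simp add: pderivative_def)
qed



section \<open>Expansions at the boundary\<close>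

lemma poincare_einstein_chart:
  fixes hr :: "real \<Rightarrow> ('m, 'n::finite) tensor2" and c :: "('m, 'n) chart"
  assumes pe: "poincare_einstein A h \<epsilon> hr" and c: "c \<in> A" and S: "S \<subseteq> cimg c"
  shows "0 < \<epsilon>"
    and "smooth_on (cylinder S \<epsilon>) (\<lambda>p. hr (p $ None) c (base_pt p))"
    and "\<And>p. p \<in> cylinder S \<epsilon> \<Longrightarrow> transpose (hr (p $ None) c (base_pt p)) = hr (p $ None) c (base_pt p)"
    and "\<And>p. p \<in> cylinder S \<epsilon> \<Longrightarrow> 0 < det (hr (p $ None) c (base_pt p))"
proof -
  have e: "0 < \<epsilon>" and m: "\<And>r. 0 < r \<Longrightarrow> r < \<epsilon> \<Longrightarrow> riemannian_metric A (hr r)"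
    and s: "smooth_on (cylinder (cimg c) \<epsilon>) (\<lambda>p. hr (p $ None) c (base_pt p))"
    using pe c unfolding poincare_einstein_def by blast+
  show "0 < \<epsilon>" by (rule e)
  show "smooth_on (cylinder S \<epsilon>) (\<lambda>p. hr (p $ None) c (base_pt p))"
    by (rule smooth_on_subset[OF s]) (use S in \<open>auto simp: cylinder_def\<close>)
  show "transpose (hr (p $ None) c (base_pt p)) = hr (p $ None) c (base_pt p)"
    and "0 < det (hr (p $ None) c (base_pt p))" if p: "p \<in> cylinder S \<epsilon>" for p
  proof -
    have "riemannian_metric A (hr (p $ None))" using p by (intro m) (simp_all add: cylinder_def)
    note f = riemannian_metric_facts[OF this c]
    have "base_pt p \<in> cimg c" using p S by (auto simp: cylinder_def)
    then show "transpose (hr (p $ None) c (base_pt p)) = hr (p $ None) c (base_pt p)"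
      and "0 < det (hr (p $ None) c (base_pt p))" using f by blast+
  qed
qed

lemma continuous_on_compact_bound:
  fixes f :: "'a::euclidean_space \<Rightarrow> 'b::real_normed_vector"
  assumes "continuous_on (cbox a b) f"
  obtains C where "0 < C" "\<And>x. x \<in> cbox a b \<Longrightarrow> norm (f x) \<le> C"
proof -
  have "bounded (f ` cbox a b)"
    by (intro compact_imp_bounded compact_continuous_image assms compact_cbox)
  then show thesis using that unfolding bounded_pos by auto
qed

lemma O_bdry_boxE:
  assumes "O_bdry S F s" "cbox a b \<subseteq> S"
  obtains C \<delta> where "0 < \<delta>"
    "\<And>x r. x \<in> cbox a b \<Longrightarrow> 0 < r \<Longrightarrow> r < \<delta> \<Longrightarrow> norm (F (mk_pt x r)) \<le> C * r powr s"
proof -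
  have "compact (cbox a b) \<and> cbox a b \<subseteq> S" using assms(2) by simp
  with assms(1) have "\<exists>C \<delta>. 0 < \<delta> \<and> (\<forall>x\<in>cbox a b. \<forall>r. 0 < r \<and> r < \<delta> \<longrightarrow> norm (F (mk_pt x r)) \<le> C * r powr s)"
    unfolding O_bdry_def by (elim allE impE)
  then show thesis by (elim exE conjE) (rule that; blast)
qed

text \<open>Every term of the expansion is bounded on a compact set; for the logarithmic one, note that
  \<open>\<bar>r log r\<bar> \<le> 1\<close> for \<open>0 < r < 1\<close>.\<close>
lemma metric_family_bounded:
  fixes hr :: "real \<Rightarrow> ('m, 'n::finite) tensor2" and c :: "('m, 'n) chart"
  assumes ex: "metric_expansion A h hr" and c: "c \<in> A" and K: "cbox a b \<subseteq> cimg c"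
  obtains C \<delta> where "0 < \<delta>" "\<And>x r. x \<in> cbox a b \<Longrightarrow> 0 < r \<Longrightarrow> r < \<delta> \<Longrightarrow> norm (hr r c x) \<le> C"
proof -
  let ?n = "CARD('n)"
  obtain hk hbar where hk: "\<And>j. sym_tensor_field A (hk j)" and hbar: "sym_tensor_field A hbar"
    and O: "\<And>ks. O_bdry (cimg c) (bderiv ks (\<lambda>p. hr (p $ None) c (base_pt p)
              - (\<Sum>j\<le>?n div 2. (p $ None) ^ (2*j) *\<^sub>R hk j c (base_pt p))
              - ((p $ None) ^ ?n * ln (p $ None)) *\<^sub>R hbar c (base_pt p))) (real ?n + 1)"
    using ex c unfolding metric_expansion_def by blast
  obtain C0 \<delta> where d: "0 < \<delta>" and C0: "\<And>x r. x \<in> cbox a b \<Longrightarrow> 0 < r \<Longrightarrow> r < \<delta> \<Longrightarrow>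
      norm (hr r c x - (\<Sum>j\<le>?n div 2. r ^ (2*j) *\<^sub>R hk j c x) - (r ^ ?n * ln r) *\<^sub>R hbar c x)
        \<le> C0 * r powr (real ?n + 1)"
    by (rule O_bdry_boxE[OF O[of "[]", unfolded bderiv.simps] K, unfolded mk_pt_None base_pt_mk_pt]) (rule that; blast)
  have ck: "continuous_on (cbox a b) (hk j c)" for j
    using hk[of j] c unfolding sym_tensor_field_def
    by (intro continuous_on_subset[OF smooth_on_continuous K]) blast
  have cbar: "continuous_on (cbox a b) (hbar c)"
    using hbar c unfolding sym_tensor_field_def
    by (intro continuous_on_subset[OF smooth_on_continuous K]) blast
  have "\<exists>B. 0 < B \<and> (\<forall>x\<in>cbox a b. norm (hk j c x) \<le> B)" for j
    by (rule continuous_on_compact_bound[OF ck[of j]]) blast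
  then have "\<exists>B. \<forall>j. 0 < B j \<and> (\<forall>x\<in>cbox a b. norm (hk j c x) \<le> B j)"
    by (intro choice allI)
  then obtain B where B: "\<And>j. 0 < B j" "\<And>j x. x \<in> cbox a b \<Longrightarrow> norm (hk j c x) \<le> B j"
    by blast
  obtain Bb where Bb: "0 < Bb" "\<And>x. x \<in> cbox a b \<Longrightarrow> norm (hbar c x) \<le> Bb"
    using cbar by (rule continuous_on_compact_bound) (rule that; blast)
  show thesis
  proof (rule that[of "min \<delta> 1" "\<bar>C0\<bar> + (\<Sum>j\<le>?n div 2. B j) + Bb"])
    show "0 < min \<delta> 1" using d by simp
    fix x r assume x: "x \<in> cbox a b" and r: "0 < (r::real)" "r < min \<delta> 1"
    have p1: "r powr (real ?n + 1) \<le> 1" using r by (intro powr_le1) auto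
    have p2: "\<bar>r ^ ?n * ln r\<bar> \<le> 1"
    proof -
      have "r ^ ?n \<le> r ^ 1" using r by (intro power_decreasing) (auto simp: Suc_le_eq)
      moreover have "\<bar>ln r\<bar> \<le> 1 / r"
        using ln_le_minus_one[of "1 / r"] r by (simp add: ln_div)
      ultimately have "r ^ ?n * \<bar>ln r\<bar> \<le> r * (1 / r)" using r by (intro mult_mono) auto
      then show ?thesis using r by (simp add: abs_mult)
    qed
    let ?S = "\<Sum>j\<le>?n div 2. r ^ (2*j) *\<^sub>R hk j c x" and ?L = "(r ^ ?n * ln r) *\<^sub>R hbar c x"
    have "norm (hr r c x - ?S - ?L) \<le> \<bar>C0\<bar>"
    proof -
      have "norm (hr r c x - ?S - ?L) \<le> C0 * r powr (real ?n + 1)" using C0[OF x r(1)] r by simp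
      also have "\<dots> \<le> \<bar>C0\<bar> * 1" using p1 by (intro mult_mono) auto
      finally show ?thesis by simp
    qed
    moreover have "norm ?S \<le> (\<Sum>j\<le>?n div 2. B j)"
    proof (rule sum_norm_le)
      fix j
      have "r ^ (2*j) * norm (hk j c x) \<le> 1 * B j"
        using r B(2)[OF x, of j] by (intro mult_mono power_le_one) auto
      then show "norm (r ^ (2*j) *\<^sub>R hk j c x) \<le> B j" using r by simp
    qed
    moreover have "norm ?L \<le> Bb"
    proof -
      have "norm ?L = \<bar>r ^ ?n * ln r\<bar> * norm (hbar c x)" by (rule norm_scaleR)
      also have "\<dots> \<le> 1 * Bb" using p2 Bb(2)[OF x] by (intro mult_mono) auto
      finally show ?thesis by simp
    qed
    moreover have "norm (hr r c x) \<le> norm (hr r c x - ?S - ?L) + norm ?S + norm ?L"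
      using norm_triangle_ineq[of "hr r c x - ?S - ?L" "?S + ?L"] norm_triangle_ineq[of ?S ?L] by simp
    ultimately show "norm (hr r c x) \<le> \<bar>C0\<bar> + (\<Sum>j\<le>?n div 2. B j) + Bb" by linarith
  qed
qed

lemma sqrt_det_continuous:
  assumes "riemannian_metric A h" "c \<in> A" "K \<subseteq> cimg c"
  shows "continuous_on K (\<lambda>x. sqrt (det (h c x)))"
  unfolding det_def
  by (intro continuous_intros continuous_on_component
      continuous_on_subset[OF smooth_on_continuous[OF riemannian_metric_facts(1)[OF assms(1,2)]] assms(3)])

lemma volume_expansion:
  fixes hr :: "real \<Rightarrow> ('m, 'n::finite) tensor2" and c :: "('m, 'n) chart"
  assumes ho: "holographic_coeffs A h hr v" and h: "riemannian_metric A h"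
    and c: "c \<in> A" and K: "cbox a b \<subseteq> cimg c"
  obtains C \<delta> where "0 < C" "0 < \<delta>" "\<And>x r. x \<in> cbox a b \<Longrightarrow> 0 < r \<Longrightarrow> r < \<delta> \<Longrightarrow>
     \<bar>sqrt (det (hr r c x)) - sqrt (det (h c x)) * (\<Sum>k\<le>CARD('n) div 2. v (2*k) (cinv c x) * r ^ (2*k))\<bar>
       \<le> C * r ^ Suc CARD('n)"
proof -
  let ?n = "CARD('n)"
  have O: "O_bdry (cimg c)
        (\<lambda>p. sqrt (det (hr (p $ None) c (base_pt p))) / sqrt (det (h c (base_pt p)))
             - (\<Sum>j\<le>?n div 2. v (2*j) (cinv c (base_pt p)) * (p $ None) ^ (2*j))) (real ?n + 1)"
    using ho c unfolding holographic_coeffs_def by blast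
  obtain C0 \<delta> where d: "0 < \<delta>" and C0: "\<And>x r. x \<in> cbox a b \<Longrightarrow> 0 < r \<Longrightarrow> r < \<delta> \<Longrightarrow>
      norm (sqrt (det (hr r c x)) / sqrt (det (h c x)) - (\<Sum>j\<le>?n div 2. v (2*j) (cinv c x) * r ^ (2*j)))
        \<le> C0 * r powr (real ?n + 1)"
    by (rule O_bdry_boxE[OF O K, unfolded mk_pt_None base_pt_mk_pt]) (rule that; blast)
  have "continuous_on (cbox a b) (\<lambda>x. sqrt (det (h c x)))" by (rule sqrt_det_continuous[OF h c K])
  then obtain B where B: "0 < B" "\<And>x. x \<in> cbox a b \<Longrightarrow> norm (sqrt (det (h c x))) \<le> B"
    by (rule continuous_on_compact_bound) (rule that; blast)
  show thesis
  proof (rule that[of "B * (\<bar>C0\<bar> + 1)" \<delta>])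
    show "0 < B * (\<bar>C0\<bar> + 1)" using B by simp
    show "0 < \<delta>" by (rule d)
    fix x r assume x: "x \<in> cbox a b" and r: "0 < (r::real)" "r < \<delta>"
    let ?s = "\<Sum>k\<le>?n div 2. v (2*k) (cinv c x) * r ^ (2*k)"
    have "0 < det (h c x)" using riemannian_metric_facts(3)[OF h c] x K by blast
    then have e: "sqrt (det (hr r c x)) - sqrt (det (h c x)) * ?s
       = sqrt (det (h c x)) * (sqrt (det (hr r c x)) / sqrt (det (h c x)) - ?s)"
      by (simp add: right_diff_distrib)
    have "r powr (real ?n + 1) = r ^ Suc ?n"
      using powr_realpow[OF r(1), of "Suc ?n"] by (simp add: add.commute)
    then have "\<bar>sqrt (det (hr r c x)) / sqrt (det (h c x)) - ?s\<bar> \<le> C0 * r ^ Suc ?n"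
      using C0[OF x r] by simp
    also have "\<dots> \<le> (\<bar>C0\<bar> + 1) * r ^ Suc ?n" using r by (intro mult_right_mono) auto
    finally have "\<bar>sqrt (det (h c x))\<bar> * \<bar>sqrt (det (hr r c x)) / sqrt (det (h c x)) - ?s\<bar>
        \<le> B * ((\<bar>C0\<bar> + 1) * r ^ Suc ?n)"
      using B(2)[OF x] B(1) by (intro mult_mono) auto
    then show "\<bar>sqrt (det (hr r c x)) - sqrt (det (h c x)) * ?s\<bar> \<le> B * (\<bar>C0\<bar> + 1) * r ^ Suc ?n"
      unfolding e abs_mult by (simp only: mult.assoc)
  qed
qed

lemma holographic_coeff_continuous:
  assumes ho: "holographic_coeffs A h hr v" and c: "c \<in> (A :: ('m, 'n::finite) chart set)"
    and K: "K \<subseteq> cimg c" and k: "k \<le> CARD('n) div 2"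
  shows "continuous_on K (\<lambda>x. v (2*k) (cinv c x))"
proof -
  have "smooth_on (cimg c) (v (2*k) \<circ> cinv c)"
    using ho c k unfolding holographic_coeffs_def smooth_fun_def by blast
  from continuous_on_subset[OF smooth_on_continuous[OF this] K] show ?thesis by (simp add: o_def)
qed

text \<open>The density tends to \<open>sqrt (det h)\<close> uniformly on the box, because \<open>v\<^sub>0 = 1\<close>.\<close>
lemma volume_density_bounds:
  fixes hr :: "real \<Rightarrow> ('m, 'n::finite) tensor2" and c :: "('m, 'n) chart"
  assumes ho: "holographic_coeffs A h hr v" and h: "riemannian_metric A h"
    and c: "c \<in> A" and K: "cbox a b \<subseteq> cimg c"
  obtains lo hi \<delta> where "0 < lo" "0 < \<delta>" "\<And>x r. x \<in> cbox a b \<Longrightarrow> 0 < r \<Longrightarrow> r < \<delta> \<Longrightarrow>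
     lo \<le> sqrt (det (hr r c x)) \<and> sqrt (det (hr r c x)) \<le> hi"
proof -
  let ?n = "CARD('n)" and ?D = "\<lambda>x. sqrt (det (h c x))"
  obtain C \<delta> where C: "0 < C" "0 < \<delta>" "\<And>x r. x \<in> cbox a b \<Longrightarrow> 0 < r \<Longrightarrow> r < \<delta> \<Longrightarrow>
     \<bar>sqrt (det (hr r c x)) - ?D x * (\<Sum>k\<le>?n div 2. v (2*k) (cinv c x) * r ^ (2*k))\<bar> \<le> C * r ^ Suc ?n"
    by (rule volume_expansion[OF ho h c K]) (rule that; blast)
  note cD = sqrt_det_continuous[OF h c K]
  have "\<exists>B. 0 < B \<and> (\<forall>x\<in>cbox a b. norm (?D x * v (2*k) (cinv c x)) \<le> B)" if "k \<le> ?n div 2" for k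
    by (rule continuous_on_compact_bound[OF continuous_on_mult[OF cD holographic_coeff_continuous[OF ho c K that]]]) blast
  then have "\<exists>B. \<forall>k. k \<le> ?n div 2 \<longrightarrow> 0 < B k \<and> (\<forall>x\<in>cbox a b. norm (?D x * v (2*k) (cinv c x)) \<le> B k)"
    by (intro choice allI) blast
  then obtain B where B: "\<And>k. k \<le> ?n div 2 \<Longrightarrow> 0 < B k"
    "\<And>k x. k \<le> ?n div 2 \<Longrightarrow> x \<in> cbox a b \<Longrightarrow> norm (?D x * v (2*k) (cinv c x)) \<le> B k"
    by blast
  define M where "M = (\<Sum>k\<in>{1..?n div 2}. B k) + C"
  have M: "0 < M" unfolding M_def using C(1) B(1) by (intro add_nonneg_pos sum_nonneg) (auto simp: less_imp_le)
  have close: "\<bar>sqrt (det (hr r c x)) - ?D x\<bar> \<le> M * r" if x: "x \<in> cbox a b" and r: "0 < r" "r < min \<delta> 1" for x r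
  proof -
    have "{..?n div 2} = insert 0 {1..?n div 2}" by auto
    then have split: "?D x * (\<Sum>k\<le>?n div 2. v (2*k) (cinv c x) * r ^ (2*k))
       = ?D x * v 0 (cinv c x) + (\<Sum>k\<in>{1..?n div 2}. ?D x * v (2*k) (cinv c x) * r ^ (2*k))"
      by (simp add: distrib_left sum_distrib_left mult.assoc)
    have "cinv c x \<in> cdom c" using x K
      by (auto simp: cimg_def cinv_def cdom_def inv_into_into)
    then have v0: "v 0 (cinv c x) = 1" using ho c unfolding holographic_coeffs_def by blast
    have pw: "r ^ Suc m \<le> r" for m
      using r power_decreasing[of 1 "Suc m" r] by simp
    have "\<bar>\<Sum>k\<in>{1..?n div 2}. ?D x * v (2*k) (cinv c x) * r ^ (2*k)\<bar> \<le> (\<Sum>k\<in>{1..?n div 2}. B k * r)"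
    proof (rule order_trans[OF sum_abs], rule sum_mono)
      fix k assume k: "k \<in> {1..?n div 2}"
      then obtain m where m: "2 * k = Suc m" by (cases "2 * k") auto
      have "\<bar>?D x * v (2*k) (cinv c x)\<bar> * r ^ (2*k) \<le> B k * r"
        using B(2)[of k x] B(1)[of k] k x r pw[of m] unfolding m by (intro mult_mono) auto
      then show "\<bar>?D x * v (2*k) (cinv c x) * r ^ (2*k)\<bar> \<le> B k * r"
        using r by (simp add: abs_mult)
    qed
    moreover have "\<bar>sqrt (det (hr r c x)) - ?D x * (\<Sum>k\<le>?n div 2. v (2*k) (cinv c x) * r ^ (2*k))\<bar> \<le> C * r"
    proof (rule order_trans[OF C(3)[OF x r(1)]])
      show "r < \<delta>" using r by simp
      show "C * r ^ Suc ?n \<le> C * r" using pw[of ?n] C(1) by (intro mult_left_mono) auto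
    qed
    ultimately show ?thesis
      unfolding split v0 M_def distrib_right sum_distrib_right by linarith
  qed
  have pos: "0 < ?D x" if "x \<in> cbox a b" for x
    using riemannian_metric_facts(3)[OF h c] that K by auto
  have "continuous_on (cbox a b) (\<lambda>x. 1 / ?D x)"
    using pos by (intro continuous_on_divide continuous_on_const cD) force
  then obtain L where L: "0 < L" "\<And>x. x \<in> cbox a b \<Longrightarrow> norm (1 / ?D x) \<le> L"
    by (rule continuous_on_compact_bound) (rule that; blast)
  obtain U where U: "0 < U" "\<And>x. x \<in> cbox a b \<Longrightarrow> norm (?D x) \<le> U"
    using cD by (rule continuous_on_compact_bound) (rule that; blast)
  have low: "1 / L \<le> ?D x" if "x \<in> cbox a b" for x
    using L(2)[OF that] L(1) pos[OF that] by (simp add: field_simps)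
  \<comment> \<open>For \<open>r < 1 / (2 L M)\<close> the deviation \<open>M r\<close> is at most half of the lower bound \<open>1 / L\<close> of \<open>sqrt (det h)\<close>.\<close>
  show thesis
  proof (rule that[of "1 / (2 * L)" "min (min \<delta> 1) (1 / (2 * L * M))" "U + M"])
    show "0 < 1 / (2 * L)" using L by simp
    show "0 < min (min \<delta> 1) (1 / (2 * L * M))" using L M C(2) by simp
    fix x r assume x: "x \<in> cbox a b" and r: "0 < r" "r < min (min \<delta> 1) (1 / (2 * L * M))"
    have c1: "\<bar>sqrt (det (hr r c x)) - ?D x\<bar> \<le> M * r" by (rule close[OF x r(1)]) (use r in simp)
    have "r < 1 / (2 * L * M)" using r by simp
    then have m1: "M * r \<le> 1 / (2 * L)" using M L by (simp add: field_simps)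
    have m2: "M * r \<le> M" using M r by simp
    have "1 / L = 1 / (2 * L) + 1 / (2 * L)" by simp
    then have "1 / (2 * L) \<le> sqrt (det (hr r c x))" using c1 m1 low[OF x] by linarith
    moreover have "sqrt (det (hr r c x)) \<le> U + M" using c1 m2 U(2)[OF x] unfolding real_norm_def by linarith
    ultimately show "1 / (2 * L) \<le> sqrt (det (hr r c x)) \<and> sqrt (det (hr r c x)) \<le> U + M" by blast
  qed
qed

text \<open>For small \<open>r\<close> the matrices \<open>h\<^sub>r\<close> stay in a compact set of matrices with determinant bounded away
  from zero, on which the inverse is continuous.\<close>
lemma inverse_metric_bounded:
  fixes hr :: "real \<Rightarrow> ('m, 'n::finite) tensor2" and c :: "('m, 'n) chart"
  assumes ex: "metric_expansion A h hr" and ho: "holographic_coeffs A h hr v" and h: "riemannian_metric A h"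
    and c: "c \<in> A" and K: "cbox a b \<subseteq> cimg c"
  obtains C \<delta> where "0 < C" "0 < \<delta>" "\<And>x r i k. x \<in> cbox a b \<Longrightarrow> 0 < r \<Longrightarrow> r < \<delta> \<Longrightarrow>
     \<bar>sqrt (det (hr r c x)) * matrix_inv (hr r c x) $ i $ k\<bar> \<le> C"
proof -
  obtain C1 \<delta>1 where C1: "0 < \<delta>1" "\<And>x r. x \<in> cbox a b \<Longrightarrow> 0 < r \<Longrightarrow> r < \<delta>1 \<Longrightarrow> norm (hr r c x) \<le> C1"
    by (rule metric_family_bounded[OF ex c K]) (rule that; blast)
  obtain lo hi \<delta>2 where lh: "0 < lo" "0 < \<delta>2" "\<And>x r. x \<in> cbox a b \<Longrightarrow> 0 < r \<Longrightarrow> r < \<delta>2 \<Longrightarrow>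
     lo \<le> sqrt (det (hr r c x)) \<and> sqrt (det (hr r c x)) \<le> hi"
    by (rule volume_density_bounds[OF ho h c K]) (rule that; blast)
  define Z where "Z = {M :: real^'n^'n. norm M \<le> C1 \<and> lo\<^sup>2 \<le> det M}"
  have cdet: "continuous_on T (det :: real^'n^'n \<Rightarrow> real)" for T
    unfolding det_def by (intro continuous_intros)
  have "Z = cball 0 C1 \<inter> {M. lo\<^sup>2 \<le> det M}" by (auto simp: Z_def)
  moreover have "closed {M :: real^'n^'n. lo\<^sup>2 \<le> det M}"
    by (intro closed_Collect_le continuous_on_const cdet)
  ultimately have cZ: "compact Z" by (simp add: compact_Int_closed)
  define G where "G M = (\<chi> i k. sqrt (det M) * matrix_inv M $ i $ k)" for M :: "real^'n^'n"
  have "open {M :: real^'n^'n. 0 < det M}"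
    by (intro open_Collect_less continuous_on_const cdet)
  note smo = smooth_on_matrix_inv[OF this smooth_on_vec_nth[OF this smooth_on_vec_nth[OF this]], of "\<lambda>M. M"]
  have ci: "continuous_on Z (\<lambda>M. matrix_inv M $ i $ k)" for i k
  proof (rule continuous_on_subset[OF smooth_on_continuous[OF smo]])
    show "smooth_on {M :: real^'n^'n. 0 < det M} (\<lambda>M. M)"
      by (simp add: smooth_on_def Ck_on_ident)
    show "Z \<subseteq> {M. 0 < det M}"
      using lh(1) by (auto simp: Z_def intro: less_le_trans[of 0 "lo\<^sup>2"])
  qed simp
  have "continuous_on Z G"
    unfolding G_def[abs_def] by (intro continuous_intros ci cdet)
  then have "bounded (G ` Z)" by (intro compact_imp_bounded compact_continuous_image cZ)
  then obtain C where C: "0 < C" "\<And>M. M \<in> Z \<Longrightarrow> norm (G M) \<le> C" unfolding bounded_pos by auto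
  show thesis
  proof (rule that[of C "min \<delta>1 \<delta>2"])
    show "0 < C" "0 < min \<delta>1 \<delta>2" using C C1 lh by auto
    fix x r i k assume x: "x \<in> cbox a b" and r: "0 < (r::real)" "r < min \<delta>1 \<delta>2"
    have l: "lo \<le> sqrt (det (hr r c x))" using lh(3)[OF x r(1)] r by simp
    then have "0 < sqrt (det (hr r c x))" using lh(1) by linarith
    then have "0 < det (hr r c x)" by simp
    moreover have "lo\<^sup>2 \<le> (sqrt (det (hr r c x)))\<^sup>2" using l lh(1) by (intro power_mono) auto
    ultimately have "hr r c x \<in> Z" using C1(2)[OF x r(1)] r by (simp add: Z_def)
    from C(2)[OF this] have "norm (G (hr r c x) $ i $ k) \<le> C"
      using Finite_Cartesian_Product.norm_nth_le[of "G (hr r c x) $ i" k] Finite_Cartesian_Product.norm_nth_le[of "G (hr r c x)" i] by linarith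
    then show "\<bar>sqrt (det (hr r c x)) * matrix_inv (hr r c x) $ i $ k\<bar> \<le> C" by (simp add: G_def)
  qed
qed

lemma integral_volume_expansion:
  fixes hr :: "real \<Rightarrow> ('m, 'n::finite) tensor2" and c :: "('m, 'n) chart" and w :: "real^'n \<Rightarrow> complex"
  assumes ho: "holographic_coeffs A h hr v" and h: "riemannian_metric A h"
    and pe: "poincare_einstein A h \<epsilon> hr" and c: "c \<in> A" and K: "cbox a b \<subseteq> cimg c"
    and \<phi>: "continuous_on (cbox a b) \<phi>" and w: "continuous_on (cbox a b) w"
  shows "(\<lambda>r. integral (cbox a b) (\<lambda>x. (\<phi> x * sqrt (det (hr r c x))) *\<^sub>R w x)
     - (\<Sum>k\<le>CARD('n) div 2. integral (cbox a b) (\<lambda>x. (\<phi> x * (sqrt (det (h c x)) * v (2*k) (cinv c x))) *\<^sub>R w x)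
          * complex_of_real r ^ (2*k))) \<in> O0 (Suc CARD('n))"
proof -
  let ?n = "CARD('n)" and ?D = "\<lambda>x. sqrt (det (h c x))" and ?K = "cbox a b"
  obtain C \<delta> where C: "0 < C" "0 < \<delta>" "\<And>x r. x \<in> ?K \<Longrightarrow> 0 < r \<Longrightarrow> r < \<delta> \<Longrightarrow>
     \<bar>sqrt (det (hr r c x)) - ?D x * (\<Sum>k\<le>?n div 2. v (2*k) (cinv c x) * r ^ (2*k))\<bar> \<le> C * r ^ Suc ?n"
    by (rule volume_expansion[OF ho h c K]) (rule that; blast)
  have eps: "0 < \<epsilon>" and met: "\<And>r. 0 < r \<Longrightarrow> r < \<epsilon> \<Longrightarrow> riemannian_metric A (hr r)"
    using pe unfolding poincare_einstein_def by blast+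
  have "continuous_on ?K (\<lambda>x. \<phi> x *\<^sub>R w x)" by (intro continuous_on_scaleR \<phi> w)
  then obtain B where B: "0 < B" "\<And>x. x \<in> ?K \<Longrightarrow> norm (\<phi> x *\<^sub>R w x) \<le> B"
    by (rule continuous_on_compact_bound) (rule that; blast)
  define g where "g k x = (\<phi> x * (?D x * v (2*k) (cinv c x))) *\<^sub>R w x" for k x
  have cg: "continuous_on ?K (g k)" if "k \<le> ?n div 2" for k
    unfolding g_def[abs_def]
    by (intro continuous_on_scaleR continuous_on_mult \<phi> w sqrt_det_continuous[OF h c K]
        holographic_coeff_continuous[OF ho c K that])
  show ?thesis
  proof (rule O0_I[of "min \<epsilon> \<delta>" _ "B * C * measure lborel ?K"])
    show "0 < min \<epsilon> \<delta>" using eps C by simp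
    fix r assume r: "0 < r" "r < min \<epsilon> \<delta>"
    define f where "f x = (\<phi> x * sqrt (det (hr r c x))) *\<^sub>R w x" for x
    have cf: "continuous_on ?K f"
      unfolding f_def using r
      by (intro continuous_on_scaleR continuous_on_mult \<phi> w sqrt_det_continuous[OF met c K]) auto
    let ?s = "\<lambda>x. \<Sum>k\<in>{..?n div 2}. complex_of_real r ^ (2*k) * g k x"
    have cs: "continuous_on ?K ?s"
      by (intro continuous_on_sum continuous_on_mult continuous_on_const cg) auto
    have "(\<Sum>k\<le>?n div 2. integral ?K (g k) * complex_of_real r ^ (2*k)) = integral ?K ?s"
      by (subst integral_lincomb) (use cg in \<open>auto simp: mult.commute\<close>)
    then have eq: "integral ?K f - (\<Sum>k\<le>?n div 2. integral ?K (g k) * complex_of_real r ^ (2*k))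
       = integral ?K (\<lambda>x. f x - ?s x)"
      using Henstock_Kurzweil_Integration.integral_diff[OF integrable_continuous[OF cf] integrable_continuous[OF cs]]
      by simp
    have "norm (integral ?K (\<lambda>x. f x - ?s x)) \<le> (B * (C * r ^ Suc ?n)) * measure lborel ?K"
    proof (rule integrable_bound)
      show "0 \<le> B * (C * r ^ Suc ?n)" using B C r by simp
      show "(\<lambda>x. f x - ?s x) integrable_on ?K"
        by (intro integrable_continuous continuous_on_diff cf cs)
      fix x assume x: "x \<in> ?K"
      let ?t = "\<Sum>k\<le>?n div 2. v (2*k) (cinv c x) * r ^ (2*k)"
      have "?s x = (?D x * ?t) *\<^sub>R (\<phi> x *\<^sub>R w x)"
        unfolding g_def sum_distrib_left scaleR_sum_left
        by (intro sum.cong refl) (simp add: scaleR_conv_of_real mult_ac)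
      moreover have "f x = sqrt (det (hr r c x)) *\<^sub>R (\<phi> x *\<^sub>R w x)"
        by (simp add: f_def mult.commute)
      ultimately have "norm (f x - ?s x) = norm (\<phi> x *\<^sub>R w x) * \<bar>sqrt (det (hr r c x)) - ?D x * ?t\<bar>"
        by (simp only: scaleR_left_diff_distrib[symmetric] norm_scaleR) (simp add: mult_ac)
      also have "\<dots> \<le> B * (C * r ^ Suc ?n)"
        using B(2)[OF x] C(3)[OF x r(1)] r B(1) by (intro mult_mono) auto
      finally show "norm (f x - ?s x) \<le> B * (C * r ^ Suc ?n)" .
    qed
    then have "norm (integral ?K f - (\<Sum>k\<le>?n div 2. integral ?K (g k) * complex_of_real r ^ (2*k)))
       \<le> B * C * measure lborel ?K * r ^ Suc ?n"
      unfolding eq by (simp only: mult_ac)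
    then show "norm (integral ?K (\<lambda>x. (\<phi> x * sqrt (det (hr r c x))) *\<^sub>R w x)
     - (\<Sum>k\<le>?n div 2. integral ?K (\<lambda>x. (\<phi> x * (?D x * v (2*k) (cinv c x))) *\<^sub>R w x)
          * complex_of_real r ^ (2*k))) \<le> B * C * measure lborel ?K * r ^ Suc ?n"
      unfolding f_def[abs_def] g_def[abs_def] .
  qed
qed

section \<open>The weak form of the eigenvalue equation\<close>

text \<open>This is what remains of the eigenvalue equation after integration against a test function.
  Here \<open>A j r\<close> is the integral of \<open>\<phi> D\<^sub>r u\<^sub>j\<close>, and \<open>B j r\<close> that of \<open>D\<^sub>r\<close> times the inner product of the
  gradients of \<open>\<phi>\<close> and \<open>u\<^sub>j\<close> with respect to \<open>h\<^sub>r\<close>.  The function \<open>P\<close> is the flux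
  \<open>r^(1-n) \<integral> \<phi> D\<^sub>r \<partial>\<^sub>r u\<close>.  Powers of \<open>r\<close> whose exponents involve \<open>lam\<close> have been cancelled, so that
  all terms can be compared with powers with natural exponents.\<close>
definition weak_equation ::
  "nat \<Rightarrow> complex \<Rightarrow> (nat \<Rightarrow> real \<Rightarrow> complex) \<Rightarrow> (nat \<Rightarrow> real \<Rightarrow> complex) \<Rightarrow> bool" where
  "weak_equation n lam A B \<longleftrightarrow> (\<exists>P P' \<epsilon>. 0 < \<epsilon> \<and>
    (\<forall>r. 0 < r \<and> r < \<epsilon> \<longrightarrow> (P has_vector_derivative P' r) (at r)) \<and>
    (\<forall>r. 0 < r \<and> r < \<epsilon> \<longrightarrow> cpow r (- (lam - of_nat n)) * P r =
        (\<Sum>j\<le>n div 2. (lam + 2 * of_nat j) * of_real r ^ (2 * j) * A j r)) \<and>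
    (\<lambda>r. cpow r (1 - (lam - of_nat n)) * P' r
       - ((\<Sum>j\<le>n div 2. of_real r ^ (2 * j + 2) * B j r)
          - lam * (of_nat n - lam) * (\<Sum>j\<le>n div 2. of_real r ^ (2 * j) * A j r))) \<in> O0 (Suc n))"

text \<open>Multiply the divergence form of the Laplacian by \<open>\<phi>\<close> and integrate over the box.  The radial
  part is the derivative of the flux, by differentiation under the integral sign; in the
  tangential part integration by parts moves one derivative to \<open>\<phi>\<close>.  The hypothesis on the
  supports makes the boundary terms vanish.  It covers both uses: a test function \<open>\<phi>\<close> supported in the box, and
  \<open>\<phi> = 1\<close> with functions \<open>u\<^sub>j\<close> supported in the box.\<close>
lemma weak_eigen_equation:
  fixes hr :: "real \<Rightarrow> ('m, 'n::finite) tensor2" and c :: "('m, 'n) chart"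
    and t :: "nat \<Rightarrow> 'm \<Rightarrow> complex" and \<phi> :: "real^'n \<Rightarrow> real" and lam :: complex
    and a b :: "real^'n"
  defines "n \<equiv> CARD('n)"
  defines "w \<equiv> \<lambda>j. t j \<circ> cinv c"
  defines "A \<equiv> \<lambda>j r. integral (cbox a b) (\<lambda>x. (\<phi> x * sqrt (det (hr r c x))) *\<^sub>R w j x)"
  defines "B \<equiv> \<lambda>j r. integral (cbox a b) (\<lambda>x. \<Sum>i\<in>UNIV. \<Sum>k\<in>UNIV.
     (pderivative i \<phi> x * (sqrt (det (hr r c x)) * matrix_inv (hr r c x) $ i $ k)) *\<^sub>R pderivative k (w j) x)"
  assumes h: "riemannian_metric \<A> h" and pe: "poincare_einstein \<A> h \<epsilon> hr"
    and ho: "holographic_coeffs \<A> h hr v" and sol: "solution_coeffs \<A> hr lam f t"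
    and c: "c \<in> \<A>" and S: "open S" "cbox a b \<subseteq> S" "S \<subseteq> cimg c" and \<phi>: "smooth_on UNIV \<phi>"
    and supp: "\<And>x. x \<in> S - cbox a b \<Longrightarrow> \<phi> x = 0 \<or> (\<forall>j\<le>n div 2. \<forall>k. pderivative k (w j) x = 0)"
  shows "weak_equation n lam A B"
proof -
  define H where "H = (\<lambda>p. hr (p $ None) c (base_pt p))"
  note pc = poincare_einstein_chart[OF pe c S(3)]
  note eps = pc(1) and H = pc(2)[folded H_def]
  have sym: "transpose (H p) = H p" and det: "0 < det (H p)" if "p \<in> cylinder S \<epsilon>" for p
    using pc(3,4)[OF that] by (simp_all add: H_def)
  have K: "cbox a b \<subseteq> cimg c" using S by blast
  have w: "smooth_on S (w j)" if "j \<le> n div 2" for j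
  proof -
    have "smooth_on (cimg c) (w j)"
      using sol c that unfolding solution_coeffs_def smooth_fun_def w_def n_def by blast
    then show ?thesis by (rule smooth_on_subset[OF _ S(3)])
  qed
  have "O_bdry (cimg c) (\<lambda>p. laplacian (gplus hr c) (eigen_ansatz c lam t) p
             + lam * (of_nat n - lam) * eigen_ansatz c lam t p) (Re lam + real n + 1)"
    using sol c unfolding solution_coeffs_def n_def by blast
  then obtain CE \<delta>E where eq: "0 < \<delta>E" "\<And>x r. x \<in> cbox a b \<Longrightarrow> 0 < r \<Longrightarrow> r < \<delta>E \<Longrightarrow>
        norm (laplacian (gplus hr c) (eigen_ansatz c lam t) (mk_pt x r)
          + lam * (of_nat n - lam) * eigen_ansatz c lam t (mk_pt x r)) \<le> CE * r powr (Re lam + real n + 1)"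
    using K by (rule O_bdry_boxE) (rule that; blast)
  obtain lo CD \<delta>D where D: "0 < lo" "0 < \<delta>D" "\<And>x r. x \<in> cbox a b \<Longrightarrow> 0 < r \<Longrightarrow> r < \<delta>D \<Longrightarrow>
     lo \<le> sqrt (det (hr r c x)) \<and> sqrt (det (hr r c x)) \<le> CD"
    by (rule volume_density_bounds[OF ho h c K]) (rule that; blast)
  note vol = D(2) conjunct2[OF D(3)]
  define \<Omega> :: "(real^('n option)) set" where "\<Omega> = cylinder S \<epsilon>"
  define u where "u = eigen_ansatz c lam t"
  \<comment> \<open>\<open>q\<close> is the radial and \<open>X\<close> the tangential component of the flux of \<open>u\<close>.\<close>
  define q where "q p = (sqrt (det (H p)) / (p $ None) ^ (n - 1)) *\<^sub>R pderivative None u p" for p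
  define X where "X i p = (\<Sum>k\<in>UNIV.
      (sqrt (det (H p)) * matrix_inv (H p) $ i $ k / (p $ None) ^ (n - 1)) *\<^sub>R pderivative (Some k) u p)" for i p
  let ?K = "cbox a b" and ?D = "\<lambda>r x. sqrt (det (hr r c x))"
    and ?I = "\<lambda>r x. matrix_inv (hr r c x)" and ?N = "n div 2"
    and ?\<mu> = "lam - of_nat n" and ?l = "\<lambda>j. lam + 2 * of_nat j"
  have n0: "0 < n" by (simp add: n_def)
  have O: "open \<Omega>" unfolding \<Omega>_def by (rule open_cylinder[OF S(1)])
  have in\<Omega>: "mk_pt x r \<in> \<Omega>" if "x \<in> S" "0 < r" "r < \<epsilon>" for x r
    using that by (simp add: \<Omega>_def mk_pt_in_cylinder)
  have Hmk: "H (mk_pt x r) = hr r c x" for x r by (simp add: H_def)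
  have posN: "0 < p $ None" if "p \<in> \<Omega>" for p using that by (simp add: \<Omega>_def cylinder_def)
  have smH: "smooth_on \<Omega> (\<lambda>p. H p $ i $ j)" for i j
    using H unfolding \<Omega>_def by (intro smooth_on_vec_nth open_cylinder S(1))
  have smD: "smooth_on \<Omega> (\<lambda>p. sqrt (det (H p)))"
    using det by (intro smooth_on_sqrt O smooth_on_det smH) (simp add: \<Omega>_def)
  have smI: "smooth_on \<Omega> (\<lambda>p. matrix_inv (H p) $ i $ j)" for i j
    using det by (intro smooth_on_matrix_inv O smH) (simp add: \<Omega>_def)
  have smN: "smooth_on \<Omega> (\<lambda>p. (p $ None) ^ m)" for m
    using smooth_on_prod[OF O, of "{..<m}" "\<lambda>_ p. p $ None"] smooth_on_linear[OF bounded_linear_vec_nth O] by simp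
  have smu: "smooth_on \<Omega> u"
    unfolding \<Omega>_def u_def by (rule smooth_on_eigen_ansatz[OF S(1)]) (use w in \<open>simp add: w_def n_def\<close>)
  have smq: "smooth_on \<Omega> q"
    unfolding q_def[abs_def] using posN
    by (intro smooth_on_scaleR O smooth_on_divide smD smN smooth_on_pderivative smu zero_less_power)
  have smX: "smooth_on \<Omega> (X i)" for i
    unfolding X_def[abs_def] using posN
    by (intro smooth_on_sum smooth_on_scaleR O smooth_on_divide smooth_on_mult smD smI smN
        smooth_on_pderivative smu zero_less_power)
  have contS: "continuous_on S (\<lambda>x. G (mk_pt x r))" if "smooth_on \<Omega> G" "0 < r" "r < \<epsilon>"
    for G :: "real^('n option) \<Rightarrow> complex" and r
    using that unfolding \<Omega>_def by (intro smooth_on_fix_r)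
  have contK: "continuous_on ?K (\<lambda>x. G (mk_pt x r))" if "smooth_on \<Omega> G" "0 < r" "r < \<epsilon>"
    for G :: "real^('n option) \<Rightarrow> complex" and r
    by (rule continuous_on_subset[OF contS[OF that] S(2)])
  have c\<phi>: "continuous_on T \<phi>" for T
    by (rule continuous_on_subset[OF smooth_on_continuous[OF \<phi>] subset_UNIV])
  have cd\<phi>: "continuous_on T (pderivative i \<phi>)" for T i
    by (rule continuous_on_subset[OF smooth_on_continuous[OF smooth_on_pderivative[OF \<phi>]] subset_UNIV])
  have cD: "continuous_on ?K (?D r)" if "0 < r" "r < \<epsilon>" for r
    using smooth_on_fix_r[OF smD[unfolded \<Omega>_def] that] S(2) by (auto simp: Hmk intro: continuous_on_subset)
  have cI: "continuous_on ?K (\<lambda>x. ?I r x $ i $ k)" if "0 < r" "r < \<epsilon>" for r i k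
    using smooth_on_fix_r[OF smI[unfolded \<Omega>_def] that] S(2) by (auto simp: Hmk intro: continuous_on_subset)
  have cw: "continuous_on ?K (w j)" "continuous_on ?K (pderivative k (w j))" if "j \<le> ?N" for j k
    using smooth_on_continuous[OF w[OF that]] smooth_on_continuous[OF smooth_on_pderivative[OF w[OF that]]] S(2)
    by (auto intro: continuous_on_subset)
  have u_mk: "u (mk_pt x r) = (\<Sum>j\<le>?N. cpow r (?l j) * w j x)" for x r
    by (simp add: u_def eigen_ansatz_def w_def n_def)
  have uN: "pderivative None u (mk_pt x r) = (\<Sum>j\<le>?N.
      ?l j * cpow r (?l j - 1) * w j x)"
    if "x \<in> S" "0 < r" for x r
    unfolding u_def w_def n_def
    by (rule pderivative_eigen_ansatz(1)[OF S(1) _ that]) (use w in \<open>simp add: w_def n_def\<close>)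
  have uS: "pderivative (Some k) u (mk_pt x r) = (\<Sum>j\<le>?N.
      cpow r (?l j) * pderivative k (w j) x)"
    if "x \<in> S" "0 < r" for x r k
    unfolding u_def w_def n_def
    by (rule pderivative_eigen_ansatz(2)[OF S(1) _ that]) (use w in \<open>simp add: w_def n_def\<close>)
  define P where "P r = integral ?K (\<lambda>x. \<phi> x *\<^sub>R q (mk_pt x r))" for r
  define P' where "P' r = integral ?K (\<lambda>x. \<phi> x *\<^sub>R pderivative None q (mk_pt x r))" for r
  have deriv: "(P has_vector_derivative P' r) (at r)" if r: "0 < r" "r < \<epsilon>" for r
  proof -
    have "(P has_vector_derivative P' r) (at r within {0<..<\<epsilon>})"
      unfolding P_def[abs_def] P'_def
    proof (rule leibniz_rule_vector_derivative)
      fix s x assume s: "s \<in> {0<..<\<epsilon>}" and x: "x \<in> ?K"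
      have "mk_pt x s \<in> \<Omega>" using s x S(2) by (intro in\<Omega>) auto
      then have "((\<lambda>s. q (mk_pt x s)) has_vector_derivative pderivative None q (mk_pt x s)) (at s within {0<..<\<epsilon>})"
        by (rule has_vector_derivative_at_within[OF has_vector_derivative_mk_pt[OF smooth_on_differentiable[OF smq]]])
      then show "((\<lambda>s. \<phi> x *\<^sub>R q (mk_pt x s)) has_vector_derivative \<phi> x *\<^sub>R pderivative None q (mk_pt x s)) (at s within {0<..<\<epsilon>})"
        by (rule bounded_linear.has_vector_derivative[OF bounded_linear_scaleR_right])
    next
      fix s assume "s \<in> {0<..<\<epsilon>}"
      then show "(\<lambda>x. \<phi> x *\<^sub>R q (mk_pt x s)) integrable_on ?K"
        by (intro integrable_continuous continuous_on_scaleR c\<phi> contK smq) auto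
    next
      have "continuous_on ({0<..<\<epsilon>} \<times> ?K) (\<lambda>z. pderivative None q (mk_pt (snd z) (fst z)))"
        by (rule continuous_on_compose2[OF smooth_on_continuous[OF smooth_on_pderivative[OF smq, of None]]])
           (use S(2) in \<open>auto intro!: continuous_intros in\<Omega>\<close>)
      moreover have "continuous_on ({0<..<\<epsilon>} \<times> ?K) (\<lambda>z. \<phi> (snd z))"
        by (rule continuous_on_compose2[OF c\<phi>[of UNIV]]) (auto intro!: continuous_intros)
      ultimately show "continuous_on ({0<..<\<epsilon>} \<times> ?K) (\<lambda>(s, x). \<phi> x *\<^sub>R pderivative None q (mk_pt x s))"
        unfolding case_prod_beta by (intro continuous_on_scaleR)
    qed (use r in auto)
    moreover have "at r within {0<..<\<epsilon>} = at r" using r by (intro at_within_open) auto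
    ultimately show ?thesis by simp
  qed
  have cA: "continuous_on ?K (\<lambda>x. (\<phi> x * ?D r x) *\<^sub>R w j x)" if "0 < r" "r < \<epsilon>" "j \<le> ?N" for r j
    using that by (intro continuous_on_scaleR continuous_on_mult c\<phi> cD cw)
  have cB: "continuous_on ?K (\<lambda>x. \<Sum>i\<in>UNIV. \<Sum>k\<in>UNIV.
     (pderivative i \<phi> x * (?D r x * ?I r x $ i $ k)) *\<^sub>R pderivative k (w j) x)"
    if "0 < r" "r < \<epsilon>" "j \<le> ?N" for r j
    using that by (intro continuous_on_sum continuous_on_scaleR continuous_on_mult cd\<phi> cD cw cI)
  have swap: "x * ((l * y) * z) = l * (x * y) * z" for x y z l :: complex
    by (simp add: mult_ac)
  have P_eq: "cpow r (- ?\<mu>) * P r =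
        (\<Sum>j\<le>?N. ?l j * of_real r ^ (2 * j) * A j r)" if r: "0 < r" "r < \<epsilon>" for r
  proof -
    have "P r = integral ?K (\<lambda>x. \<Sum>j\<le>?N. (?l j *
        (cpow r (?l j - 1) / of_real r ^ (n - 1))) * ((\<phi> x * ?D r x) *\<^sub>R w j x))"
      unfolding P_def
    proof (rule Henstock_Kurzweil_Integration.integral_cong)
      fix x assume "x \<in> ?K"
      then have x: "x \<in> S" using S(2) by blast
      show "\<phi> x *\<^sub>R q (mk_pt x r) = (\<Sum>j\<le>?N. (?l j *
        (cpow r (?l j - 1) / of_real r ^ (n - 1))) * ((\<phi> x * ?D r x) *\<^sub>R w j x))"
        unfolding q_def Hmk uN[OF x r(1)] scaleR_sum_right mk_pt_None
        by (intro sum.cong refl) (simp add: scaleR_conv_of_real mult_ac)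
    qed
    also have "\<dots> = (\<Sum>j\<le>?N. (?l j *
        (cpow r (?l j - 1) / of_real r ^ (n - 1))) * A j r)"
      unfolding A_def by (rule integral_lincomb) (use cA[OF r] in auto)
    finally have "cpow r (- ?\<mu>) * P r = (\<Sum>j\<le>?N.
       cpow r (- ?\<mu>) * ((?l j *
        (cpow r (?l j - 1) / of_real r ^ (n - 1))) * A j r))"
      by (simp only: sum_distrib_left)
    also have "\<dots> = (\<Sum>j\<le>?N. ?l j * of_real r ^ (2 * j) * A j r)"
    proof (intro sum.cong refl)
      fix j
      have "cpow r (- ?\<mu>) * cpow r (?l j - 1)
         = of_real r ^ (n - 1 + 2 * j)"
        using r(1) n0 by (intro of_real_powr_mult_eq_power) (simp_all add: of_nat_diff)
      then have "cpow r (- ?\<mu>) * (cpow r (?l j - 1) / of_real r ^ (n - 1))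
         = of_real r ^ (2 * j)"
        using r(1) by (simp add: power_add)
      then show "cpow r (- ?\<mu>) * ((?l j *
        (cpow r (?l j - 1) / of_real r ^ (n - 1))) * A j r)
         = ?l j * of_real r ^ (2 * j) * A j r"
        by (simp only: swap)
    qed
    finally show ?thesis .
  qed
  \<comment> \<open>\<open>Q\<close> is the defect of the equation, times \<open>\<phi> D\<^sub>r / r^(n+1)\<close>, in a form that is visibly continuous.\<close>
  define Q where "Q r x = \<phi> x *\<^sub>R (pderivative None q (mk_pt x r) + (\<Sum>i\<in>UNIV. pderivative (Some i) (X i) (mk_pt x r)))
     + (\<phi> x * ?D r x / r ^ (n + 1)) *\<^sub>R (lam * (of_nat n - lam) * u (mk_pt x r))" for r x
  have Q_eq: "Q r x = (\<phi> x * ?D r x / r ^ (n + 1)) *\<^sub>R (laplacian (gplus hr c) u (mk_pt x r)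
          + lam * (of_nat n - lam) * u (mk_pt x r))" if x: "x \<in> S" and r: "0 < r" "r < \<epsilon>" for r x
  proof -
    have "?D r x *\<^sub>R laplacian (gplus hr c) u (mk_pt x r) =
       r ^ (n + 1) *\<^sub>R (pderivative None q (mk_pt x r) + (\<Sum>i\<in>UNIV. pderivative (Some i) (X i) (mk_pt x r)))"
    proof -
      have "smooth_on \<Omega> (\<lambda>p. hr (p $ None) c (base_pt p))" using H by (simp add: \<Omega>_def H_def)
      moreover have "transpose (hr (p $ None) c (base_pt p)) = hr (p $ None) c (base_pt p)"
        and "0 < det (hr (p $ None) c (base_pt p))" if "p \<in> \<Omega>" for p
        using sym[of p] det[of p] that by (simp_all add: \<Omega>_def H_def)
      ultimately show ?thesis
        using laplacian_gplus[where hr=hr and c=c and u=u and S=\<Omega> and p="mk_pt x r", OF O in\<Omega>[OF x r] posN] smu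
        unfolding q_def[abs_def] X_def[abs_def] H_def n_def mk_pt_None base_pt_mk_pt by blast
    qed
    then have "(\<phi> x / r ^ (n + 1)) *\<^sub>R (?D r x *\<^sub>R laplacian (gplus hr c) u (mk_pt x r)) =
       (\<phi> x / r ^ (n + 1)) *\<^sub>R (r ^ (n + 1) *\<^sub>R (pderivative None q (mk_pt x r) + (\<Sum>i\<in>UNIV. pderivative (Some i) (X i) (mk_pt x r))))"
      by (rule arg_cong)
    then have "\<phi> x *\<^sub>R (pderivative None q (mk_pt x r) + (\<Sum>i\<in>UNIV. pderivative (Some i) (X i) (mk_pt x r)))
       = (\<phi> x * ?D r x / r ^ (n + 1)) *\<^sub>R laplacian (gplus hr c) u (mk_pt x r)"
      using r by (simp del: power_Suc)
    then show ?thesis unfolding Q_def by (simp only: scaleR_add_right)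
  qed
  have cq: "continuous_on ?K (\<lambda>x. pderivative None q (mk_pt x r))" if "0 < r" "r < \<epsilon>" for r
    by (rule contK[OF smooth_on_pderivative[OF smq] that])
  have cX: "continuous_on ?K (\<lambda>x. pderivative (Some i) (X i) (mk_pt x r))" if "0 < r" "r < \<epsilon>" for r i
    by (rule contK[OF smooth_on_pderivative[OF smX] that])
  have cu: "continuous_on ?K (\<lambda>x. (\<phi> x * ?D r x) *\<^sub>R u (mk_pt x r))" if "0 < r" "r < \<epsilon>" for r
    using that by (intro continuous_on_scaleR continuous_on_mult c\<phi> cD contK smu)
  have cQ: "continuous_on ?K (Q r)" if r: "0 < r" "r < \<epsilon>" for r
    unfolding Q_def[abs_def] using r
    by (intro continuous_on_add continuous_on_scaleR continuous_on_mult continuous_on_divide continuous_on_sum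
        continuous_on_const c\<phi> cD contK smu cq cX) auto
  have parts: "integral ?K (\<lambda>x. \<phi> x *\<^sub>R pderivative (Some i) (X i) (mk_pt x r))
      = - integral ?K (\<lambda>x. pderivative i \<phi> x *\<^sub>R X i (mk_pt x r))" if r: "0 < r" "r < \<epsilon>" for r i
  proof -
    define Y where "Y x = \<phi> x *\<^sub>R X i (mk_pt x r)" for x
    have Yd: "(Y has_derivative (\<lambda>v. \<phi> x *\<^sub>R frechet_derivative (\<lambda>x. X i (mk_pt x r)) (at x) v
         + frechet_derivative \<phi> (at x) v *\<^sub>R X i (mk_pt x r))) (at x)" if x: "x \<in> S" for x
    proof -
      have "(\<lambda>x. X i (mk_pt x r)) differentiable (at x)"
        by (rule pderivative_mk_pt(1)[OF smooth_on_differentiable[OF smX in\<Omega>[OF x r]]])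
      then have "((\<lambda>x. X i (mk_pt x r)) has_derivative frechet_derivative (\<lambda>x. X i (mk_pt x r)) (at x)) (at x)"
        by (simp add: frechet_derivative_works)
      then show ?thesis unfolding Y_def[abs_def]
        by (intro has_derivative_scaleR smooth_on_has_derivative[OF \<phi>] UNIV_I)
    qed
    have Yp: "pderivative i Y x = \<phi> x *\<^sub>R pderivative (Some i) (X i) (mk_pt x r) + pderivative i \<phi> x *\<^sub>R X i (mk_pt x r)"
      if x: "x \<in> S" for x
      using pderivative_eq[OF Yd[OF x], of i]
        pderivative_mk_pt(2)[OF smooth_on_differentiable[OF smX in\<Omega>[OF x r]], of i i]
      by (simp add: pderivative_def)
    have "integral ?K (pderivative i Y) = 0"
    proof (rule integral_pderivative_eq_0[OF S(1,2)])
      show "Y differentiable (at x)" if "x \<in> S" for x using Yd[OF that] by (auto simp: differentiable_def)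
      have "continuous_on S (\<lambda>x. \<phi> x *\<^sub>R pderivative (Some i) (X i) (mk_pt x r) + pderivative i \<phi> x *\<^sub>R X i (mk_pt x r))"
        using r by (intro continuous_on_add continuous_on_scaleR c\<phi> cd\<phi> contS smooth_on_pderivative smX)
      then show "continuous_on S (pderivative i Y)"
        by (rule continuous_on_eq) (simp add: Yp)
      show "Y x = 0" if "x \<in> S - ?K" for x
        using supp[OF that] that r by (auto simp: Y_def X_def uS)
    qed
    also have "integral ?K (pderivative i Y) = integral ?K (\<lambda>x. \<phi> x *\<^sub>R pderivative (Some i) (X i) (mk_pt x r)
         + pderivative i \<phi> x *\<^sub>R X i (mk_pt x r))"
      using S(2) Yp by (intro Henstock_Kurzweil_Integration.integral_cong) auto
    also have "\<dots> = integral ?K (\<lambda>x. \<phi> x *\<^sub>R pderivative (Some i) (X i) (mk_pt x r))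
         + integral ?K (\<lambda>x. pderivative i \<phi> x *\<^sub>R X i (mk_pt x r))"
      using r by (intro Henstock_Kurzweil_Integration.integral_add integrable_continuous continuous_on_scaleR c\<phi> cd\<phi> cX contK smX)
    finally show ?thesis by (simp add: add_eq_0_iff2)
  qed
  have P'_eq: "P' r = integral ?K (Q r)
      - (lam * (of_nat n - lam) / of_real r ^ (n + 1)) * integral ?K (\<lambda>x. (\<phi> x * ?D r x) *\<^sub>R u (mk_pt x r))
      + (\<Sum>i\<in>UNIV. integral ?K (\<lambda>x. pderivative i \<phi> x *\<^sub>R X i (mk_pt x r)))" if r: "0 < r" "r < \<epsilon>" for r
  proof -
    let ?e = "lam * (of_nat n - lam) / of_real r ^ (n + 1)"
    have "P' r = integral ?K (\<lambda>x. Q r x - ?e * ((\<phi> x * ?D r x) *\<^sub>R u (mk_pt x r))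
        - (\<Sum>i\<in>UNIV. \<phi> x *\<^sub>R pderivative (Some i) (X i) (mk_pt x r)))"
      unfolding P'_def Q_def
    proof (rule Henstock_Kurzweil_Integration.integral_cong)
      fix x
      have "(\<phi> x * ?D r x / r ^ (n + 1)) *\<^sub>R (lam * (of_nat n - lam) * u (mk_pt x r)) = ?e * ((\<phi> x * ?D r x) *\<^sub>R u (mk_pt x r))"
        by (simp add: scaleR_conv_of_real mult_ac del: power_Suc)
      then show "\<phi> x *\<^sub>R pderivative None q (mk_pt x r) = \<phi> x *\<^sub>R (pderivative None q (mk_pt x r) + (\<Sum>i\<in>UNIV. pderivative (Some i) (X i) (mk_pt x r)))
     + (\<phi> x * ?D r x / r ^ (n + 1)) *\<^sub>R (lam * (of_nat n - lam) * u (mk_pt x r)) - ?e * ((\<phi> x * ?D r x) *\<^sub>R u (mk_pt x r))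
        - (\<Sum>i\<in>UNIV. \<phi> x *\<^sub>R pderivative (Some i) (X i) (mk_pt x r))"
        by (simp only: scaleR_add_right scaleR_sum_right) simp
    qed
    also have "\<dots> = integral ?K (\<lambda>x. Q r x - ?e * ((\<phi> x * ?D r x) *\<^sub>R u (mk_pt x r)))
        - integral ?K (\<lambda>x. \<Sum>i\<in>UNIV. \<phi> x *\<^sub>R pderivative (Some i) (X i) (mk_pt x r))"
      using r by (intro Henstock_Kurzweil_Integration.integral_diff integrable_continuous continuous_on_diff cQ
          continuous_on_mult continuous_on_const cu continuous_on_sum continuous_on_scaleR[OF c\<phi> cX])
    also have "integral ?K (\<lambda>x. Q r x - ?e * ((\<phi> x * ?D r x) *\<^sub>R u (mk_pt x r)))
       = integral ?K (Q r) - integral ?K (\<lambda>x. ?e * ((\<phi> x * ?D r x) *\<^sub>R u (mk_pt x r)))"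
      using r by (intro Henstock_Kurzweil_Integration.integral_diff integrable_continuous cQ
          continuous_on_mult[OF continuous_on_const cu])
    also have "integral ?K (\<lambda>x. ?e * ((\<phi> x * ?D r x) *\<^sub>R u (mk_pt x r)))
       = ?e * integral ?K (\<lambda>x. (\<phi> x * ?D r x) *\<^sub>R u (mk_pt x r))"
      by (rule Henstock_Kurzweil_Integration.integral_mult_right)
    also have "integral ?K (\<lambda>x. \<Sum>i\<in>UNIV. \<phi> x *\<^sub>R pderivative (Some i) (X i) (mk_pt x r))
       = (\<Sum>i\<in>UNIV. integral ?K (\<lambda>x. \<phi> x *\<^sub>R pderivative (Some i) (X i) (mk_pt x r)))"
      using r by (intro Henstock_Kurzweil_Integration.integral_sum integrable_continuous continuous_on_scaleR[OF c\<phi> cX]) auto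
    also have "\<dots> = - (\<Sum>i\<in>UNIV. integral ?K (\<lambda>x. pderivative i \<phi> x *\<^sub>R X i (mk_pt x r)))"
      unfolding sum_negf[symmetric] by (intro sum.cong refl parts[OF r])
    finally show ?thesis by simp
  qed
  have u_int: "cpow r (1 - ?\<mu>) * ((lam * (of_nat n - lam) / of_real r ^ (n + 1)) *
      integral ?K (\<lambda>x. (\<phi> x * ?D r x) *\<^sub>R u (mk_pt x r)))
      = lam * (of_nat n - lam) * (\<Sum>j\<le>?N. of_real r ^ (2 * j) * A j r)" if r: "0 < r" "r < \<epsilon>" for r
  proof -
    have "integral ?K (\<lambda>x. (\<phi> x * ?D r x) *\<^sub>R u (mk_pt x r)) =
       integral ?K (\<lambda>x. \<Sum>j\<le>?N. cpow r (?l j) * ((\<phi> x * ?D r x) *\<^sub>R w j x))"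
      unfolding u_mk scaleR_sum_right
      by (intro Henstock_Kurzweil_Integration.integral_cong sum.cong refl) simp
    also have "\<dots> = (\<Sum>j\<le>?N. cpow r (?l j) * A j r)"
      unfolding A_def by (rule integral_lincomb) (use cA[OF r] in auto)
    finally have "cpow r (1 - ?\<mu>) * ((lam * (of_nat n - lam) / of_real r ^ (n + 1)) *
      integral ?K (\<lambda>x. (\<phi> x * ?D r x) *\<^sub>R u (mk_pt x r))) = lam * (of_nat n - lam) *
       (\<Sum>j\<le>?N. (cpow r (1 - ?\<mu>) * cpow r (?l j)) / of_real r ^ (n + 1) * A j r)"
      by (simp only: sum_distrib_left) (intro sum.cong refl, simp add: mult_ac)
    also have "(\<Sum>j\<le>?N. (cpow r (1 - ?\<mu>) * cpow r (?l j)) / of_real r ^ (n + 1) * A j r)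
      = (\<Sum>j\<le>?N. of_real r ^ (2 * j) * A j r)"
    proof (intro sum.cong refl)
      fix j
      have "cpow r (1 - ?\<mu>) * cpow r (?l j)
         = of_real r ^ (n + 1 + 2 * j)"
        using r(1) by (intro of_real_powr_mult_eq_power) simp_all
      then show "(cpow r (1 - ?\<mu>) * cpow r (?l j)) / of_real r ^ (n + 1) * A j r
         = of_real r ^ (2 * j) * A j r"
        using r(1) by (simp add: power_add)
    qed
    finally show ?thesis .
  qed
  have X_int: "cpow r (1 - ?\<mu>) * (\<Sum>i\<in>UNIV. integral ?K (\<lambda>x. pderivative i \<phi> x *\<^sub>R X i (mk_pt x r)))
      = (\<Sum>j\<le>?N. of_real r ^ (2 * j + 2) * B j r)" if r: "0 < r" "r < \<epsilon>" for r
  proof -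
    have "(\<Sum>i\<in>UNIV. integral ?K (\<lambda>x. pderivative i \<phi> x *\<^sub>R X i (mk_pt x r)))
      = integral ?K (\<lambda>x. \<Sum>i\<in>UNIV. pderivative i \<phi> x *\<^sub>R X i (mk_pt x r))"
      using r by (intro Henstock_Kurzweil_Integration.integral_sum[symmetric] integrable_continuous
          continuous_on_scaleR cd\<phi> contK smX) auto
    also have "\<dots> = integral ?K (\<lambda>x. \<Sum>j\<le>?N. (cpow r (?l j) / of_real r ^ (n - 1)) *
         (\<Sum>i\<in>UNIV. \<Sum>k\<in>UNIV. (pderivative i \<phi> x * (?D r x * ?I r x $ i $ k)) *\<^sub>R pderivative k (w j) x))"
    proof (rule Henstock_Kurzweil_Integration.integral_cong)
      fix x assume "x \<in> ?K"
      then have x: "x \<in> S" using S(2) by blast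
      let ?g = "\<lambda>i k j. (cpow r (?l j) / of_real r ^ (n - 1)) *
         ((pderivative i \<phi> x * (?D r x * ?I r x $ i $ k)) *\<^sub>R pderivative k (w j) x)"
      have "(\<Sum>i\<in>UNIV. pderivative i \<phi> x *\<^sub>R X i (mk_pt x r)) = (\<Sum>i\<in>UNIV. \<Sum>k\<in>UNIV. \<Sum>j\<le>?N. ?g i k j)"
        unfolding X_def Hmk uS[OF x r(1)] scaleR_sum_right mk_pt_None
        by (intro sum.cong refl) (simp add: scaleR_conv_of_real mult_ac)
      also have "\<dots> = (\<Sum>i\<in>UNIV. \<Sum>j\<le>?N. \<Sum>k\<in>UNIV. ?g i k j)"
        by (intro sum.cong refl sum.swap)
      also have "\<dots> = (\<Sum>j\<le>?N. \<Sum>i\<in>UNIV. \<Sum>k\<in>UNIV. ?g i k j)"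
        by (rule sum.swap)
      finally show "(\<Sum>i\<in>UNIV. pderivative i \<phi> x *\<^sub>R X i (mk_pt x r)) =
         (\<Sum>j\<le>?N. (cpow r (?l j) / of_real r ^ (n - 1)) *
         (\<Sum>i\<in>UNIV. \<Sum>k\<in>UNIV. (pderivative i \<phi> x * (?D r x * ?I r x $ i $ k)) *\<^sub>R pderivative k (w j) x))"
        by (simp only: sum_distrib_left)
    qed
    also have "\<dots> = (\<Sum>j\<le>?N. (cpow r (?l j) / of_real r ^ (n - 1)) * B j r)"
      unfolding B_def by (rule integral_lincomb) (use cB[OF r] in auto)
    finally have "cpow r (1 - ?\<mu>) * (\<Sum>i\<in>UNIV. integral ?K (\<lambda>x. pderivative i \<phi> x *\<^sub>R X i (mk_pt x r)))
      = (\<Sum>j\<le>?N. (cpow r (1 - ?\<mu>) * cpow r (?l j)) / of_real r ^ (n - 1) * B j r)"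
      by (simp only: sum_distrib_left) (intro sum.cong refl, simp add: mult_ac)
    also have "\<dots> = (\<Sum>j\<le>?N. of_real r ^ (2 * j + 2) * B j r)"
    proof (intro sum.cong refl)
      fix j
      have "cpow r (1 - ?\<mu>) * cpow r (?l j)
         = of_real r ^ (n - 1 + (2 * j + 2))"
        using r(1) n0 by (intro of_real_powr_mult_eq_power) (simp_all add: of_nat_diff)
      then show "(cpow r (1 - ?\<mu>) * cpow r (?l j)) / of_real r ^ (n - 1) * B j r
         = of_real r ^ (2 * j + 2) * B j r"
        using r(1) by (simp only: power_add) simp
    qed
    finally show ?thesis .
  qed
  obtain C\<phi> where C\<phi>: "0 < C\<phi>" "\<And>x. x \<in> ?K \<Longrightarrow> norm (\<phi> x) \<le> C\<phi>"
  proof -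
    have "bounded (\<phi> ` ?K)" by (intro compact_imp_bounded compact_continuous_image c\<phi> compact_cbox)
    then show thesis using that unfolding bounded_pos by auto
  qed
  define M where "M = C\<phi> * \<bar>CD\<bar> * \<bar>CE\<bar>"
  have remainder: "(\<lambda>r. cpow r (1 - ?\<mu>) * integral ?K (Q r)) \<in> O0 (Suc n)"
  proof (rule O0_I[of "min \<epsilon> (min \<delta>E \<delta>D)" _ "M * measure lborel ?K"])
    show "0 < min \<epsilon> (min \<delta>E \<delta>D)" using eps eq(1) vol(1) by simp
    fix r assume r: "0 < r" "r < min \<epsilon> (min \<delta>E \<delta>D)"
    have "norm (integral ?K (Q r)) \<le> (M * r powr Re lam) * measure lborel ?K"
    proof (rule integrable_bound)
      show "0 \<le> M * r powr Re lam" using C\<phi> by (simp add: M_def)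
      show "Q r integrable_on ?K" using r by (intro integrable_continuous cQ) auto
      fix x assume x: "x \<in> ?K"
      have D: "0 \<le> ?D r x" "?D r x \<le> \<bar>CD\<bar>"
        using vol(2)[OF x, of r] r det[of "mk_pt x r"] x S(2) by (auto simp: Hmk mk_pt_in_cylinder less_imp_le)
      have E: "norm (laplacian (gplus hr c) u (mk_pt x r) + lam * (of_nat n - lam) * u (mk_pt x r))
         \<le> \<bar>CE\<bar> * r powr (Re lam + real n + 1)"
        using eq(2)[OF x, of r] r unfolding u_def
        by (auto intro: order_trans[OF _ mult_right_mono[of CE "\<bar>CE\<bar>"]])
      have rp: "r powr (Re lam + real n + 1) = r powr Re lam * r ^ (n + 1)"
        using r(1) powr_add[of r "Re lam" "real (n + 1)"] powr_realpow[OF r(1), of "n + 1"]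
        by (simp add: add_ac)
      have "norm (Q r x) = \<bar>\<phi> x\<bar> * ?D r x / r ^ (n + 1) * norm (laplacian (gplus hr c) u (mk_pt x r) + lam * (of_nat n - lam) * u (mk_pt x r))"
        using Q_eq[of x r] x S(2) r D(1) by (auto simp: abs_mult)
      also have "\<dots> \<le> C\<phi> * \<bar>CD\<bar> / r ^ (n + 1) * (\<bar>CE\<bar> * r powr (Re lam + real n + 1))"
        using C\<phi>(2)[OF x] C\<phi>(1) D E r(1)
        by (intro mult_mono divide_right_mono) auto
      also have "\<dots> = M * r powr Re lam"
        using r(1) unfolding rp M_def by (simp del: power_Suc)
      finally show "norm (Q r x) \<le> M * r powr Re lam" .
    qed
    then have "norm (cpow r (1 - ?\<mu>) * integral ?K (Q r))
       \<le> r powr (1 - (Re lam - real n)) * ((M * r powr Re lam) * measure lborel ?K)"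
      using r(1) by (simp add: norm_mult norm_of_real_powr mult_left_mono)
    also have "\<dots> = (r powr (1 - (Re lam - real n)) * r powr Re lam) * (M * measure lborel ?K)"
      by (simp add: mult_ac)
    also have "r powr (1 - (Re lam - real n)) * r powr Re lam = r ^ Suc n"
      using powr_realpow[OF r(1), of "Suc n"] unfolding powr_add[symmetric] by (simp add: add.commute)
    finally show "norm (cpow r (1 - ?\<mu>) * integral ?K (Q r)) \<le> M * measure lborel ?K * r ^ Suc n"
      by (simp add: mult_ac)
  qed
  have "(\<lambda>r. cpow r (1 - ?\<mu>) * P' r
       - ((\<Sum>j\<le>?N. of_real r ^ (2 * j + 2) * B j r)
          - lam * (of_nat n - lam) * (\<Sum>j\<le>?N. of_real r ^ (2 * j) * A j r))) \<in> O0 (Suc n)"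
  proof (rule landau_o.big.in_cong[THEN iffD1, OF _ remainder])
    have "cpow r (1 - ?\<mu>) * integral ?K (Q r) =
       cpow r (1 - ?\<mu>) * P' r
       - ((\<Sum>j\<le>?N. of_real r ^ (2 * j + 2) * B j r)
          - lam * (of_nat n - lam) * (\<Sum>j\<le>?N. of_real r ^ (2 * j) * A j r))" if r: "0 < r" "r < \<epsilon>" for r
      unfolding X_int[OF r, symmetric] u_int[OF r, symmetric] P'_eq[OF r]
      by (simp only: distrib_left right_diff_distrib) simp
    then show "\<forall>\<^sub>F r in at_right 0. cpow r (1 - ?\<mu>) * integral ?K (Q r) =
       cpow r (1 - ?\<mu>) * P' r
       - ((\<Sum>j\<le>?N. of_real r ^ (2 * j + 2) * B j r)
          - lam * (of_nat n - lam) * (\<Sum>j\<le>?N. of_real r ^ (2 * j) * A j r))"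
      unfolding eventually_at_right_field using eps by blast
  qed
  then show ?thesis unfolding weak_equation_def using eps deriv P_eq by blast
qed

section \<open>Locality of the coefficients and the integral identity\<close>

text \<open>Comparison of the coefficients at the power \<open>M\<close>.  Here \<open>\<sigma> \<kappa> i\<close> is the coefficient of \<open>r\<^sup>i\<close> in
  \<open>\<Sum>\<^sub>j \<kappa>\<^sub>j r^(2j) A\<^sub>j(r)\<close>; the two instances of \<open>\<kappa>\<close> in the conclusion are those that occur in the
  expansions of the flux and of its derivative.\<close>
lemma indicial_identity:
  assumes weak: "weak_equation n lam A B" and M: "M \<le> n"
    and A: "\<And>\<kappa>. (\<lambda>r. (\<Sum>j\<le>n div 2. \<kappa> j * of_real r ^ (2 * j) * A j r)
        - (\<Sum>i\<le>M. \<sigma> \<kappa> i * complex_of_real r ^ i)) \<in> O0 (Suc M)"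
    and B: "(\<lambda>r. \<Sum>j\<le>n div 2. of_real r ^ (2 * j + 2) * B j r) \<in> O0 (Suc M)"
  shows "\<sigma> (\<lambda>_. - (lam * (of_nat n - lam))) M
    = (lam - of_nat n + of_nat M) * \<sigma> (\<lambda>j. lam + 2 * of_nat j) M"
proof -
  let ?A = "\<lambda>r. \<Sum>j\<le>n div 2. of_real r ^ (2 * j) * A j r"
    and ?B = "\<lambda>r. \<Sum>j\<le>n div 2. of_real r ^ (2 * j + 2) * B j r"
    and ?e = "lam * (of_nat n - lam)"
  obtain P P' \<epsilon> where eps: "0 < \<epsilon>"
    and P: "\<And>r. 0 < r \<Longrightarrow> r < \<epsilon> \<Longrightarrow> (P has_vector_derivative P' r) (at r)"
    and Pe: "\<And>r. 0 < r \<Longrightarrow> r < \<epsilon> \<Longrightarrow> cpow r (- (lam - of_nat n)) * P r =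
        (\<Sum>j\<le>n div 2. (lam + 2 * of_nat j) * of_real r ^ (2 * j) * A j r)"
    and P'e: "(\<lambda>r. cpow r (1 - (lam - of_nat n)) * P' r - (?B r - ?e * ?A r)) \<in> O0 (Suc n)"
    using weak unfolding weak_equation_def by blast
  define \<alpha> where "\<alpha> = \<sigma> (\<lambda>j. lam + 2 * of_nat j)"
  define \<beta> where "\<beta> = \<sigma> (\<lambda>_. - ?e)"
  have "\<beta> M = (lam - of_nat n + of_nat M) * \<alpha> M"
  proof (rule derivative_of_expansion[where \<alpha>=\<alpha> and \<beta>=\<beta> and N=M, OF eps P])
    have "\<forall>\<^sub>F r in at_right 0. (\<Sum>j\<le>n div 2. (lam + 2 * of_nat j) * of_real r ^ (2 * j) * A j r) - (\<Sum>i\<le>M. \<alpha> i * complex_of_real r ^ i)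
      = cpow r (- (lam - of_nat n)) * P r - (\<Sum>i\<le>M. \<alpha> i * complex_of_real r ^ i)"
      unfolding eventually_at_right_field using eps Pe by (intro exI[of _ \<epsilon>]) simp
    then show "(\<lambda>r. cpow r (- (lam - of_nat n)) * P r - (\<Sum>i\<le>M. \<alpha> i * complex_of_real r ^ i)) \<in> O0 (Suc M)"
      using A[of "\<lambda>j. lam + 2 * of_nat j", folded \<alpha>_def] by (rule landau_o.big.in_cong[THEN iffD1])
    have "(\<lambda>r. (cpow r (1 - (lam - of_nat n)) * P' r - (?B r - ?e * ?A r))
       + (?B r + ((\<Sum>j\<le>n div 2. - ?e * of_real r ^ (2 * j) * A j r) - (\<Sum>i\<le>M. \<beta> i * complex_of_real r ^ i)))) \<in> O0 (Suc M)"
      by (intro sum_in_bigo(1) B A[of "\<lambda>_. - ?e", folded \<beta>_def] O0_mono[OF P'e]) (use M in simp)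
    moreover have "(\<Sum>j\<le>n div 2. - ?e * of_real r ^ (2 * j) * A j r) = - (?e * ?A r)" for r
      by (simp add: sum_distrib_left sum_negf mult.assoc)
    ultimately show "(\<lambda>r. cpow r (1 - (lam - of_nat n)) * P' r - (\<Sum>i\<le>M. \<beta> i * complex_of_real r ^ i)) \<in> O0 (Suc M)"
      by simp
  qed simp_all
  then show ?thesis unfolding \<alpha>_def \<beta>_def .
qed

text \<open>The expression equals \<open>4m (lam - n/2 + m)\<close>.\<close>
lemma generic_indicial:
  assumes gen: "generic n lam" and ev: "even n" and m: "1 \<le> m" "m \<le> n div 2"
  shows "(lam + 2 * of_nat m) * (lam - of_nat n + of_nat (2 * m)) + lam * (of_nat n - lam) \<noteq> 0"
proof -
  have n: "(of_nat n :: complex) = 2 * of_nat (n div 2)"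
    using ev by (metis dvd_mult_div_cancel of_nat_mult of_nat_numeral)
  have e: "(lam + 2 * of_nat m) * (lam - of_nat n + of_nat (2 * m)) + lam * (of_nat n - lam)
      = 4 * of_nat m * (lam - (of_nat (n div 2) - of_nat m))"
    unfolding n by (simp add: algebra_simps)
  have "lam \<noteq> of_nat (n div 2) - of_nat m" using gen m unfolding generic_def by auto
  then show ?thesis unfolding e using m by simp
qed

lemma flux_integral_bounded:
  fixes hr :: "real \<Rightarrow> ('m, 'n::finite) tensor2" and c :: "('m, 'n) chart"
    and w :: "real^'n \<Rightarrow> complex" and a b :: "real^'n"
  assumes h: "riemannian_metric \<A> h" and pe: "poincare_einstein \<A> h \<epsilon> hr"
    and ho: "holographic_coeffs \<A> h hr v" and c: "c \<in> \<A>"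
    and W: "open W" "W \<subseteq> cimg c" and KW: "cbox a b \<subseteq> W"
    and \<phi>: "smooth_on UNIV \<phi>" and w: "smooth_on W w"
  shows "(\<lambda>r. integral (cbox a b) (\<lambda>x. \<Sum>i\<in>UNIV. \<Sum>k\<in>UNIV.
     (pderivative i \<phi> x * (sqrt (det (hr r c x)) * matrix_inv (hr r c x) $ i $ k)) *\<^sub>R pderivative k w x)) \<in> O0 0"
proof -
  let ?K = "cbox a b"
  let ?F = "\<lambda>r x i k. (pderivative i \<phi> x * (sqrt (det (hr r c x)) * matrix_inv (hr r c x) $ i $ k)) *\<^sub>R pderivative k w x"
  have K: "?K \<subseteq> cimg c" using KW W(2) by blast
  have ex: "metric_expansion \<A> h hr" and met: "\<And>r. 0 < r \<Longrightarrow> r < \<epsilon> \<Longrightarrow> riemannian_metric \<A> (hr r)"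
    using pe unfolding poincare_einstein_def by blast+
  note pc = poincare_einstein_chart[OF pe c W(2)]
  have c\<phi>: "continuous_on ?K (pderivative i \<phi>)" for i
    by (rule continuous_on_subset[OF smooth_on_continuous[OF smooth_on_pderivative[OF \<phi>]] subset_UNIV])
  have cw: "continuous_on ?K (pderivative k w)" for k
    by (rule continuous_on_subset[OF smooth_on_continuous[OF smooth_on_pderivative[OF w]] KW])
  obtain C \<delta> where C: "0 < C" "0 < \<delta>" "\<And>x r i k. x \<in> ?K \<Longrightarrow> 0 < r \<Longrightarrow> r < \<delta> \<Longrightarrow>
      \<bar>sqrt (det (hr r c x)) * matrix_inv (hr r c x) $ i $ k\<bar> \<le> C"
    by (rule inverse_metric_bounded[OF ex ho h c K]) (rule that; blast)
  define g where "g x = (\<Sum>i\<in>UNIV. \<Sum>k\<in>UNIV. \<bar>pderivative i \<phi> x\<bar> * norm (pderivative k w x))" for x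
  have "continuous_on ?K g"
    unfolding g_def[abs_def]
    by (intro continuous_on_sum continuous_on_mult continuous_on_rabs continuous_on_norm c\<phi> cw)
  then obtain G where G: "0 < G" "\<And>x. x \<in> ?K \<Longrightarrow> norm (g x) \<le> G"
    by (rule continuous_on_compact_bound) (rule that; blast)
  show ?thesis
  proof (rule O0_I[of "min \<epsilon> \<delta>" _ "C * G * measure lborel ?K"])
    show "0 < min \<epsilon> \<delta>" using pc(1) C by simp
    fix r assume r: "0 < r" "r < min \<epsilon> \<delta>"
    have smH: "smooth_on (cylinder W \<epsilon>) (\<lambda>p. hr (p $ None) c (base_pt p) $ i $ k)" for i k
      by (intro smooth_on_vec_nth open_cylinder W pc)
    have cI: "continuous_on ?K (\<lambda>x. matrix_inv (hr r c x) $ i $ k)" for i k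
      using smooth_on_fix_r[OF smooth_on_matrix_inv[OF open_cylinder[OF W(1)] smH pc(4)], of r i k] r KW
      by (auto intro: continuous_on_subset)
    have cD: "continuous_on ?K (\<lambda>x. sqrt (det (hr r c x)))"
      by (rule sqrt_det_continuous[OF met c K]) (use r in auto)
    have "norm (integral ?K (\<lambda>x. \<Sum>i\<in>UNIV. \<Sum>k\<in>UNIV. ?F r x i k)) \<le> (C * G) * measure lborel ?K"
    proof (rule integrable_bound)
      show "0 \<le> C * G" using C G by simp
      show "(\<lambda>x. \<Sum>i\<in>UNIV. \<Sum>k\<in>UNIV. ?F r x i k) integrable_on ?K"
        by (intro integrable_continuous continuous_on_sum continuous_on_scaleR continuous_on_mult c\<phi> cw cI cD)
      fix x assume x: "x \<in> ?K"
      have "norm (\<Sum>i\<in>UNIV. \<Sum>k\<in>UNIV. ?F r x i k)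
        \<le> (\<Sum>i\<in>UNIV. \<Sum>k\<in>UNIV. C * (\<bar>pderivative i \<phi> x\<bar> * norm (pderivative k w x)))"
      proof (intro sum_norm_le)
        fix i k
        have "\<bar>sqrt (det (hr r c x)) * matrix_inv (hr r c x) $ i $ k\<bar> * (\<bar>pderivative i \<phi> x\<bar> * norm (pderivative k w x))
           \<le> C * (\<bar>pderivative i \<phi> x\<bar> * norm (pderivative k w x))"
          using C(3)[OF x r(1), of i k] r by (intro mult_right_mono) auto
        then show "norm (?F r x i k) \<le> C * (\<bar>pderivative i \<phi> x\<bar> * norm (pderivative k w x))"
          by (simp only: norm_scaleR abs_mult mult_ac)
      qed
      also have "\<dots> = C * g x" by (simp only: g_def sum_distrib_left)
      also have "\<dots> \<le> C * G" using G(2)[OF x] C(1) by (intro mult_left_mono) auto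
      finally show "norm (\<Sum>i\<in>UNIV. \<Sum>k\<in>UNIV. ?F r x i k) \<le> C * G" .
    qed
    then show "norm (integral ?K (\<lambda>x. \<Sum>i\<in>UNIV. \<Sum>k\<in>UNIV. ?F r x i k)) \<le> C * G * measure lborel ?K * r ^ 0"
      by simp
  qed
qed

text \<open>Induction on \<open>m\<close>.  On \<open>W\<close> the earlier coefficients vanish, so the weak equation with a bump
  function \<open>\<phi>\<close> supported in \<open>W\<close> starts at the power \<open>2m\<close>.  There the tangential terms do not
  contribute, being of order \<open>2m + 2\<close>, and the relation between the leading coefficients is the
  indicial equation for \<open>\<integral> \<phi> u\<^sub>m dvol(h)\<close>.\<close>
lemma solution_coeffs_local:
  fixes hr :: "real \<Rightarrow> ('m, 'n::finite) tensor2" and c :: "('m, 'n) chart"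
    and t :: "nat \<Rightarrow> 'm \<Rightarrow> complex"
  assumes h: "riemannian_metric \<A> h" and pe: "poincare_einstein \<A> h \<epsilon> hr"
    and ho: "holographic_coeffs \<A> h hr v" and sol: "solution_coeffs \<A> hr lam f t"
    and gen: "generic CARD('n) lam" and ev: "even CARD('n)"
    and c: "c \<in> \<A>" and W: "open W" "W \<subseteq> cimg c" and zero: "\<And>y. y \<in> W \<Longrightarrow> f (cinv c y) = 0"
  shows "m \<le> CARD('n) div 2 \<Longrightarrow> y \<in> W \<Longrightarrow> t m (cinv c y) = 0"
proof (induction m arbitrary: y rule: less_induct)
  case (less m)
  let ?n = "CARD('n)" and ?D = "\<lambda>x. sqrt (det (h c x))"
  have dom: "cinv c y \<in> cdom c" if "y \<in> W" for y
    using that W(2) by (auto simp: cimg_def cinv_def cdom_def inv_into_into)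
  show ?case
  proof (cases "m = 0")
    case True
    have "t 0 (cinv c y) = f (cinv c y)"
      using sol c dom[OF less.prems(2)] unfolding solution_coeffs_def by blast
    then show ?thesis using True zero[OF less.prems(2)] by simp
  next
    case False
    have tW: "smooth_on W (t j \<circ> cinv c)" if "j \<le> ?n div 2" for j
    proof -
      have "smooth_on (cimg c) (t j \<circ> cinv c)"
        using sol c that unfolding solution_coeffs_def smooth_fun_def by blast
      then show ?thesis by (rule smooth_on_subset[OF _ W(2)])
    qed
    have earlier: "(t j \<circ> cinv c) x = 0" "pderivative k (t j \<circ> cinv c) x = 0" if "j < m" "x \<in> W" for j x k
    proof -
      have z: "(t j \<circ> cinv c) x = 0" if "x \<in> W" for x
        using less.IH[OF \<open>j < m\<close> _ that] \<open>j < m\<close> less.prems(1) by simp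
      show "(t j \<circ> cinv c) x = 0" by (rule z[OF \<open>x \<in> W\<close>])
      have "pderivative k (t j \<circ> cinv c) x = pderivative k (\<lambda>_. 0) x"
        by (rule pderivative_cong_open[OF W(1) \<open>x \<in> W\<close> z])
      then show "pderivative k (t j \<circ> cinv c) x = 0" by (simp add: pderivative_def)
    qed
    have "?D y *\<^sub>R (t m \<circ> cinv c) y = 0"
    proof (rule vanishes_if_bump_integrals_vanish[where G="\<lambda>y. ?D y *\<^sub>R (t m \<circ> cinv c) y", OF W(1) _ _ less.prems(2)])
      show "continuous_on W (\<lambda>y. ?D y *\<^sub>R (t m \<circ> cinv c) y)"
        by (intro continuous_on_scaleR sqrt_det_continuous[OF h c W(2)] smooth_on_continuous tW less.prems(1))
      fix y0 d and a b :: "real^'n"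
      assume d: "0 < d" "cball y0 d \<subseteq> cbox a b" and KW: "cbox a b \<subseteq> W"
      let ?K = "cbox a b"
      have K: "?K \<subseteq> cimg c" using KW W(2) by blast
      define \<phi> where "\<phi> = bump y0 d"
      have sm\<phi>: "smooth_on UNIV \<phi>" unfolding \<phi>_def by (rule smooth_on_bump)
      have c\<phi>: "continuous_on ?K \<phi>"
        by (rule continuous_on_subset[OF smooth_on_continuous[OF sm\<phi>] subset_UNIV])
      have cw: "continuous_on ?K (t j \<circ> cinv c)" if "j \<le> ?n div 2" for j
        by (rule continuous_on_subset[OF smooth_on_continuous[OF tW[OF that]] KW])
      define AA where "AA j r = integral ?K (\<lambda>x. (\<phi> x * sqrt (det (hr r c x))) *\<^sub>R (t j \<circ> cinv c) x)" for j r
      define BB where "BB j r = integral ?K (\<lambda>x. \<Sum>i\<in>UNIV. \<Sum>k\<in>UNIV.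
         (pderivative i \<phi> x * (sqrt (det (hr r c x)) * matrix_inv (hr r c x) $ i $ k)) *\<^sub>R pderivative k (t j \<circ> cinv c) x)" for j r
      \<comment> \<open>The coefficient of \<open>r^(2k)\<close> in \<open>AA j r\<close>.\<close>
      define aa where "aa j k = integral ?K (\<lambda>x. (\<phi> x * (?D x * v (2*k) (cinv c x))) *\<^sub>R (t j \<circ> cinv c) x)" for j k
      have supp: "\<phi> x = 0 \<or> (\<forall>j\<le>?n div 2. \<forall>k. pderivative k (t j \<circ> cinv c) x = 0)" if "x \<in> W - ?K" for x
        using bump_outside[OF d(1), of x y0] d(2) that unfolding \<phi>_def by blast
      have weak: "weak_equation ?n lam AA BB"
        unfolding AA_def BB_def by (rule weak_eigen_equation[OF h pe ho sol c W(1) KW W(2) sm\<phi> supp])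
      have A0: "AA j r = 0" if "j < m" for j r
      proof -
        have "AA j r = integral ?K (\<lambda>x. 0)"
          unfolding AA_def by (intro Henstock_Kurzweil_Integration.integral_cong) (use earlier(1)[OF that] KW in auto)
        then show ?thesis by simp
      qed
      have B0: "BB j r = 0" if "j < m" for j r
      proof -
        have "BB j r = integral ?K (\<lambda>x. 0)"
          unfolding BB_def
          by (intro Henstock_Kurzweil_Integration.integral_cong) (use earlier(2)[OF that] KW in \<open>auto intro!: sum.neutral\<close>)
        then show ?thesis by simp
      qed
      have A1: "(\<lambda>r. AA j r - aa j 0) \<in> O0 1" if j: "j \<le> ?n div 2" for j
      proof -
        have "(\<lambda>r. (AA j r - (\<Sum>k\<le>?n div 2. aa j k * complex_of_real r ^ (2*k)))
            + (\<Sum>k\<in>{1..?n div 2}. aa j k * complex_of_real r ^ (2*k))) \<in> O0 1"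
        proof (rule sum_in_bigo(1))
          show "(\<lambda>r. AA j r - (\<Sum>k\<le>?n div 2. aa j k * complex_of_real r ^ (2*k))) \<in> O0 1"
            using integral_volume_expansion[OF ho h pe c K c\<phi> cw[OF j]]
            unfolding AA_def aa_def by (rule O0_mono) simp
          show "(\<lambda>r. \<Sum>k\<in>{1..?n div 2}. aa j k * complex_of_real r ^ (2*k)) \<in> O0 1"
          proof (rule big_sum_in_bigo)
            fix k assume "k \<in> {1..?n div 2}"
            then have "1 \<le> 2 * k" by simp
            then show "(\<lambda>r. aa j k * complex_of_real r ^ (2*k)) \<in> O0 1"
              by (intro O0_cmult) (rule O0_mono[OF landau_o.big_refl])
          qed
        qed
        moreover have "{..?n div 2} = insert 0 {1..?n div 2}" by auto
        ultimately show ?thesis by simp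
      qed
      have Abd: "AA j \<in> O0 0" if j: "j \<le> ?n div 2" for j
      proof -
        have "(\<lambda>r. (AA j r - aa j 0) + aa j 0) \<in> O0 0"
          by (rule sum_in_bigo(1)[OF O0_mono[OF A1[OF j]]]) auto
        then show ?thesis by simp
      qed
      have Bbd: "BB j \<in> O0 0" if j: "j \<le> ?n div 2" for j
        unfolding BB_def[abs_def] by (rule flux_integral_bounded[OF h pe ho c W KW sm\<phi> tW[OF j]])
      have Asum: "(\<lambda>r. (\<Sum>j\<le>?n div 2. \<kappa> j * of_real r ^ (2 * j) * AA j r) - \<kappa> m * aa m 0 * of_real r ^ (2 * m)) \<in> O0 (Suc (2 * m))" for \<kappa> :: "nat \<Rightarrow> complex"
      proof -
        have "(\<lambda>r. \<Sum>j\<le>?n div 2. (\<kappa> j * of_real r ^ (2 * j) * AA j r - (if j = m then \<kappa> m * aa m 0 * of_real r ^ (2 * m) else 0))) \<in> O0 (Suc (2 * m))"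
        proof (rule big_sum_in_bigo)
          fix j assume j: "j \<in> {..?n div 2}"
          consider "j < m" | "j = m" | "m < j" by linarith
          then show "(\<lambda>r. \<kappa> j * of_real r ^ (2 * j) * AA j r - (if j = m then \<kappa> m * aa m 0 * of_real r ^ (2 * m) else 0)) \<in> O0 (Suc (2 * m))"
          proof cases
            case 1
            then show ?thesis by (simp add: A0)
          next
            case 2
            have "(\<lambda>r. \<kappa> m * (of_real r ^ (2 * m) * (AA m r - aa m 0))) \<in> O0 (2 * m + 1)"
              by (intro O0_cmult O0_mult_power A1 less.prems(1))
            then show ?thesis using 2 by (simp add: algebra_simps)
          next
            case 3
            have "(\<lambda>r. \<kappa> j * (of_real r ^ (2 * j) * AA j r)) \<in> O0 (2 * j + 0)"
              using j by (intro O0_cmult O0_mult_power Abd) simp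
            then have "(\<lambda>r. \<kappa> j * (of_real r ^ (2 * j) * AA j r)) \<in> O0 (Suc (2 * m))"
              by (rule O0_mono) (use 3 in simp)
            then show ?thesis using 3 by (simp add: mult.assoc)
          qed
        qed
        then show ?thesis using less.prems(1) by (simp add: sum_subtractf)
      qed
      have Bsum: "(\<lambda>r. \<Sum>j\<le>?n div 2. of_real r ^ (2 * j + 2) * BB j r) \<in> O0 (Suc (2 * m))"
      proof (rule big_sum_in_bigo)
        fix j assume j: "j \<in> {..?n div 2}"
        show "(\<lambda>r. of_real r ^ (2 * j + 2) * BB j r) \<in> O0 (Suc (2 * m))"
        proof (cases "j < m")
          case True
          then show ?thesis by (simp add: B0)
        next
          case False
          have "(\<lambda>r. of_real r ^ (2 * j + 2) * BB j r) \<in> O0 (2 * j + 2 + 0)"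
            using j by (intro O0_mult_power Bbd) simp
          then show ?thesis by (rule O0_mono) (use False in simp)
        qed
      qed
      define \<sigma> where "\<sigma> \<kappa> i = (if i = 2 * m then \<kappa> m * aa m 0 else 0)" for \<kappa> :: "nat \<Rightarrow> complex" and i
      have pick: "(\<Sum>i\<le>2 * m. \<sigma> \<kappa> i * complex_of_real r ^ i) = \<kappa> m * aa m 0 * of_real r ^ (2 * m)" for \<kappa> r
        unfolding \<sigma>_def by (subst sum.remove[of _ "2 * m"]) auto
      have "\<sigma> (\<lambda>_. - (lam * (of_nat ?n - lam))) (2 * m)
         = (lam - of_nat ?n + of_nat (2 * m)) * \<sigma> (\<lambda>j. lam + 2 * of_nat j) (2 * m)"
        by (rule indicial_identity[OF weak _ Asum[folded pick] Bsum]) (use less.prems(1) in simp)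
      then have "((lam + 2 * of_nat m) * (lam - of_nat ?n + of_nat (2 * m)) + lam * (of_nat ?n - lam)) * aa m 0 = 0"
        by (simp add: \<sigma>_def algebra_simps)
      then have "aa m 0 = 0"
        using generic_indicial[OF gen ev _ less.prems(1)] False by simp
      moreover have "integral ?K (\<lambda>y. bump y0 d y *\<^sub>R (?D y *\<^sub>R (t m \<circ> cinv c) y)) = aa m 0"
        unfolding aa_def
      proof (rule Henstock_Kurzweil_Integration.integral_cong)
        fix x assume "x \<in> ?K"
        then have "cinv c x \<in> cdom c" using KW dom by blast
        then have "v 0 (cinv c x) = 1" using ho c unfolding holographic_coeffs_def by blast
        then show "bump y0 d x *\<^sub>R (?D x *\<^sub>R (t m \<circ> cinv c) x) = (\<phi> x * (?D x * v (2*0) (cinv c x))) *\<^sub>R (t m \<circ> cinv c) x"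
          by (simp add: \<phi>_def)
      qed
      ultimately show "integral ?K (\<lambda>y. bump y0 d y *\<^sub>R (?D y *\<^sub>R (t m \<circ> cinv c) y)) = 0" by simp
    qed
    moreover have "0 < ?D y" using riemannian_metric_facts(3)[OF h c] less.prems(2) W(2) by auto
    ultimately show ?thesis by simp
  qed
qed

text \<open>Multiplication of the expansions of \<open>F\<^sub>j\<close> by \<open>r^(2j)\<close>; the products of order greater than \<open>n\<close> go
  into the remainder.\<close>
lemma product_expansion:
  fixes F :: "nat \<Rightarrow> real \<Rightarrow> complex"
  assumes F: "\<And>j. j \<le> N \<Longrightarrow> (\<lambda>r. F j r - (\<Sum>k\<le>N. a j k * complex_of_real r ^ (2 * k))) \<in> O0 (Suc n)"
  shows "(\<lambda>r. (\<Sum>j\<le>N. \<kappa> j * of_real r ^ (2 * j) * F j r)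
     - (\<Sum>i\<le>n. (\<Sum>j\<le>N. \<Sum>k\<le>N. if 2 * j + 2 * k = i then \<kappa> j * a j k else 0) * complex_of_real r ^ i)) \<in> O0 (Suc n)"
proof -
  have "(\<lambda>r. \<Sum>j\<le>N. (\<kappa> j * (of_real r ^ (2 * j) * (F j r - (\<Sum>k\<le>N. a j k * complex_of_real r ^ (2 * k))))
     + (\<Sum>k\<le>N. if 2 * j + 2 * k \<le> n then 0 else \<kappa> j * a j k * complex_of_real r ^ (2 * j + 2 * k)))) \<in> O0 (Suc n)"
  proof (intro big_sum_in_bigo sum_in_bigo(1))
    fix j assume j: "j \<in> {..N}"
    have "(\<lambda>r. \<kappa> j * (of_real r ^ (2 * j) * (F j r - (\<Sum>k\<le>N. a j k * complex_of_real r ^ (2 * k))))) \<in> O0 (2 * j + Suc n)"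
      using j by (intro O0_cmult O0_mult_power F) simp
    then show "(\<lambda>r. \<kappa> j * (of_real r ^ (2 * j) * (F j r - (\<Sum>k\<le>N. a j k * complex_of_real r ^ (2 * k))))) \<in> O0 (Suc n)"
      by (rule O0_mono) simp
    fix k
    show "(\<lambda>r. if 2 * j + 2 * k \<le> n then 0 else \<kappa> j * a j k * complex_of_real r ^ (2 * j + 2 * k)) \<in> O0 (Suc n)"
    proof (cases "2 * j + 2 * k \<le> n")
      case False
      have "(\<lambda>r. \<kappa> j * a j k * complex_of_real r ^ (2 * j + 2 * k)) \<in> O0 (Suc n)"
        by (rule O0_cmult[OF O0_mono[OF landau_o.big_refl]]) (use False in simp)
      then show ?thesis using False by simp
    qed simp
  qed
  moreover have "(\<Sum>j\<le>N. (\<kappa> j * (of_real r ^ (2 * j) * (F j r - (\<Sum>k\<le>N. a j k * complex_of_real r ^ (2 * k))))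
     + (\<Sum>k\<le>N. if 2 * j + 2 * k \<le> n then 0 else \<kappa> j * a j k * complex_of_real r ^ (2 * j + 2 * k))))
     = (\<Sum>j\<le>N. \<kappa> j * of_real r ^ (2 * j) * F j r)
     - (\<Sum>i\<le>n. (\<Sum>j\<le>N. \<Sum>k\<le>N. if 2 * j + 2 * k = i then \<kappa> j * a j k else 0) * complex_of_real r ^ i)" for r
  proof -
    have "(\<Sum>i\<le>n. (\<Sum>j\<le>N. \<Sum>k\<le>N. if 2 * j + 2 * k = i then \<kappa> j * a j k else 0) * complex_of_real r ^ i)
       = (\<Sum>i\<le>n. \<Sum>j\<le>N. \<Sum>k\<le>N. if 2 * j + 2 * k = i then \<kappa> j * a j k * complex_of_real r ^ (2 * j + 2 * k) else 0)"
      unfolding sum_distrib_right by (intro sum.cong refl) auto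
    also have "\<dots> = (\<Sum>j\<le>N. \<Sum>i\<le>n. \<Sum>k\<le>N. if 2 * j + 2 * k = i then \<kappa> j * a j k * complex_of_real r ^ (2 * j + 2 * k) else 0)"
      by (rule sum.swap)
    also have "\<dots> = (\<Sum>j\<le>N. \<Sum>k\<le>N. \<Sum>i\<le>n. if 2 * j + 2 * k = i then \<kappa> j * a j k * complex_of_real r ^ (2 * j + 2 * k) else 0)"
      by (intro sum.cong refl sum.swap)
    also have "\<dots> = (\<Sum>j\<le>N. \<Sum>k\<le>N. if 2 * j + 2 * k \<le> n then \<kappa> j * a j k * complex_of_real r ^ (2 * j + 2 * k) else 0)"
      by (intro sum.cong refl) simp
    finally have e: "(\<Sum>i\<le>n. (\<Sum>j\<le>N. \<Sum>k\<le>N. if 2 * j + 2 * k = i then \<kappa> j * a j k else 0) * complex_of_real r ^ i)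
       = (\<Sum>j\<le>N. \<Sum>k\<le>N. if 2 * j + 2 * k \<le> n then \<kappa> j * a j k * complex_of_real r ^ (2 * j + 2 * k) else 0)" .
    show ?thesis
      unfolding e sum_subtractf[symmetric]
    proof (intro sum.cong refl)
      fix j
      have "(\<Sum>k\<le>N. if 2 * j + 2 * k \<le> n then 0 else \<kappa> j * a j k * complex_of_real r ^ (2 * j + 2 * k))
        + (\<Sum>k\<le>N. if 2 * j + 2 * k \<le> n then \<kappa> j * a j k * complex_of_real r ^ (2 * j + 2 * k) else 0)
        = \<kappa> j * (of_real r ^ (2 * j) * (\<Sum>k\<le>N. a j k * complex_of_real r ^ (2 * k)))"
        unfolding sum.distrib[symmetric] sum_distrib_left
        by (intro sum.cong refl) (simp add: power_add mult_ac)
      then show "\<kappa> j * (of_real r ^ (2 * j) * (F j r - (\<Sum>k\<le>N. a j k * complex_of_real r ^ (2 * k))))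
         + (\<Sum>k\<le>N. if 2 * j + 2 * k \<le> n then 0 else \<kappa> j * a j k * complex_of_real r ^ (2 * j + 2 * k))
         = \<kappa> j * of_real r ^ (2 * j) * F j r
         - (\<Sum>k\<le>N. if 2 * j + 2 * k \<le> n then \<kappa> j * a j k * complex_of_real r ^ (2 * j + 2 * k) else 0)"
        by (simp add: right_diff_distrib mult.assoc eq_diff_eq add.assoc)
    qed
  qed
  ultimately show ?thesis by simp
qed

text \<open>The weak equation with \<open>\<phi> = 1\<close>, for which the tangential terms are zero, compared at the power
  \<open>n\<close>: there \<open>(lam - n) + n = lam\<close>, and \<open>v\<^sub>n\<^sub>-\<^sub>2\<^sub>j\<close> is the only coefficient that meets \<open>u\<^sub>j\<close>.\<close>
lemma integral_identity:
  fixes hr :: "real \<Rightarrow> ('m, 'n::finite) tensor2" and c :: "('m, 'n) chart"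
    and t :: "nat \<Rightarrow> 'm \<Rightarrow> complex" and a b :: "real^'n"
  assumes h: "riemannian_metric \<A> h" and pe: "poincare_einstein \<A> h \<epsilon> hr"
    and ho: "holographic_coeffs \<A> h hr v" and sol: "solution_coeffs \<A> hr lam f t"
    and ev: "even CARD('n)" and lam: "lam \<noteq> 0"
    and c: "c \<in> \<A>" and S: "open (cimg c)" and K: "cbox a b \<subseteq> cimg c"
    and supp: "\<And>j x. j \<le> CARD('n) div 2 \<Longrightarrow> x \<in> cimg c - cbox a b \<Longrightarrow> t j (cinv c x) = 0"
  shows "(\<Sum>j\<le>CARD('n) div 2. of_nat (CARD('n) + 2 * j) *
    integral (cbox a b) (\<lambda>x. (sqrt (det (h c x)) * v (CARD('n) - 2 * j) (cinv c x)) *\<^sub>R t j (cinv c x))) = 0"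
proof -
  let ?n = "CARD('n)" and ?D = "\<lambda>x. sqrt (det (h c x))" and ?K = "cbox a b"
  define N where "N = ?n div 2"
  have n: "?n = 2 * N" unfolding N_def using ev by simp
  define AA where "AA j r = integral ?K (\<lambda>x. (1 * sqrt (det (hr r c x))) *\<^sub>R (t j \<circ> cinv c) x)" for j r
  define aa where "aa j k = integral ?K (\<lambda>x. (1 * (?D x * v (2*k) (cinv c x))) *\<^sub>R (t j \<circ> cinv c) x)" for j k
  have d0: "pderivative k (t j \<circ> cinv c) x = 0" if "j \<le> ?n div 2" "x \<in> cimg c - ?K" for j k x
  proof -
    have "open (cimg c - ?K)" using S by (intro open_Diff) auto
    then have "pderivative k (t j \<circ> cinv c) x = pderivative k (\<lambda>_. 0) x"
      by (rule pderivative_cong_open[OF _ that(2)]) (simp add: supp[OF that(1)])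
    then show ?thesis by (simp add: pderivative_def)
  qed
  have p1: "pderivative i (\<lambda>_::real^'n. 1::real) x = 0" for i x by (simp add: pderivative_def)
  define BB where "BB j r = integral ?K (\<lambda>x. \<Sum>i\<in>UNIV. \<Sum>k\<in>UNIV.
     (pderivative i (\<lambda>_. 1) x * (sqrt (det (hr r c x)) * matrix_inv (hr r c x) $ i $ k)) *\<^sub>R pderivative k (t j \<circ> cinv c) x)" for j r
  have B0: "BB j r = 0" for j r by (simp add: BB_def p1)
  have weak: "weak_equation ?n lam AA BB"
    unfolding AA_def BB_def
    by (rule weak_eigen_equation[OF h pe ho sol c S K order_refl smooth_on_const]) (use d0 in blast)
  have tK: "continuous_on ?K (t j \<circ> cinv c)" if "j \<le> N" for j
  proof -
    have "smooth_on (cimg c) (t j \<circ> cinv c)"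
      using sol c that unfolding solution_coeffs_def smooth_fun_def N_def by blast
    then show ?thesis by (rule continuous_on_subset[OF smooth_on_continuous K])
  qed
  have exp: "(\<lambda>r. AA j r - (\<Sum>k\<le>N. aa j k * complex_of_real r ^ (2 * k))) \<in> O0 (Suc ?n)" if "j \<le> N" for j
    using integral_volume_expansion[OF ho h pe c K continuous_on_const[of _ 1] tK[OF that]]
    unfolding AA_def aa_def N_def .
  define \<sigma> where "\<sigma> \<kappa> i = (\<Sum>j\<le>N. \<Sum>k\<le>N. if 2 * j + 2 * k = i then \<kappa> j * aa j k else 0)" for \<kappa> :: "nat \<Rightarrow> complex" and i
  have \<sigma>: "\<sigma> (\<lambda>_. - (lam * (of_nat ?n - lam))) ?n = (lam - of_nat ?n + of_nat ?n) * \<sigma> (\<lambda>j. lam + 2 * of_nat j) ?n"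
  proof (rule indicial_identity[OF weak order_refl])
    show "(\<lambda>r. (\<Sum>j\<le>?n div 2. \<kappa> j * of_real r ^ (2 * j) * AA j r) - (\<Sum>i\<le>?n. \<sigma> \<kappa> i * complex_of_real r ^ i)) \<in> O0 (Suc ?n)" for \<kappa>
      unfolding \<sigma>_def N_def[symmetric] by (rule product_expansion[OF exp])
  qed (simp add: B0)
  \<comment> \<open>At the power \<open>n\<close> only \<open>k = n/2 - j\<close> contributes.\<close>
  have inner: "(\<Sum>k\<le>N. if 2 * j + 2 * k = ?n then \<kappa> * aa j k else 0) = \<kappa> * aa j (N - j)" if "j \<le> N" for j \<kappa>
  proof -
    have "(\<Sum>k\<le>N. if 2 * j + 2 * k = ?n then \<kappa> * aa j k else 0) = (\<Sum>k\<le>N. if k = N - j then \<kappa> * aa j k else 0)"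
      using that by (intro sum.cong refl if_cong) (auto simp: n)
    then show ?thesis by simp
  qed
  have "\<sigma> \<kappa> ?n = (\<Sum>j\<le>N. \<kappa> j * aa j (N - j))" for \<kappa>
    unfolding \<sigma>_def by (intro sum.cong refl inner) simp
  with \<sigma> have "(\<Sum>j\<le>N. - (lam * (of_nat ?n - lam)) * aa j (N - j)) = lam * (\<Sum>j\<le>N. (lam + 2 * of_nat j) * aa j (N - j))"
    by simp
  then have "(\<Sum>j\<le>N. lam * ((lam + 2 * of_nat j) * aa j (N - j)) - - (lam * (of_nat ?n - lam)) * aa j (N - j)) = 0"
    unfolding sum_subtractf sum_distrib_left by simp
  moreover have "lam * ((lam + 2 * of_nat j) * aa j (N - j)) - - (lam * (of_nat ?n - lam)) * aa j (N - j)
     = lam * (of_nat (?n + 2 * j) * aa j (N - j))" for j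
    by (simp add: algebra_simps)
  ultimately have "lam * (\<Sum>j\<le>N. of_nat (?n + 2 * j) * aa j (N - j)) = 0"
    by (simp only: sum_distrib_left)
  then have "(\<Sum>j\<le>N. of_nat (?n + 2 * j) * aa j (N - j)) = 0" using lam by simp
  moreover have "aa j (N - j) = integral ?K (\<lambda>x. (?D x * v (?n - 2 * j) (cinv c x)) *\<^sub>R t j (cinv c x))" for j
    unfolding aa_def by (simp add: n diff_mult_distrib2)
  ultimately show ?thesis by (simp add: N_def)
qed

lemma smooth_fun_continuous:
  "smooth_fun A f \<Longrightarrow> c \<in> A \<Longrightarrow> continuous_on (cimg c) (f \<circ> cinv c)"
  unfolding smooth_fun_def using smooth_on_continuous by blast

theorem theorem2p2:
  fixes X :: "'m topology"
    and A :: "('m, 'n::finite) chart set"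
    and h :: "('m, 'n) tensor2"
    and hr :: "real \<Rightarrow> ('m, 'n) tensor2"
    and \<epsilon> :: real
    and v :: "nat \<Rightarrow> 'm \<Rightarrow> real"
    and T Ts :: "nat \<Rightarrow> complex \<Rightarrow> ('m \<Rightarrow> complex) \<Rightarrow> 'm \<Rightarrow> complex"
    and \<mu> :: "'m measure"
    and n :: nat
  assumes "n = CARD('n)" and "even n" and "n \<ge> 2"
    and "riemannian_manifold X A h"
    and "poincare_einstein A h \<epsilon> hr"
    and "holographic_coeffs A h hr v"
    and "solution_operators A hr T"
    and "volume_measure X A h \<mu>"
    and "\<And>j lam. j \<le> n div 2 \<Longrightarrow> generic n lam \<Longrightarrow> formal_adjoint X A \<mu> (T j lam) (Ts j lam)"
  shows "\<forall>x\<in>topspace X. \<exists>p :: complex poly.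
           (\<forall>lam. generic n lam \<longrightarrow> poly p lam = calV n Ts v lam x) \<and> (\<forall>lam. poly p lam = 0)"
proof
  fix z assume z: "z \<in> topspace X"
  have M: "smooth_manifold X A" and h: "riemannian_metric A h"
    using assms(4) unfolding riemannian_manifold_def by auto
  have "calV n Ts v lam z = 0" if gen: "generic n lam" for lam
  proof -
    define N where "N = n div 2"
    have n: "n = 2 * N" unfolding N_def using assms(2) by simp
    have N1: "1 \<le> N" using assms(3) n by simp
    \<comment> \<open>\<open>0 = n/2 - n/2\<close> is one of the values that are not generic.\<close>
    have lam0: "lam \<noteq> 0"
    proof -
      have "lam \<noteq> of_nat (n div 2) - of_nat N"
        using gen N1 unfolding generic_def N_def by (metis atLeastAtMost_iff order_refl)
      then show ?thesis by (simp add: N_def)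
    qed
    define V where "V j = (\<lambda>y. complex_of_real (v (n - 2 * j) y))" for j
    have smV: "smooth_fun A (V j)" if "j \<le> N" for j
      unfolding smooth_fun_def
    proof
      fix e assume e: "e \<in> A"
      have "n - 2 * j = 2 * (N - j)" "N - j \<le> CARD('n) div 2" using n assms(1) by (auto simp: diff_mult_distrib2)
      then have "smooth_on (cimg e) (v (n - 2 * j) \<circ> cinv e)"
        using assms(6) e unfolding holographic_coeffs_def smooth_fun_def by simp
      from smooth_on_bounded_linear[OF bounded_linear_of_real chart_open_img[OF M e] this]
      show "smooth_on (cimg e) (V j \<circ> cinv e)" by (simp add: V_def o_def)
    qed
    have adj: "formal_adjoint X A \<mu> (T j lam) (Ts j lam)" if "j \<le> N" for j
      using assms(9)[of j lam] that gen by (simp add: N_def)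
    have smTs: "smooth_fun A (Ts j lam (V j))" if "j \<le> N" for j
      using adj[OF that] smV[OF that] unfolding formal_adjoint_def by blast
    \<comment> \<open>The sum in \<open>\<V>\<^sub>n(lam)\<close>, to be integrated against bump functions in a chart around \<open>z\<close>.\<close>
    define W where "W y = (\<Sum>j\<le>N. of_nat (n + 2 * j) * Ts j lam (V j) y)" for y
    have "z \<in> (\<Union>c\<in>A. cdom c)" using z M unfolding smooth_manifold_def by simp
    then obtain c where c: "c \<in> A" "z \<in> cdom c" by blast
    let ?S = "cimg c" and ?D = "\<lambda>x. sqrt (det (h c x))"
    note ch = chart_facts[OF M c(1)]
    have cTs: "continuous_on ?S (Ts j lam (V j) \<circ> cinv c)" if "j \<le> N" for j
      by (rule smooth_fun_continuous[OF smTs[OF that] c(1)])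
    have y: "snd c z \<in> ?S" by (rule chart_in[OF M c])
    have "?D (snd c z) *\<^sub>R W (cinv c (snd c z)) = 0"
    proof (rule vanishes_if_bump_integrals_vanish[where G="\<lambda>x. ?D x *\<^sub>R W (cinv c x)", OF chart_open_img[OF M c(1)] _ _ y])
      have "continuous_on ?S (\<lambda>x. ?D x *\<^sub>R (\<Sum>j\<le>N. of_nat (n + 2 * j) * (Ts j lam (V j) \<circ> cinv c) x))"
        by (intro continuous_on_scaleR sqrt_det_continuous[OF h c(1) order_refl] continuous_on_sum
            continuous_on_mult continuous_on_const cTs) auto
      then show "continuous_on ?S (\<lambda>x. ?D x *\<^sub>R W (cinv c x))" by (simp add: W_def)
      fix y0 d and a b :: "real^'n"
      assume d: "0 < d" "cball y0 d \<subseteq> cbox a b" and K: "cbox a b \<subseteq> ?S"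
      let ?K = "cbox a b"
      define f where "f = chart_bump c y0 d"
      have smf: "smooth_fun A f" unfolding f_def by (rule smooth_fun_chart_bump[OF M c(1) d K])
      have csf: "compact_support X f" unfolding f_def by (rule compact_support_chart_bump[OF M c(1) d K])
      have f0: "f p = 0" if "p \<notin> cinv c ` ?K" for p
        unfolding f_def by (rule chart_bump_outside[OF M c(1) d that])
      have genn: "generic CARD('n) lam" using gen assms(1) by simp
      have evn: "even CARD('n)" using assms(1,2) by simp
      have sol: "solution_coeffs A hr lam f (\<lambda>j. T j lam f)"
        using assms(7) genn smf unfolding solution_operators_def by blast
      \<comment> \<open>Outside the box, \<open>f\<close> vanishes near every point, and locality applies in a chart around it.\<close>
      have t0: "T j lam f p = 0" if j: "j \<le> N" and p: "p \<in> topspace X" "p \<notin> cinv c ` ?K" for j p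
      proof -
        have "p \<in> (\<Union>c\<in>A. cdom c)" using p(1) M unfolding smooth_manifold_def by simp
        then obtain e where e: "e \<in> A" "p \<in> cdom e" by blast
        let ?W = "snd e ` (cdom e \<inter> (topspace X - cinv c ` ?K))"
        have "openin X (topspace X - cinv c ` ?K)"
          using chart_box_compactin(2)[OF M c(1) K] by blast
        then have oW: "open ?W" by (rule chart_open_image[OF M e(1)])
        have WS: "?W \<subseteq> cimg e" using chart_in[OF M e(1)] by blast
        have zero: "f (cinv e q) = 0" if q: "q \<in> ?W" for q
        proof -
          obtain p' where "p' \<in> cdom e" "p' \<notin> cinv c ` ?K" "q = snd e p'" using q by blast
          then show ?thesis using chart_left_inv[OF M e(1)] f0 by simp
        qed
        have "snd e p \<in> ?W" using e(2) p by blast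
        then have "T j lam f (cinv e (snd e p)) = 0"
          using solution_coeffs_local[OF h assms(5,6) sol genn evn e(1) oW WS zero] j assms(1) by (simp add: N_def)
        then show ?thesis using chart_left_inv[OF M e] by simp
      qed
      have smT: "smooth_fun A (T j lam f)" if "j \<le> N" for j
        using sol that assms(1) unfolding solution_coeffs_def N_def by blast
      have swap: "integral ?K (\<lambda>x. (?D x * v (n - 2 * j) (cinv c x)) *\<^sub>R T j lam f (cinv c x))
         = integral ?K (\<lambda>x. ?D x *\<^sub>R (f (cinv c x) * Ts j lam (V j) (cinv c x)))" if j: "j \<le> N" for j
      proof -
        have cont: "continuous_on ?S ((\<lambda>x. g1 x * g2 x) \<circ> cinv c)" if "smooth_fun A g1" "smooth_fun A g2" for g1 g2 :: "'m \<Rightarrow> complex"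
        proof -
          have "continuous_on ?S (\<lambda>x. (g1 \<circ> cinv c) x * (g2 \<circ> cinv c) x)"
            by (rule continuous_on_mult[OF smooth_fun_continuous[OF that(1) c(1)] smooth_fun_continuous[OF that(2) c(1)]])
          then show ?thesis by (simp add: o_def)
        qed
        have "integral ?K (\<lambda>x. (?D x * v (n - 2 * j) (cinv c x)) *\<^sub>R T j lam f (cinv c x))
           = integral ?K (\<lambda>x. ?D x *\<^sub>R (T j lam f (cinv c x) * V j (cinv c x)))"
          by (simp add: V_def scaleR_conv_of_real mult_ac)
        also have "\<dots> = (LINT p|\<mu>. T j lam f p * V j p)"
          by (rule integral_in_chart[OF M c(1) assms(8) h cont[OF smT[OF j] smV[OF j]] K, symmetric])
             (simp add: t0[OF j])
        also have "\<dots> = (LINT p|\<mu>. f p * Ts j lam (V j) p)"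
          using adj[OF j] smf csf smV[OF j] unfolding formal_adjoint_def by blast
        also have "\<dots> = integral ?K (\<lambda>x. ?D x *\<^sub>R (f (cinv c x) * Ts j lam (V j) (cinv c x)))"
          by (rule integral_in_chart[OF M c(1) assms(8) h cont[OF smf smTs[OF j]] K]) (simp add: f0)
        finally show ?thesis .
      qed
      have supp: "T j lam f (cinv c x) = 0" if "j \<le> CARD('n) div 2" "x \<in> ?S - ?K" for j x
      proof (rule t0)
        show "j \<le> N" using that assms(1) by (simp add: N_def)
        show "cinv c x \<in> topspace X" using chart_cinv_in[OF M c(1), of x] chart_dom_sub[OF M c(1)] that(2) by blast
        show "cinv c x \<notin> cinv c ` ?K"
        proof
          assume "cinv c x \<in> cinv c ` ?K"
          then obtain x' where x': "x' \<in> ?K" "cinv c x = cinv c x'" by blast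
          then have "snd c (cinv c x) = snd c (cinv c x')" by simp
          then have "x = x'" using chart_right_inv[OF M c(1)] x'(1) K that(2) by auto
          then show False using that(2) x'(1) by simp
        qed
      qed
      have "(\<Sum>j\<le>N. of_nat (n + 2 * j) * integral ?K (\<lambda>x. ?D x *\<^sub>R (f (cinv c x) * Ts j lam (V j) (cinv c x)))) = 0"
      proof -
        have "(\<Sum>j\<le>N. of_nat (n + 2 * j) * integral ?K (\<lambda>x. (?D x * v (n - 2 * j) (cinv c x)) *\<^sub>R T j lam f (cinv c x))) = 0"
          using integral_identity[OF h assms(5,6) sol evn lam0 c(1) chart_open_img[OF M c(1)] K supp]
          unfolding N_def assms(1) .
        moreover have "(\<Sum>j\<le>N. of_nat (n + 2 * j) * integral ?K (\<lambda>x. (?D x * v (n - 2 * j) (cinv c x)) *\<^sub>R T j lam f (cinv c x)))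
          = (\<Sum>j\<le>N. of_nat (n + 2 * j) * integral ?K (\<lambda>x. ?D x *\<^sub>R (f (cinv c x) * Ts j lam (V j) (cinv c x))))"
          by (intro sum.cong refl arg_cong2[of _ _ _ _ "(*)"] swap) simp
        ultimately show ?thesis by simp
      qed
      also have "(\<Sum>j\<le>N. of_nat (n + 2 * j) * integral ?K (\<lambda>x. ?D x *\<^sub>R (f (cinv c x) * Ts j lam (V j) (cinv c x))))
        = integral ?K (\<lambda>x. \<Sum>j\<in>{..N}. of_nat (n + 2 * j) * (?D x *\<^sub>R (f (cinv c x) * Ts j lam (V j) (cinv c x))))"
      proof (rule integral_lincomb[symmetric])
        fix j assume "j \<in> {..N}"
        then have j: "j \<le> N" by simp
        have "continuous_on ?K (\<lambda>x. ?D x *\<^sub>R ((f \<circ> cinv c) x * (Ts j lam (V j) \<circ> cinv c) x))"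
          by (intro continuous_on_scaleR sqrt_det_continuous[OF h c(1) K] continuous_on_mult
              continuous_on_subset[OF smooth_fun_continuous[OF smf c(1)] K] continuous_on_subset[OF cTs[OF j] K])
        then show "continuous_on ?K (\<lambda>x. ?D x *\<^sub>R (f (cinv c x) * Ts j lam (V j) (cinv c x)))" by simp
      qed simp
      also have "\<dots> = integral ?K (\<lambda>x. bump y0 d x *\<^sub>R (?D x *\<^sub>R W (cinv c x)))"
      proof (rule Henstock_Kurzweil_Integration.integral_cong)
        fix x assume "x \<in> ?K"
        then have x: "x \<in> ?S" using K by blast
        have "f (cinv c x) = of_real (bump y0 d x)"
          using chart_cinv_in[OF M c(1) x] chart_right_inv[OF M c(1) x] by (simp add: f_def chart_bump_def)
        then show "(\<Sum>j\<in>{..N}. of_nat (n + 2 * j) * (?D x *\<^sub>R (f (cinv c x) * Ts j lam (V j) (cinv c x))))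
           = bump y0 d x *\<^sub>R (?D x *\<^sub>R W (cinv c x))"
          unfolding W_def scaleR_sum_right by (intro sum.cong refl) (simp add: scaleR_conv_of_real mult_ac)
      qed
      finally show "integral ?K (\<lambda>x. bump y0 d x *\<^sub>R (?D x *\<^sub>R W (cinv c x))) = 0" by simp
    qed
    moreover have "0 < ?D (snd c z)" using riemannian_metric_facts(3)[OF h c(1) y] by simp
    ultimately have "W z = 0" using chart_left_inv[OF M c] by simp
    then show ?thesis unfolding calV_def W_def V_def N_def by simp
  qed
  then show "\<exists>p :: complex poly. (\<forall>lam. generic n lam \<longrightarrow> poly p lam = calV n Ts v lam z) \<and> (\<forall>lam. poly p lam = 0)"
    by (intro exI[of _ 0]) simp
qed

end
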